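(* Let $q=3^t$ with $t\ge 1$, put $m=q/3$, and let $Z_3=\mathbb{F}_{q^2}(x,y)$ be the function field defined by $x^q+x+(y+y^3+\cdots+y^{q/3})^2=0$. Let $P$ be a rational place of $Z_3$ satisfying $\beta(P)=1$. Then $$H(P)=\langle q,\ q+1,\ (q-1)+j(q-2)\ \mid\ j=0,\ldots,m-1\rangle .$$
   Context: $Z_3$ is a function field with full constant field $\mathbb{F}_{q^2}$ and genus $q(q-1)/6$. The functions $x$ and $y$ have a unique common pole $P_\infty$, a rational place, and no other poles. The rational places other than $P_\infty$ are the places $P_{(a,b)}$, uniquely determined by $x(P)=a$, $y(P)=b$, where $(a,b)\in\mathbb{F}_{q^2}^2$ satisfies $a^q+a+(b+b^3+\cdots+b^{q/3})^2=0$. Define $\beta(P_{(a,b)})=(b+b^3+\cdots+b^{q/3})^2=-(a^q+a)$ and $\beta(P_\infty)=\infty$. For a rational place $P$, the Weierstrass semigroup $H(P)$ is the set of non-negative integers $n$ for which there exists a function with pole divisor exactly $nP$. The notation $\langle\cdots\rangle$ denotes the submonoid of $(\mathbb{Z}_{\ge 0},+)$ generated by the listed elements. *)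

theory Defs
  imports Complex_Main "HOL-Computational_Algebra.Polynomial"
begin

section \<open>Algebraic function fields\<close>

text \<open>
  The function field is the whole type \<open>'f\<close>; the constant field is a subset \<open>K\<close> of it.
\<close>

definition is_subfield :: "'f::field set \<Rightarrow> bool" where
  "is_subfield K \<longleftrightarrow> 0 \<in> K \<and> 1 \<in> K \<and>
     (\<forall>a\<in>K. \<forall>b\<in>K. a - b \<in> K \<and> a * b \<in> K) \<and> (\<forall>a\<in>K. inverse a \<in> K)"

definition adjoin :: "'f::field set \<Rightarrow> 'f set \<Rightarrow> 'f set" where
  "adjoin K S = is_subfield hull (K \<union> S)"

definition transcendental_over :: "'f::field set \<Rightarrow> 'f \<Rightarrow> bool" where
  "transcendental_over K z \<longleftrightarrow>
     (\<forall>p :: 'f poly. p \<noteq> 0 \<longrightarrow> set (coeffs p) \<subseteq> K \<longrightarrow> poly p z \<noteq> 0)"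

definition finite_over :: "'f::field set \<Rightarrow> bool" where
  "finite_over L \<longleftrightarrow>
     (\<exists>B. finite B \<and> (\<forall>f. \<exists>c. c ` B \<subseteq> L \<and> f = (\<Sum>b\<in>B. c b * b)))"

definition function_field :: "'f::field set \<Rightarrow> bool" where
  "function_field K \<longleftrightarrow> is_subfield K \<and>
     (\<exists>z. transcendental_over K z \<and> finite_over (adjoin K {z}))"

section \<open>Places\<close>

text \<open>
  A place of \<open>'f\<close> over \<open>K\<close> is represented by its normalized discrete valuation. The value at
  \<open>0\<close>, mathematically infinite, is fixed to be the dummy integer \<open>0\<close>, so that distinct
  functions are distinct places; every use below treats the argument \<open>0\<close> separately.
\<close>

type_synonym 'f place = "'f \<Rightarrow> int"

definition is_place :: "'f::field set \<Rightarrow> 'f place \<Rightarrow> bool" where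
  "is_place K v \<longleftrightarrow> v 0 = 0 \<and>
     (\<forall>a b. a \<noteq> 0 \<longrightarrow> b \<noteq> 0 \<longrightarrow> v (a * b) = v a + v b) \<and>
     (\<forall>a b. a \<noteq> 0 \<longrightarrow> b \<noteq> 0 \<longrightarrow> a + b \<noteq> 0 \<longrightarrow> min (v a) (v b) \<le> v (a + b)) \<and>
     (\<forall>c\<in>K. c \<noteq> 0 \<longrightarrow> v c = 0) \<and>
     (\<exists>a. a \<noteq> 0 \<and> v a = 1)"

definition valuation_ring :: "'f::field place \<Rightarrow> 'f set" where
  "valuation_ring v = {z. z = 0 \<or> 0 \<le> v z}"

definition maximal_ideal :: "'f::field place \<Rightarrow> 'f set" where
  "maximal_ideal v = {z. z = 0 \<or> 0 < v z}"

text \<open>Rational means that \<open>K\<close> maps onto the residue class field, i.e. the degree is one.\<close>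

definition rational_place :: "'f::field set \<Rightarrow> 'f place \<Rightarrow> bool" where
  "rational_place K v \<longleftrightarrow> is_place K v \<and>
     (\<forall>z\<in>valuation_ring v. \<exists>c\<in>K. z - c \<in> maximal_ideal v)"

text \<open>
  The value \<open>z(P)\<close>, where the residue class field of the rational place \<open>P\<close> is identified with
  \<open>K\<close>; meaningful only if \<open>z\<close> has no pole at \<open>P\<close>.
\<close>

definition value_at :: "'f::field set \<Rightarrow> 'f \<Rightarrow> 'f place \<Rightarrow> 'f" where
  "value_at K z P = (THE c. c \<in> K \<and> z - c \<in> maximal_ideal P)"

section \<open>Weierstrass semigroups\<close>

text \<open>The pole divisor of a nonzero function, as the family of its coefficients.\<close>

definition pole_divisor :: "'f::field set \<Rightarrow> 'f \<Rightarrow> 'f place \<Rightarrow> int" where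
  "pole_divisor K z = (\<lambda>Q. if is_place K Q then max 0 (- Q z) else 0)"

definition point_divisor :: "nat \<Rightarrow> 'f place \<Rightarrow> 'f place \<Rightarrow> int" where
  "point_divisor n P = (\<lambda>Q. if Q = P then int n else 0)"

definition weierstrass_semigroup :: "'f::field set \<Rightarrow> 'f place \<Rightarrow> nat set" where
  "weierstrass_semigroup K P = {n. \<exists>z. z \<noteq> 0 \<and> pole_divisor K z = point_divisor n P}"

definition is_submonoid :: "nat set \<Rightarrow> bool" where
  "is_submonoid M \<longleftrightarrow> 0 \<in> M \<and> (\<forall>a\<in>M. \<forall>b\<in>M. a + b \<in> M)"

definition submonoid_generated :: "nat set \<Rightarrow> nat set" where
  "submonoid_generated S = is_submonoid hull S"

section \<open>The function field \<open>Z\<^sub>3\<close>\<close>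

text \<open>With \<open>q = 3 ^ t\<close> this is \<open>y + y^3 + \<dots> + y^(q/3)\<close>.\<close>

definition trace_sum :: "nat \<Rightarrow> 'f::field \<Rightarrow> 'f" where
  "trace_sum t y = (\<Sum>i<t. y ^ (3 ^ i))"

definition Z3_function_field :: "nat \<Rightarrow> 'f::field set \<Rightarrow> 'f \<Rightarrow> 'f \<Rightarrow> bool" where
  "Z3_function_field t K x y \<longleftrightarrow>
     function_field K \<and> card K = (3 ^ t)\<^sup>2 \<and> adjoin K {x, y} = UNIV \<and>
     x ^ (3 ^ t) + x + (trace_sum t y)\<^sup>2 = 0"

text \<open>
  The value \<open>\<infinity>\<close> is \<open>None\<close>; the only pole of \<open>y\<close> is \<open>P\<^sub>\<infinity>\<close>.
\<close>

definition beta :: "nat \<Rightarrow> 'f::field set \<Rightarrow> 'f \<Rightarrow> 'f place \<Rightarrow> 'f option" where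
  "beta t K y P =
     (if y \<in> valuation_ring P then Some ((trace_sum t (value_at K y P))\<^sup>2) else None)"

end

theory Submission
  imports Defs
begin

text \<open>
  Put \<open>\<epsilon> = trace_sum t b\<close> for \<open>b = y(P)\<close>, so that \<open>\<epsilon> = 1\<close> or \<open>\<epsilon> = - 1\<close>. In the coordinates \<open>X = x - x(P)\<close>
  and \<open>Y = - \<epsilon> (y - b)\<close> the curve is \<open>X ^ q + X + T\<^sup>2 + T = 0\<close> with \<open>T = Y + Y ^ 3 + \<dots> + Y ^ (q/3)\<close>, and
  \<open>P\<close> is the origin. Everything rests on the cubic \<open>\<tau> = X ^ 3 - X\<^sup>2 + Y\<^sup>2\<close>. It satisfies
  \<open>\<tau> ^ q + \<tau> + X ^ (q + 1) + Y ^ (q + 1) = 0\<close>, which gives it a zero of order \<open>q + 1\<close> at \<open>P\<close>, a pole of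
  order \<open>q + 1\<close> at infinity, and no other zeros or poles (lemmas \<open>P_tau\<close>, \<open>infinite_place_vals\<close> and
  \<open>tau_zero_unique\<close>).

  A function with a pole at infinity only therefore becomes, after division by a power of \<open>\<tau>\<close>, a
  function with a pole at \<open>P\<close> only. To get the generators one needs functions with a high zero at \<open>P\<close>.
  Up to order about \<open>q\<close> the curve agrees at \<open>P\<close> with one branch of the nodal cubic \<open>\<tau> = 0\<close>, on which the
  slope \<open>s = Y / X\<close> is a parameter: \<open>X = 1 - s\<^sup>2\<close> and \<open>Y = s - s ^ 3\<close>, and the branch is at \<open>s = - 1\<close>. The
  polynomials in \<open>X\<close> and \<open>Y\<close> of degree \<open>k\<close> contain one that restricts to \<open>(1 + s) ^ (3 k - 1) (1 - s)\<close>
  on the cubic, and it has order \<open>3 k - 1\<close> at \<open>P\<close> (lemma \<open>node_order\<close>). Its quotient by \<open>\<tau> ^ k\<close> has the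
  pole order \<open>(q - 1) + (k - 1) (q - 2)\<close>.

  For the other inclusion, every number outside the semigroup is shown to be a gap by duality. The
  differential \<open>dY\<close> has no zeros or poles at finite places and order \<open>2 g - 2\<close> at infinity, where
  \<open>2 g - 2 = (q + 1) (m - 1) + m - 1\<close>. Products of powers of \<open>\<tau>\<close> with functions of small degree yield,
  for each such number \<open>n\<close>, a function \<open>F\<close> of order \<open>n - 1\<close> at \<open>P\<close> whose pole at infinity has order at
  most \<open>2 g - 2\<close> (lemma \<open>function_of_order\<close>). If \<open>z\<close> had the pole divisor \<open>n P\<close>, then \<open>F z dY\<close> would
  have just one pole, a simple one, which contradicts the residue theorem. The residue theorem is
  proved in the form that is needed (lemma \<open>no_simple_pole\<close>): the field is Galois over \<open>K(Y)\<close>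
  with group \<open>X \<mapsto> X + \<alpha>\<close>, \<open>\<alpha> ^ q = - \<alpha>\<close>, the trace is the coefficient of \<open>X ^ (q - 1)\<close>, and the
  functions \<open>X ^ i \<tau> ^ j\<close> with \<open>i < 3\<close> and \<open>j < m\<close> are a basis over \<open>K(Y)\<close> with pairwise different pole
  orders modulo \<open>q\<close>.

  Both the trace argument and the place at infinity need places that are not given in advance. They are
  obtained from valuation rings that Zorn's lemma provides; these are discrete because
  the field is finite over \<open>K(Y)\<close> (theorem \<open>place_exists\<close>).
\<close>

section \<open>Subrings, subfields and polynomials with coefficients in them\<close>

definition is_subring :: "'f::field set \<Rightarrow> bool" where
  "is_subring A \<longleftrightarrow> 1 \<in> A \<and> (\<forall>a\<in>A. \<forall>b\<in>A. a - b \<in> A \<and> a * b \<in> A)"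

lemma is_subringI:
  assumes "1 \<in> A" "\<And>a b. a \<in> A \<Longrightarrow> b \<in> A \<Longrightarrow> a - b \<in> A"
    "\<And>a b. a \<in> A \<Longrightarrow> b \<in> A \<Longrightarrow> a * b \<in> A"
  shows "is_subring A"
  using assms by (auto simp: is_subring_def)

lemma
  assumes "is_subring A"
  shows subring_1: "1 \<in> A"
    and subring_diff: "a \<in> A \<Longrightarrow> b \<in> A \<Longrightarrow> a - b \<in> A"
    and subring_mult: "a \<in> A \<Longrightarrow> b \<in> A \<Longrightarrow> a * b \<in> A"
  using assms by (auto simp: is_subring_def)

lemma subring_0: "is_subring A \<Longrightarrow> 0 \<in> A"
  using subring_diff[of A 1 1] subring_1 by force

lemma subring_uminus: "is_subring A \<Longrightarrow> a \<in> A \<Longrightarrow> - a \<in> A"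
  using subring_diff[of A 0 a] subring_0 by force

lemma subring_add: "is_subring A \<Longrightarrow> a \<in> A \<Longrightarrow> b \<in> A \<Longrightarrow> a + b \<in> A"
  using subring_diff[of A a "- b"] subring_uminus by force

lemma subring_power: "is_subring A \<Longrightarrow> a \<in> A \<Longrightarrow> a ^ n \<in> A"
  by (induction n) (auto intro: subring_1 subring_mult)

lemma subring_sum: "is_subring A \<Longrightarrow> (\<And>i. i \<in> I \<Longrightarrow> f i \<in> A) \<Longrightarrow> sum f I \<in> A"
  by (induction I rule: infinite_finite_induct) (auto intro: subring_0 subring_add)

lemma subfield_subring: "is_subfield K \<Longrightarrow> is_subring K"
  by (auto simp: is_subfield_def is_subring_def)

lemma subfield_inverse: "is_subfield K \<Longrightarrow> a \<in> K \<Longrightarrow> inverse a \<in> K"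
  by (auto simp: is_subfield_def)

lemma subfield_divide: "is_subfield K \<Longrightarrow> a \<in> K \<Longrightarrow> b \<in> K \<Longrightarrow> a / b \<in> K"
  by (auto simp: is_subfield_def divide_inverse)

definition polys :: "'f::field set \<Rightarrow> 'f poly set" where
  "polys A = {p. \<forall>i. coeff p i \<in> A}"

lemma polysI: "(\<And>i. coeff p i \<in> A) \<Longrightarrow> p \<in> polys A"
  by (simp add: polys_def)

lemma polys_coeff: "p \<in> polys A \<Longrightarrow> coeff p i \<in> A"
  by (simp add: polys_def)

lemma polys_coeffs: "0 \<in> A \<Longrightarrow> p \<in> polys A \<longleftrightarrow> set (coeffs p) \<subseteq> A"
proof -
  assume "0 \<in> A"
  moreover have "p \<in> polys A \<longleftrightarrow> range (coeff p) \<subseteq> A" by (auto simp: polys_def)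
  ultimately show ?thesis by (simp add: range_coeff)
qed

lemma polys_mono: "A \<subseteq> B \<Longrightarrow> polys A \<subseteq> polys B"
  by (auto simp: polys_def)

lemma polys_pCons:
  "is_subring A \<Longrightarrow> c \<in> A \<Longrightarrow> p \<in> polys A \<Longrightarrow> pCons c p \<in> polys A"
  by (auto simp: polys_def coeff_pCons split: nat.split)

lemma polys_0: "is_subring A \<Longrightarrow> 0 \<in> polys A"
  by (auto simp: polys_def subring_0)

lemma polys_const: "is_subring A \<Longrightarrow> c \<in> A \<Longrightarrow> [:c:] \<in> polys A"
  by (simp add: polys_pCons polys_0)

lemma polys_1: "is_subring A \<Longrightarrow> 1 \<in> polys A"
  using polys_const[of A 1] by (simp add: subring_1 one_pCons)

lemma polys_diff:
  "is_subring A \<Longrightarrow> p \<in> polys A \<Longrightarrow> r \<in> polys A \<Longrightarrow> p - r \<in> polys A"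
  by (auto simp: polys_def subring_diff)

lemma polys_add:
  "is_subring A \<Longrightarrow> p \<in> polys A \<Longrightarrow> r \<in> polys A \<Longrightarrow> p + r \<in> polys A"
  by (auto simp: polys_def subring_add)

lemma polys_mult:
  "is_subring A \<Longrightarrow> p \<in> polys A \<Longrightarrow> r \<in> polys A \<Longrightarrow> p * r \<in> polys A"
  by (auto simp: polys_def coeff_mult intro!: subring_sum subring_mult)

lemma polys_smult:
  "is_subring A \<Longrightarrow> c \<in> A \<Longrightarrow> p \<in> polys A \<Longrightarrow> smult c p \<in> polys A"
  by (auto simp: polys_def subring_mult)

lemma polys_monom: "is_subring A \<Longrightarrow> c \<in> A \<Longrightarrow> monom c n \<in> polys A"
  by (auto simp: polys_def subring_0)

lemma polys_power: "is_subring A \<Longrightarrow> p \<in> polys A \<Longrightarrow> p ^ n \<in> polys A"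
  by (induction n) (auto intro: polys_1 polys_mult)

lemma polys_pcompose:
  assumes A: "is_subring A" and p: "p \<in> polys A" and r: "r \<in> polys A"
  shows "p \<circ>\<^sub>p r \<in> polys A"
  using p
proof (induction p)
  case 0
  then show ?case using A by (simp add: polys_0)
next
  case (pCons a p)
  have "p \<in> polys A" "a \<in> A"
    using polys_coeff[OF pCons.prems, of "Suc i" for i] polys_coeff[OF pCons.prems, of 0]
    by (auto intro: polysI)
  then show ?case
    using pCons.IH A r by (simp add: pcompose_pCons polys_add polys_const polys_mult)
qed

lemma poly_in_subring:
  assumes A: "is_subring A" and p: "p \<in> polys A" and z: "z \<in> A"
  shows "poly p z \<in> A"
  unfolding poly_altdef using A p z
  by (intro subring_sum subring_mult subring_power) (auto simp: polys_def)

lemma polys_degree_0: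
  assumes "p \<in> polys A" "p \<noteq> 0" "degree p = 0"
  obtains c where "c \<in> A" "c \<noteq> 0" "p = [:c:]"
  using assms polys_coeff[OF assms(1), of 0] by (auto elim: degree_eq_zeroE)

lemma polys_division:
  assumes K: "is_subfield K" and b: "b \<in> polys K" "b \<noteq> 0" and a: "a \<in> polys K"
  shows "\<exists>s r. s \<in> polys K \<and> r \<in> polys K \<and> a = b * s + r \<and> (r = 0 \<or> degree r < degree b)"
  using a
proof (induction "degree a" arbitrary: a rule: less_induct)
  case less
  note R = subfield_subring[OF K]
  show ?case
  proof (cases "a = 0 \<or> degree a < degree b")
    case True
    then show ?thesis using less.prems R
      by (intro exI[of _ 0] exI[of _ a]) (auto simp: polys_0)
  next
    case False
    define c where "c = lead_coeff a / lead_coeff b"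
    define d where "d = monom c (degree a - degree b)"
    have c: "c \<in> K" "c \<noteq> 0"
      using False b less.prems by (auto simp: c_def intro!: subfield_divide[OF K] polys_coeff)
    then have d: "d \<in> polys K" "d \<noteq> 0" "degree d = degree a - degree b" "lead_coeff d = c"
      using R by (auto simp: d_def polys_monom degree_monom_eq)
    have deg: "degree (b * d) = degree a" using d b False by (simp add: degree_mult_eq)
    have lc: "lead_coeff (b * d) = lead_coeff a"
      using d b by (simp add: lead_coeff_mult c_def)
    define a' where "a' = a - b * d"
    have a': "a' \<in> polys K"
      unfolding a'_def using R d b less.prems by (simp add: polys_diff polys_mult)
    have "degree a' < degree a \<or> a' = 0"
    proof (rule ccontr)
      assume n: "\<not> (degree a' < degree a \<or> a' = 0)"
      have "degree a' \<le> degree a"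
        unfolding a'_def using degree_diff_le[of a "degree a" "b*d"] deg by simp
      with n have "degree a' = degree a" "a' \<noteq> 0" by auto
      moreover have "coeff a' (degree a) = 0" using lc deg by (simp add: a'_def)
      ultimately show False by (metis leading_coeff_0_iff)
    qed
    then show ?thesis
    proof
      assume "degree a' < degree a"
      from less.hyps[OF this a'] obtain s r where
        "s \<in> polys K" "r \<in> polys K" "a' = b * s + r" "r = 0 \<or> degree r < degree b"
        by blast
      then show ?thesis using d R unfolding a'_def
        by (intro exI[of _ "s + d"] exI[of _ r]) (auto simp: polys_add algebra_simps)
    next
      assume "a' = 0"
      then show ?thesis using d R unfolding a'_def
        by (intro exI[of _ d] exI[of _ 0]) (auto simp: polys_0)
    qed
  qed
qed

section \<open>Adjunction\<close>

lemma subfield_adjoin: "is_subfield (adjoin K S)"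
proof -
  have "is_subfield (\<Inter>{L. is_subfield L \<and> K \<union> S \<subseteq> L})"
    by (auto simp: is_subfield_def)
  then show ?thesis by (simp add: adjoin_def hull_def)
qed

lemma adjoin_base: "K \<subseteq> adjoin K S"
  by (auto simp: adjoin_def hull_def)

lemma adjoin_gen: "S \<subseteq> adjoin K S"
  by (auto simp: adjoin_def hull_def)

lemma adjoin_least: "is_subfield L \<Longrightarrow> K \<subseteq> L \<Longrightarrow> S \<subseteq> L \<Longrightarrow> adjoin K S \<subseteq> L"
  by (auto simp: adjoin_def hull_def)

definition fractions :: "'f::field set \<Rightarrow> 'f set" where
  "fractions A = {a / b | a b. a \<in> A \<and> b \<in> A}"

lemma subfield_fractions:
  assumes A: "is_subring A"
  shows "is_subfield (fractions A)"
proof -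
  have mk: "a / b \<in> fractions A" if "a \<in> A" "b \<in> A" for a b
    using that unfolding fractions_def by blast
  have "0 \<in> fractions A" "1 \<in> fractions A"
    using mk[OF subring_0[OF A] subring_1[OF A]] mk[OF subring_1[OF A] subring_1[OF A]] by auto
  moreover have "inverse z \<in> fractions A" if "z \<in> fractions A" for z
    using that mk unfolding fractions_def by (auto simp: inverse_divide)
  moreover have "z * w \<in> fractions A" if "z \<in> fractions A" "w \<in> fractions A" for z w
  proof -
    from that obtain a b c d where "a \<in> A" "b \<in> A" "c \<in> A" "d \<in> A" "z = a / b" "w = c / d"
      unfolding fractions_def by blast
    then show ?thesis using mk[of "a * c" "b * d"] subring_mult[OF A] by simp
  qed
  moreover have "z - w \<in> fractions A" if "z \<in> fractions A" "w \<in> fractions A" for z w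
  proof -
    from that obtain a b c d where *: "a \<in> A" "b \<in> A" "c \<in> A" "d \<in> A" "z = a / b" "w = c / d"
      unfolding fractions_def by blast
    consider "b = 0" | "d = 0" | "b \<noteq> 0" "d \<noteq> 0" by blast
    then show ?thesis
    proof cases
      case 1
      then have "z - w = (- c) / d" using * by simp
      moreover have "- c \<in> A" using A * subring_uminus by blast
      ultimately show ?thesis using *(4) mk[of "- c" d] by (simp only:)
    next
      case 2
      then show ?thesis using that * by simp
    next
      case 3
      then have "z - w = (a * d - c * b) / (b * d)" using * by (simp add: field_simps)
      moreover have "a * d - c * b \<in> A" "b * d \<in> A"
        using A * by (auto intro!: subring_diff subring_mult)
      ultimately show ?thesis using mk by simp
    qed
  qed
  ultimately show ?thesis unfolding is_subfield_def by blast
qed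

lemma subset_fractions: "is_subring A \<Longrightarrow> A \<subseteq> fractions A"
proof
  fix a assume "is_subring A" "a \<in> A"
  then show "a \<in> fractions A"
    using subring_1[of A] unfolding fractions_def by (intro CollectI exI[of _ a] exI[of _ 1]) simp
qed

abbreviation poly_values :: "'f::field set \<Rightarrow> 'f \<Rightarrow> 'f set" where
  "poly_values A z \<equiv> (\<lambda>p. poly p z) ` polys A"

lemma subring_poly_values:
  assumes A: "is_subring A"
  shows "is_subring (poly_values A z)"
proof (rule is_subringI)
  show "1 \<in> poly_values A z"
    using polys_1[OF A] by (force intro: image_eqI[of _ _ 1])
next
  fix a b assume "a \<in> poly_values A z" "b \<in> poly_values A z"
  then obtain p r where *: "p \<in> polys A" "r \<in> polys A" "a = poly p z" "b = poly r z"
    by blast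
  show "a - b \<in> poly_values A z"
    using * polys_diff[OF A] by (intro image_eqI[of _ _ "p - r"]) auto
  show "a * b \<in> poly_values A z"
    using * polys_mult[OF A] by (intro image_eqI[of _ _ "p * r"]) auto
qed

lemma poly_values_base: "is_subring A \<Longrightarrow> A \<subseteq> poly_values A z"
  by (auto intro!: image_eqI[of _ _ "[:a:]" for a] polys_const)

lemma poly_values_gen: "is_subring A \<Longrightarrow> z \<in> poly_values A z"
  by (auto intro!: image_eqI[of _ _ "[:0, 1:]"] polys_pCons polys_0 subring_0 subring_1)

lemma adjoin_single_fraction:
  assumes K: "is_subfield K" and r: "r \<in> adjoin K {z}"
  obtains a b where "a \<in> polys K" "b \<in> polys K" "b \<noteq> 0" "poly b z \<noteq> 0"
    "r = poly a z / poly b z"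
proof -
  let ?A = "poly_values K z"
  note R = subfield_subring[OF K]
  have A: "is_subring ?A" by (rule subring_poly_values[OF R])
  have "adjoin K {z} \<subseteq> fractions ?A"
    using subfield_fractions[OF A] subset_fractions[OF A] poly_values_base[OF R] poly_values_gen[OF R]
    by (intro adjoin_least) blast+
  with r obtain a b where *: "a \<in> polys K" "b \<in> polys K" "r = poly a z / poly b z"
    unfolding fractions_def by blast
  show ?thesis
  proof (cases "poly b z = 0")
    case True
    then show ?thesis using * that[of 0 1] polys_0[OF R] polys_1[OF R] by simp
  next
    case False
    moreover have "b \<noteq> 0" using False by auto
    ultimately show ?thesis using * False that[of a b] by blast
  qed
qed

lemma poly_in_adjoin:
  assumes "is_subfield K" "p \<in> polys K"
  shows "poly p z \<in> adjoin K {z}"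
  using assms poly_in_subring[OF subfield_subring[OF subfield_adjoin], of p K "{z}" z]
    polys_mono[OF adjoin_base] adjoin_gen by blast

lemma transcendental_polys:
  "is_subfield K \<Longrightarrow> transcendental_over K z \<longleftrightarrow> (\<forall>p\<in>polys K. p \<noteq> 0 \<longrightarrow> poly p z \<noteq> 0)"
  using polys_coeffs[of K] by (auto simp: transcendental_over_def is_subfield_def)

section \<open>Places\<close>

lemma
  assumes "is_place K v"
  shows place_0: "v 0 = 0"
    and place_mult: "a \<noteq> 0 \<Longrightarrow> b \<noteq> 0 \<Longrightarrow> v (a * b) = v a + v b"
    and place_min: "a \<noteq> 0 \<Longrightarrow> b \<noteq> 0 \<Longrightarrow> a + b \<noteq> 0 \<Longrightarrow> min (v a) (v b) \<le> v (a + b)"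
    and place_const: "c \<in> K \<Longrightarrow> v c = 0"
    and place_onto: "\<exists>a. a \<noteq> 0 \<and> v a = 1"
  using assms by (auto simp: is_place_def)

lemma place_1: "is_place K v \<Longrightarrow> v 1 = 0"
  using place_mult[of K v 1 1] by simp

lemma place_inverse:
  assumes "is_place K v"
  shows "v (inverse a) = - v a"
  using assms place_mult[of K v a "inverse a"] place_1[of K v] place_0[of K v] by (cases "a = 0") auto

lemma place_divide: "is_place K v \<Longrightarrow> a \<noteq> 0 \<Longrightarrow> b \<noteq> 0 \<Longrightarrow> v (a / b) = v a - v b"
  by (simp add: divide_inverse place_mult place_inverse)

lemma place_power: "is_place K v \<Longrightarrow> v (a ^ n) = int n * v a"
  by (induction n; cases "a = 0") (auto simp: place_mult place_0 place_1 algebra_simps)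

lemma place_uminus:
  assumes "is_place K v" shows "v (- a) = v a"
proof (cases "a = 0")
  case False
  have "v (- 1) + v (- 1) = v 1" using place_mult[OF assms, of "-1" "-1"] by simp
  then have "v (- 1) = 0" using place_1[OF assms] by simp
  then show ?thesis using place_mult[OF assms, of "-1" a] False by simp
qed simp

text \<open>
  The relation \<open>v z \<ge> n\<close> with the convention \<open>v 0 = \<infinity>\<close>, which the dummy value
  \<open>v 0 = 0\<close> does not obey.
\<close>

definition vge :: "('f::field \<Rightarrow> int) \<Rightarrow> int \<Rightarrow> 'f \<Rightarrow> bool" where
  "vge v n z \<longleftrightarrow> z = 0 \<or> n \<le> v z"

lemma vge_0 [simp]: "vge v n 0" by (simp add: vge_def)

lemma vgeI: "n \<le> v z \<Longrightarrow> vge v n z" by (simp add: vge_def)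

lemma vge_mono: "vge v n z \<Longrightarrow> k \<le> n \<Longrightarrow> vge v k z" by (auto simp: vge_def)

lemma vge_add: "is_place K v \<Longrightarrow> vge v n a \<Longrightarrow> vge v n b \<Longrightarrow> vge v n (a + b)"
  using place_min[of K v a b] by (fastforce simp: vge_def)

lemma vge_uminus: "is_place K v \<Longrightarrow> vge v n (- a) \<longleftrightarrow> vge v n a"
  by (simp add: vge_def place_uminus)

lemma vge_diff: "is_place K v \<Longrightarrow> vge v n a \<Longrightarrow> vge v n b \<Longrightarrow> vge v n (a - b)"
  using vge_add[of K v n a "- b"] by (simp add: vge_uminus)

lemma vge_1: "is_place K v \<Longrightarrow> vge v 0 1"
  by (simp add: vge_def place_1)

lemma vge_mult: "is_place K v \<Longrightarrow> vge v n a \<Longrightarrow> vge v k b \<Longrightarrow> vge v (n + k) (a * b)"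
  using place_mult[of K v a b] by (cases "a = 0"; cases "b = 0") (auto simp: vge_def)

lemma vge_power: "is_place K v \<Longrightarrow> vge v n a \<Longrightarrow> vge v (int k * n) (a ^ k)"
proof (induction k)
  case (Suc k)
  then show ?case using vge_mult[of K v n a "int k * n" "a ^ k"] by (simp add: algebra_simps)
qed (simp add: vge_1)

lemma vge_sum: "is_place K v \<Longrightarrow> (\<And>i. i \<in> I \<Longrightarrow> vge v n (f i)) \<Longrightarrow> vge v n (sum f I)"
  by (induction I rule: infinite_finite_induct) (auto intro: vge_add)

lemma vge_const: "is_place K v \<Longrightarrow> c \<in> K \<Longrightarrow> vge v 0 c"
  by (simp add: vge_def place_const)

lemma vge_poly:
  assumes "is_place K v" "p \<in> polys K" "vge v 0 z"
  shows "vge v 0 (poly p z)"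
proof -
  have "vge v 0 (coeff p i * z ^ i)" for i
    using vge_mult[OF assms(1) vge_const[OF assms(1) polys_coeff[OF assms(2)]] vge_power[OF assms(1,3)]]
    by simp
  then show ?thesis unfolding poly_altdef using assms(1) by (intro vge_sum) auto
qed

lemma place_add_dominant:
  assumes v: "is_place K v" and a: "a \<noteq> 0" and b: "vge v (v a + 1) b"
  shows "a + b \<noteq> 0" "v (a + b) = v a"
proof -
  show nz: "a + b \<noteq> 0"
  proof
    assume "a + b = 0"
    then have "b = - a" by (simp add: add_eq_0_iff)
    then show False using a b by (auto simp: vge_def place_uminus[OF v])
  qed
  show "v (a + b) = v a"
  proof (cases "b = 0")
    case False
    then have "v a < v b" using b by (simp add: vge_def)
    moreover have "min (v (a + b)) (v (- b)) \<le> v (a + b + - b)"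
      using nz False a by (intro place_min[OF v]) auto
    ultimately show ?thesis using place_min[OF v a False nz] by (auto simp: place_uminus[OF v])
  qed simp
qed

lemma vge_add_const:
  assumes "is_place K v" "vge v 1 z" "c \<in> K" "c \<noteq> 0"
  shows "c + z \<noteq> 0" "v (c + z) = 0"
  using place_add_dominant[of K v c z] assms place_const[of K v c] by auto

text \<open>
  The term of least value dominates the others, so that nothing can cancel it.
\<close>

lemma place_sum_distinct:
  fixes v :: "'f::field \<Rightarrow> int" and f :: "'i \<Rightarrow> 'f"
  assumes v: "is_place K v" and I: "finite I" and dist: "inj_on (\<lambda>i. v (f i)) {i\<in>I. f i \<noteq> 0}"
    and i: "i \<in> I" "f i \<noteq> 0"
  shows "sum f I \<noteq> 0" "v (sum f I) \<le> v (f i)"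
proof -
  let ?J = "{i\<in>I. f i \<noteq> 0}"
  have J: "finite ?J" "?J \<noteq> {}" using I i by auto
  obtain k where k: "k \<in> ?J" "\<And>j. j \<in> ?J \<Longrightarrow> v (f k) \<le> v (f j)"
    using arg_min_least[OF J, where f = "\<lambda>i. v (f i)"]
      arg_min_if_finite(1)[OF J, where f = "\<lambda>i. v (f i)"] by blast
  have "sum f I = f k + sum f (I - {k})"
    using k I by (auto intro!: sum.remove)
  moreover have "vge v (v (f k) + 1) (sum f (I - {k}))"
  proof (rule vge_sum[OF v])
    fix j assume j: "j \<in> I - {k}"
    show "vge v (v (f k) + 1) (f j)"
    proof (cases "f j = 0")
      case False
      then have "v (f j) \<noteq> v (f k)" using dist j k by (auto simp: inj_on_def)
      moreover have "v (f k) \<le> v (f j)" using k j False by auto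
      ultimately show ?thesis by (simp add: vge_def)
    qed simp
  qed
  ultimately show "sum f I \<noteq> 0" "v (sum f I) \<le> v (f i)"
    using place_add_dominant[OF v, of "f k"] k i by auto
qed

text \<open>
  At a pole of \<open>z\<close> the leading term of a polynomial in \<open>z\<close> dominates.
\<close>

lemma place_poly_at_pole:
  assumes v: "is_place K v" and K: "is_subfield K" and z: "v z < 0" and p: "p \<in> polys K" "p \<noteq> 0"
  shows "v (poly p z) = int (degree p) * v z" "poly p z \<noteq> 0"
proof -
  let ?f = "\<lambda>i. coeff p i * z ^ i"
  have z0: "z \<noteq> 0" using z place_0[OF v] by auto
  have val: "v (?f i) = int i * v z" if "?f i \<noteq> 0" for i
    using that p place_mult[OF v, of "coeff p i" "z ^ i"] place_const[OF v polys_coeff]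
    by (simp add: place_power[OF v])
  have lead: "?f (degree p) \<noteq> 0" using p z0 by simp
  have "poly p z = ?f (degree p) + (\<Sum>i<degree p. ?f i)"
    by (simp add: poly_altdef lessThan_Suc_atMost[symmetric] add.commute)
  moreover have "vge v (v (?f (degree p)) + 1) (\<Sum>i<degree p. ?f i)"
  proof (rule vge_sum[OF v])
    fix i assume "i \<in> {..<degree p}"
    then have "int i < int (degree p)" by simp
    then have "int (degree p) * v z < int i * v z" using z by (simp add: mult_strict_right_mono_neg)
    then show "vge v (v (?f (degree p)) + 1) (?f i)"
      using val[OF lead] val[of i] unfolding vge_def by (cases "?f i = 0") auto
  qed
  ultimately show "v (poly p z) = int (degree p) * v z" "poly p z \<noteq> 0"
    using place_add_dominant[OF v lead] val[OF lead] by auto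
qed

section \<open>Linear dependence over a subfield\<close>

text \<open>
  Gaussian elimination. A coordinate \<open>b\<close> that occurs in some \<open>f k\<close> is removed from all the other vectors
  by subtracting multiples of \<open>f k\<close>. The index set is arbitrary, so that \<open>k\<close> can be dropped without
  renumbering.
\<close>

lemma dependent_in_span:
  fixes f :: "'i \<Rightarrow> 'f::field"
  assumes E: "is_subfield E" and B: "finite B" and I: "finite I" "card B < card I"
    and span: "\<And>i. i \<in> I \<Longrightarrow> \<exists>c. c ` B \<subseteq> E \<and> f i = (\<Sum>b\<in>B. c b * b)"
  shows "\<exists>c. c ` I \<subseteq> E \<and> (\<exists>i\<in>I. c i \<noteq> 0) \<and> (\<Sum>i\<in>I. c i * f i) = 0"
  using B I span
proof (induction B arbitrary: I f rule: finite_induct)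
  case empty
  then have "I \<noteq> {}" by auto
  then show ?case using empty subring_1[OF subfield_subring[OF E]]
    by (intro exI[of _ "\<lambda>_. 1"]) auto
next
  case (insert b B)
  note R = subfield_subring[OF E]
  have "\<forall>i\<in>I. \<exists>c. c ` insert b B \<subseteq> E \<and> f i = (\<Sum>b\<in>insert b B. c b * b)"
    using insert.prems(3) by blast
  then obtain C where C: "\<And>i. i \<in> I \<Longrightarrow> C i ` insert b B \<subseteq> E"
    "\<And>i. i \<in> I \<Longrightarrow> f i = (\<Sum>b\<in>insert b B. C i b * b)"
    by metis
  then have f: "f i = C i b * b + (\<Sum>b\<in>B. C i b * b)" if "i \<in> I" for i
    using insert.hyps that by simp
  show ?case
  proof (cases "\<forall>i\<in>I. C i b = 0")
    case True
    show ?thesis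
    proof (rule insert.IH)
      show "finite I" "card B < card I" using insert.prems insert.hyps by auto
      show "\<exists>c. c ` B \<subseteq> E \<and> f i = (\<Sum>b\<in>B. c b * b)" if "i \<in> I" for i
        using C(1)[OF that] f[OF that] True that by (intro exI[of _ "C i"]) auto
    qed
  next
    case False
    then obtain k where k: "k \<in> I" "C k b \<noteq> 0" by blast
    define r where "r = (\<lambda>i. C i b / C k b)"
    define g where "g = (\<lambda>i. f i - r i * f k)"
    have r: "r i \<in> E" if "i \<in> I" for i
      unfolding r_def using C(1)[OF that] C(1)[OF k(1)] by (intro subfield_divide[OF E]) auto
    have "\<exists>c. c ` (I - {k}) \<subseteq> E \<and> (\<exists>i\<in>I - {k}. c i \<noteq> 0) \<and> (\<Sum>i\<in>I - {k}. c i * g i) = 0"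
    proof (rule insert.IH)
      show "finite (I - {k})" "card B < card (I - {k})" using insert.prems insert.hyps k by auto
      fix i assume i: "i \<in> I - {k}"
      have "g i = (\<Sum>x\<in>B. (C i x - r i * C k x) * x)"
        using i k f[of i] f[of k]
        by (simp add: g_def r_def algebra_simps sum_subtractf sum_distrib_left flip: sum.distrib)
      moreover have "(\<lambda>x. C i x - r i * C k x) ` B \<subseteq> E"
        using C(1)[of i] C(1)[OF k(1)] i r[of i] by (auto intro!: subring_diff[OF R] subring_mult[OF R])
      ultimately show "\<exists>c. c ` B \<subseteq> E \<and> g i = (\<Sum>b\<in>B. c b * b)"
        by (intro exI[of _ "\<lambda>x. C i x - r i * C k x"]) auto
    qed
    then obtain d where d: "d ` (I - {k}) \<subseteq> E" "\<exists>i\<in>I - {k}. d i \<noteq> 0" "(\<Sum>i\<in>I - {k}. d i * g i) = 0"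
      by blast
    define c where "c = d(k := - (\<Sum>i\<in>I - {k}. d i * r i))"
    have "(\<Sum>i\<in>I. c i * f i) = c k * f k + (\<Sum>i\<in>I - {k}. c i * f i)"
      using k insert.prems by (simp add: sum.remove)
    also have "\<dots> = (\<Sum>i\<in>I - {k}. d i * g i)"
      by (simp add: c_def g_def algebra_simps sum_subtractf sum_distrib_left)
    finally have "(\<Sum>i\<in>I. c i * f i) = 0" using d by simp
    moreover have "c ` I \<subseteq> E"
      using d r unfolding c_def
      by (auto intro!: subring_uminus[OF R] subring_sum[OF R] subring_mult[OF R])
    moreover have "\<exists>i\<in>I. c i \<noteq> 0" using d by (auto simp: c_def)
    ultimately show ?thesis by blast
  qed
qed

section \<open>Existence of places\<close>

text \<open>
  Inverting \<open>u = 1 - a c\<close> does not make \<open>a\<close> invertible, because all powers of \<open>u\<close> are congruent to \<open>1\<close>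
  modulo \<open>a\<close>. So maximality puts the inverse of \<open>u\<close> into \<open>V\<close>.
\<close>

lemma maximal_avoiding_unit:
  fixes V :: "'f::field set"
  assumes V: "is_subring V" "inverse a \<notin> V"
    and max: "\<And>W. is_subring W \<Longrightarrow> V \<subseteq> W \<Longrightarrow> inverse a \<notin> W \<Longrightarrow> W = V"
    and aV: "a \<in> V" "a \<noteq> 0" and c: "c \<in> V"
  shows "inverse (1 - a * c) \<in> V"
proof -
  define u where "u = 1 - a * c"
  have uV: "u \<in> V" using V aV c unfolding u_def by (auto intro: subring_diff subring_mult subring_1)
  have u_pow: "\<exists>y\<in>V. u ^ n = 1 - a * y" for n
  proof (induction n)
    case 0
    then show ?case using subring_0[OF V(1)] by (intro bexI[of _ 0]) auto
  next
    case (Suc n)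
    then obtain y where y: "y \<in> V" "u ^ n = 1 - a * y" by blast
    then have "u ^ Suc n = 1 - a * (c * u ^ n + y)" by (simp add: u_def algebra_simps)
    moreover have "c * u ^ n + y \<in> V"
      using y(1) c uV V by (intro subring_add subring_mult subring_power)
    ultimately show ?case by blast
  qed
  have u0: "u \<noteq> 0"
  proof
    assume "u = 0"
    then have "inverse a = c" using aV by (simp add: u_def field_simps)
    then show False using V c by simp
  qed
  define W where "W = {x / u ^ n | x n. x \<in> V}"
  have mk: "x / u ^ n \<in> W" if "x \<in> V" for x n using that unfolding W_def by blast
  have W: "is_subring W"
  proof (rule is_subringI)
    show "1 \<in> W" using mk[of 1 0] subring_1[OF V(1)] by simp
    fix x y assume "x \<in> W" "y \<in> W"
    then obtain x' n y' k where xy: "x' \<in> V" "x = x' / u ^ n" "y' \<in> V" "y = y' / u ^ k"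
      unfolding W_def by blast
    have "x * y = (x' * y') / u ^ (n + k)" using xy by (simp add: power_add)
    then show "x * y \<in> W" using mk subring_mult[OF V(1)] xy by (simp only:)
    have "x - y = (x' * u ^ k - y' * u ^ n) / u ^ (n + k)"
      using u0 unfolding xy(2,4) by (simp add: diff_divide_distrib power_add)
    moreover have "x' * u ^ k - y' * u ^ n \<in> V" using V uV xy
      by (intro subring_diff subring_mult subring_power) auto
    ultimately show "x - y \<in> W" using mk by (simp only:)
  qed
  moreover have "V \<subseteq> W"
  proof
    fix x assume "x \<in> V"
    then show "x \<in> W" using mk[of x 0] by simp
  qed
  moreover have "inverse a \<notin> W"
  proof
    assume "inverse a \<in> W"
    then obtain x n where x: "x \<in> V" "inverse a = x / u ^ n" unfolding W_def by blast
    obtain y where y: "y \<in> V" "u ^ n = 1 - a * y" using u_pow by blast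
    have "u ^ n * inverse a = x" using x u0 by simp
    then have "inverse a = x + y" using y aV by (simp add: field_simps)
    then show False using V x y subring_add by metis
  qed
  ultimately have "W = V" using max by blast
  then show ?thesis using mk[of 1 1] subring_1[OF V(1)] by (simp add: u_def inverse_eq_divide)
qed

text \<open>
  The relation in \<open>1/z\<close> has a constant term that can be moved to the left, where it becomes a unit.
  Multiplied by \<open>z ^ n\<close> it expresses \<open>z ^ n\<close> by lower powers of \<open>z\<close>.
\<close>

lemma unit_relation_descent:
  fixes V :: "'f::field set"
  assumes V: "is_subring V" "inverse a \<notin> V" and aV: "a \<in> V" "a \<noteq> 0"
    and unit: "\<And>c. c \<in> V \<Longrightarrow> inverse (1 - a * c) \<in> V"
    and p: "p \<in> polys V" "degree p \<le> n" "a * poly p z = 1" and n0: "n > 0"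
    and r: "r \<in> polys V" "degree r \<le> k" "a * poly r (inverse z) = 1"
    and k: "k \<le> n" and z: "z \<noteq> 0"
  shows "\<exists>n'<n. \<exists>p. p \<in> polys V \<and> degree p \<le> n' \<and> a * poly p z = 1"
proof -
  define u where "u = 1 - a * coeff r 0"
  have uV: "inverse u \<in> V" using unit[OF polys_coeff[OF r(1)], of 0] by (simp add: u_def)
  have u0: "u \<noteq> 0"
  proof
    assume "u = 0"
    then have "inverse a = coeff r 0" using aV by (simp add: u_def field_simps)
    then show False using V polys_coeff[OF r(1)] by metis
  qed
  \<comment> \<open>the relation in \<open>1/z\<close>, solved for its constant part and multiplied by \<open>z ^ n\<close>\<close>
  define s where "s = (\<Sum>j=1..k. monom (a * inverse u * coeff r j) (n - j))"
  have sV: "s \<in> polys V"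
    unfolding s_def polys_def
    using aV uV r V by (auto simp: coeff_sum polys_coeff subring_0
        intro!: subring_sum subring_mult)
  have sdeg: "degree s \<le> n - 1"
    unfolding s_def by (intro degree_sum_le) (auto intro: order_trans[OF degree_monom_le])
  have "poly r (inverse z) = (\<Sum>j\<le>k. coeff r j * inverse z ^ j)"
    unfolding poly_altdef using r(2) by (intro sum.mono_neutral_left) (auto simp: coeff_eq_0)
  then have "1 = a * (\<Sum>j\<le>k. coeff r j * inverse z ^ j)" using r by simp
  also have "\<dots> = a * coeff r 0 + (\<Sum>j=1..k. a * coeff r j * inverse z ^ j)"
    by (simp add: atMost_atLeast0 sum.atLeast_Suc_atMost algebra_simps sum_distrib_left)
  finally have "u = (\<Sum>j=1..k. a * coeff r j * inverse z ^ j)"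
    by (simp add: u_def algebra_simps)
  then have "1 = inverse u * (\<Sum>j=1..k. a * coeff r j * inverse z ^ j)" using u0 by auto
  then have "z ^ n = (\<Sum>j=1..k. inverse u * (a * coeff r j * inverse z ^ j) * z ^ n)"
    by (metis mult_1 sum_distrib_left sum_distrib_right)
  also have "\<dots> = poly s z"
    unfolding s_def poly_sum
    using k z by (intro sum.cong) (auto simp: poly_monom power_diff field_simps)
  finally have zn: "z ^ n = poly s z" .
  define p' where "p' = (p - monom (coeff p n) n) + smult (coeff p n) s"
  have "p' \<in> polys V"
    unfolding p'_def using V p sV
    by (intro polys_add polys_diff polys_monom polys_smult)
       (auto simp: polys_coeff)
  moreover have "a * poly p' z = 1" using p zn by (simp add: p'_def poly_monom)
  moreover have "degree p' \<le> n - 1"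
  proof -
    have "coeff p' i = 0" if "i > n - 1" for i
      using that p sdeg n0 by (cases "i = n") (auto simp: p'_def coeff_eq_0)
    then show ?thesis by (intro degree_le) auto
  qed
  ultimately show ?thesis using n0 by (intro exI[of _ "n - 1"]) auto
qed

text \<open>
  A maximal subring avoiding the inverse of \<open>a\<close> is a valuation ring: if it contained neither \<open>z\<close>
  nor \<open>1/z\<close>, then \<open>1/a\<close> would be a polynomial in \<open>z\<close> and also one in \<open>1/z\<close>, and the second
  equation can be used to lower the degree of the first.
\<close>

lemma valuation_ring_exists:
  fixes A :: "'f::field set"
  assumes A: "is_subring A" and a: "a \<in> A" "inverse a \<notin> A"
  shows "\<exists>V. is_subring V \<and> A \<subseteq> V \<and> inverse a \<notin> V \<and> (\<forall>z. z \<in> V \<or> inverse z \<in> V)"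
proof -
  let ?F = "{V. is_subring V \<and> A \<subseteq> V \<and> inverse a \<notin> V}"
  have "\<exists>V\<in>?F. \<forall>W\<in>?F. V \<subseteq> W \<longrightarrow> W = V"
  proof (rule subset_Zorn_nonempty)
    show "?F \<noteq> {}" using A a by blast
    fix \<C> assume C: "\<C> \<noteq> {}" "subset.chain ?F \<C>"
    have "is_subring (\<Union>\<C>)"
    proof (rule is_subringI)
      show "1 \<in> \<Union>\<C>" using C subring_1 by (fastforce simp: subset.chain_def)
      fix x y assume "x \<in> \<Union>\<C>" "y \<in> \<Union>\<C>"
      then obtain V W where "V \<in> \<C>" "x \<in> V" "W \<in> \<C>" "y \<in> W" by blast
      moreover from this have "V \<subseteq> W \<or> W \<subseteq> V" using C by (auto simp: subset_chain_def)
      ultimately obtain U where "U \<in> \<C>" "x \<in> U" "y \<in> U" by blast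
      moreover from this have "is_subring U" using C by (auto simp: subset_chain_def)
      ultimately show "x - y \<in> \<Union>\<C>" "x * y \<in> \<Union>\<C>"
        using subring_diff subring_mult by blast+
    qed
    then show "\<Union>\<C> \<in> ?F" using C by (auto simp: subset_chain_def)
  qed
  then obtain V where V: "is_subring V" "A \<subseteq> V" "inverse a \<notin> V"
    and max: "\<And>W. is_subring W \<Longrightarrow> V \<subseteq> W \<Longrightarrow> inverse a \<notin> W \<Longrightarrow> W = V"
    by (smt (verit) mem_Collect_eq subset_trans)
  have aV: "a \<in> V" "a \<noteq> 0" using V a subring_0[OF A] by auto

  have unit: "inverse (1 - a * c) \<in> V" if "c \<in> V" for c
    using maximal_avoiding_unit[OF V(1,3) max aV that] by blast
  let ?rel = "\<lambda>z n. \<exists>p. p \<in> polys V \<and> degree p \<le> n \<and> a * poly p z = 1"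
  have ex_rel: "\<exists>n. ?rel z n" if z: "z \<notin> V" for z
  proof -
    have "inverse a \<in> poly_values V z"
    proof (rule ccontr)
      assume "inverse a \<notin> poly_values V z"
      then have "poly_values V z = V"
        using max[OF subring_poly_values[OF V(1)] poly_values_base[OF V(1)]] by blast
      then show False using z poly_values_gen[OF V(1), of z] by blast
    qed
    then obtain p where "p \<in> polys V" "inverse a = poly p z" by blast
    then show ?thesis using aV by (intro exI[of _ "degree p"] exI[of _ p]) (auto simp: field_simps)
  qed

  have descent: "\<exists>n'<n. ?rel z n'"
    if n: "?rel z n" "\<not> ?rel z 0" and k: "?rel (inverse z) k" "k \<le> n" and z: "z \<noteq> 0" for z n k
  proof -
    have "n > 0" using n by (cases n) auto
    then show ?thesis
      using n(1) k z unit_relation_descent[OF V(1,3) aV unit, of _ n z _ k] by blast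
  qed

  have total: "z \<in> V \<or> inverse z \<in> V" for z
  proof (rule ccontr)
    assume "\<not> (z \<in> V \<or> inverse z \<in> V)"
    then have z: "z \<notin> V" "inverse z \<notin> V" "z \<noteq> 0" using subring_0[OF V(1)] by auto
    have not0: "\<not> ?rel z 0" for z
    proof
      assume "?rel z 0"
      then obtain p where p: "p \<in> polys V" "degree p = 0" "a * poly p z = 1" by auto
      then have "poly p z = coeff p 0" by (auto elim!: degree_eq_zeroE)
      then have "inverse a = coeff p 0" using p aV by (simp add: field_simps)
      then show False using V polys_coeff[OF p(1)] by metis
    qed
    define n where "n = (LEAST n. ?rel z n)"
    define k where "k = (LEAST n. ?rel (inverse z) n)"
    have n: "?rel z n" "\<And>n'. n' < n \<Longrightarrow> \<not> ?rel z n'"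
      using LeastI_ex[OF ex_rel[OF z(1)]] not_less_Least unfolding n_def by blast+
    have k: "?rel (inverse z) k" "\<And>n'. n' < k \<Longrightarrow> \<not> ?rel (inverse z) n'"
      using LeastI_ex[OF ex_rel[OF z(2)]] not_less_Least unfolding k_def by blast+
    show False
    proof (cases "k \<le> n")
      case True
      then show False using descent[OF n(1) not0 k(1) _ z(3)] n(2) by blast
    next
      case False
      then show False using descent[OF k(1) not0, of n] n(1) k(2) z(3) by auto
    qed
  qed
  show ?thesis using V total by blast
qed

locale valuation_ring_set =
  fixes V :: "'f::field set"
  assumes subring: "is_subring V" and total: "z \<in> V \<or> inverse z \<in> V"
begin

definition units :: "'f set" where
  "units = {u\<in>V. u \<noteq> 0 \<and> inverse u \<in> V}"

definition nonunits :: "'f set" where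
  "nonunits = {z\<in>V. z = 0 \<or> inverse z \<notin> V}"

lemma unit_or_nonunit: "z \<in> V \<Longrightarrow> z \<in> units \<or> z \<in> nonunits"
  by (auto simp: units_def nonunits_def)

lemma unit_not_nonunit: "u \<in> units \<Longrightarrow> u \<notin> nonunits"
  by (auto simp: units_def nonunits_def)

lemma unitsD: "u \<in> units \<Longrightarrow> u \<in> V \<and> u \<noteq> 0 \<and> inverse u \<in> V"
  by (auto simp: units_def)

lemma one_unit: "1 \<in> units"
  using subring_1[OF subring] by (simp add: units_def)

lemma unit_mult: "u \<in> units \<Longrightarrow> w \<in> units \<Longrightarrow> u * w \<in> units"
  using subring_mult[OF subring] by (auto simp: units_def)

lemma unit_inverse: "u \<in> units \<Longrightarrow> inverse u \<in> units"
  by (auto simp: units_def)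

lemma unit_power: "u \<in> units \<Longrightarrow> u ^ n \<in> units"
  by (induction n) (auto intro: one_unit unit_mult)

lemma nonunits_V: "z \<in> nonunits \<Longrightarrow> z \<in> V"
  by (simp add: nonunits_def)

lemma zero_nonunit: "0 \<in> nonunits"
  using subring_0[OF subring] by (simp add: nonunits_def)

lemma nonunits_mult:
  assumes "a \<in> nonunits" "b \<in> V"
  shows "a * b \<in> nonunits" "b * a \<in> nonunits"
proof -
  show "a * b \<in> nonunits"
  proof (cases "a * b = 0")
    case False
    have "inverse (a * b) \<notin> V"
    proof
      assume "inverse (a * b) \<in> V"
      then have "b * inverse (a * b) \<in> V" using assms subring_mult[OF subring] by blast
      moreover have "b * inverse (a * b) = inverse a" using False by (simp add: field_simps)
      ultimately have "inverse a \<in> V" by (simp only:)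
      then show False using assms False by (simp add: nonunits_def)
    qed
    then show ?thesis using assms subring_mult[OF subring] by (auto simp: nonunits_def)
  next
    case True
    then show ?thesis using zero_nonunit by (simp only:)
  qed
  then show "b * a \<in> nonunits" by (simp add: mult.commute)
qed

lemma nonunits_add:
  assumes "a \<in> nonunits" "b \<in> nonunits"
  shows "a + b \<in> nonunits"
proof -
  have *: "a + b \<in> nonunits" if "a \<in> nonunits" "b \<in> nonunits" "b \<noteq> 0" "a / b \<in> V" for a b
  proof -
    have "a + b = b * (1 + a / b)" using that by (simp add: field_simps)
    moreover have "1 + a / b \<in> V" using that by (intro subring_add subring subring_1)
    ultimately show ?thesis using nonunits_mult that by (simp only:)
  qed
  show ?thesis
  proof (cases "a = 0 \<or> b = 0")
    case False
    then show ?thesis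
      using *[OF assms] *[OF assms(2,1)] total[of "a / b"] by (auto simp: add.commute inverse_divide)
  qed (use assms in auto)
qed

lemma nonunits_sum: "(\<And>i. i \<in> I \<Longrightarrow> f i \<in> nonunits) \<Longrightarrow> sum f I \<in> nonunits"
  by (induction I rule: infinite_finite_induct) (auto intro: zero_nonunit nonunits_add)

lemma unit_add_nonunit:
  assumes "u \<in> units" "a \<in> nonunits"
  shows "u + a \<in> units"
proof (rule ccontr)
  assume "u + a \<notin> units"
  moreover have "u + a \<in> V" using assms subring_add[OF subring] by (auto simp: units_def nonunits_def)
  ultimately have "u + a \<in> nonunits" using unit_or_nonunit by blast
  moreover have "- a \<in> nonunits"
    using nonunits_mult(2)[of a "- 1"] assms subring_uminus[OF subring subring_1[OF subring]] by simp
  ultimately have "u \<in> nonunits" using nonunits_add[of "u + a" "- a"] by simp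
  then show False using assms unit_not_nonunit by blast
qed

lemma ratio_nonunit:
  assumes "a \<noteq> 0" "b / a \<notin> V"
  shows "a / b \<in> nonunits"
  using assms total[of "b / a"] by (auto simp: nonunits_def inverse_divide)

text \<open>
  These two lemmas play the part of the lemma on sums of terms with distinct values before a value is
  available: \<open>a / b \<in> nonunits\<close> says that \<open>a\<close> has the larger value.
\<close>

lemma dominant_exists:
  assumes "finite J" "J \<noteq> {}"
    and "\<And>i j. i \<in> J \<Longrightarrow> j \<in> J \<Longrightarrow> i \<noteq> j \<Longrightarrow> t i / t j \<in> nonunits \<or> t j / t i \<in> nonunits"
    and "\<And>i. i \<in> J \<Longrightarrow> t i \<noteq> (0::'f)"
  shows "\<exists>k\<in>J. \<forall>j\<in>J - {k}. t j / t k \<in> nonunits"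
  using assms
proof (induction J rule: finite_ne_induct)
  case (singleton x)
  then show ?case by auto
next
  case (insert x J)
  then obtain k where k: "k \<in> J" "\<And>j. j \<in> J - {k} \<Longrightarrow> t j / t k \<in> nonunits" by blast
  have "x \<noteq> k" using k insert.hyps by blast
  then consider "t x / t k \<in> nonunits" | "t k / t x \<in> nonunits"
    using insert.prems(1)[of x k] k by auto
  then show ?case
  proof cases
    case 1
    then show ?thesis using k by (intro bexI[of _ k]) auto
  next
    case 2
    have "t j / t x \<in> nonunits" if "j \<in> J" for j
    proof (cases "j = k")
      case False
      then have "(t j / t k) * (t k / t x) \<in> nonunits"
        using k(2)[of j] that 2 by (intro nonunits_mult nonunits_V) auto
      then show ?thesis using insert.prems(2)[of k] k by simp
    qed (use 2 in simp)
    then show ?thesis by (intro bexI[of _ x]) auto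
  qed
qed

lemma dominant_sum_nonzero:
  assumes J: "finite J" "J \<noteq> {}"
    and t: "\<And>i j. i \<in> J \<Longrightarrow> j \<in> J \<Longrightarrow> i \<noteq> j \<Longrightarrow> t i / t j \<in> nonunits \<or> t j / t i \<in> nonunits"
      "\<And>i. i \<in> J \<Longrightarrow> t i \<noteq> (0::'f)"
  shows "sum t J \<noteq> 0"
proof -
  have "\<exists>k\<in>J. \<forall>j\<in>J - {k}. t j / t k \<in> nonunits"
    by (rule dominant_exists) (fact J t)+
  then obtain k where k: "k \<in> J" "\<And>j. j \<in> J - {k} \<Longrightarrow> t j / t k \<in> nonunits" by blast
  have "1 + (\<Sum>j\<in>J - {k}. t j / t k) \<in> units"
    using one_unit k by (intro unit_add_nonunit nonunits_sum) auto
  moreover have "sum t J / t k = 1 + (\<Sum>j\<in>J - {k}. t j / t k)"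
    using sum.remove[OF J(1) k(1), of "\<lambda>j. t j / t k"] t(2)[OF k(1)] by (simp add: sum_divide_distrib)
  ultimately have "sum t J / t k \<noteq> 0" using unitsD by metis
  then show ?thesis by auto
qed

end

text \<open>
  A valuation ring \<open>V\<close> and a subfield \<open>E\<close> on which \<open>V\<close> is discrete with uniformizer \<open>\<pi>\<close>, such that the
  whole field is finite over \<open>E\<close>. Then \<open>V\<close> is discrete as well: elements whose values are positive, at
  most that of \<open>\<pi>\<close>, and pairwise different have different values modulo those of \<open>E\<close>. They are therefore
  independent over \<open>E\<close>, which bounds their number.
\<close>

locale valuation_ring_over = valuation_ring_set V for V :: "'f::field set" +
  fixes E :: "'f set" and B :: "'f set" and \<pi> :: 'f
  assumes E: "is_subfield E"
    and finite_B: "finite B" and span: "\<And>f. \<exists>c. c ` B \<subseteq> E \<and> f = (\<Sum>b\<in>B. c b * b)"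
    and pi: "\<pi> \<in> nonunits" "\<pi> \<noteq> 0"
    and E_discrete: "\<And>r. r \<in> E \<Longrightarrow> r \<noteq> 0 \<Longrightarrow> \<exists>k. \<exists>u\<in>units. r = \<pi> powi k * u"
begin

lemma scaled_ratio_nonunit:
  assumes f: "f \<in> nonunits" "f \<noteq> 0" and g: "\<pi> / g \<in> V" "g \<noteq> 0" and k: "k \<ge> 1" and u: "u \<in> units"
  shows "\<pi> powi k * u * f / g \<in> nonunits"
proof -
  obtain n where n: "k = int (Suc n)" using zero_less_imp_eq_int[of k] k by (metis gr0_implies_Suc int_one_le_iff_zero_less)
  have "\<pi> powi k * u * f / g = f * (\<pi> ^ n * (\<pi> / g) * u)" unfolding n power_int_of_nat by simp
  moreover have "\<pi> ^ n * (\<pi> / g) * u \<in> V"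
    using nonunits_V[OF pi(1)] g unitsD[OF u] by (intro subring_mult[OF subring] subring_power[OF subring]) auto
  ultimately show ?thesis using nonunits_mult f by (simp only:)
qed

lemma card_values_le:
  assumes I: "finite I" and f: "\<And>i. i \<in> I \<Longrightarrow> f i \<in> nonunits \<and> f i \<noteq> 0 \<and> \<pi> / f i \<in> V"
    and dist: "\<And>i j. i \<in> I \<Longrightarrow> j \<in> I \<Longrightarrow> i \<noteq> j \<Longrightarrow> f i / f j \<in> nonunits \<or> f j / f i \<in> nonunits"
  shows "card I \<le> card B"
proof (rule ccontr)
  assume "\<not> card I \<le> card B"
  then obtain c where c: "c ` I \<subseteq> E" "\<exists>i\<in>I. c i \<noteq> 0" "(\<Sum>i\<in>I. c i * f i) = 0"
    using dependent_in_span[OF E finite_B I, of f] span by force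
  let ?J = "{i\<in>I. c i \<noteq> 0}"
  have "(\<Sum>i\<in>?J. c i * f i) \<noteq> 0"
  proof (rule dominant_sum_nonzero)
    show "finite ?J" "?J \<noteq> {}" using I c by auto
    show "c i * f i \<noteq> 0" if "i \<in> ?J" for i using that f by auto
    fix i j assume ij: "i \<in> ?J" "j \<in> ?J" "i \<noteq> j"
    have "c i / c j \<in> E" "c i / c j \<noteq> 0" using c ij by (auto intro!: subfield_divide[OF E])
    then obtain k u where u: "u \<in> units" "c i / c j = \<pi> powi k * u" using E_discrete by blast
    have e: "(c i * f i) / (c j * f j) = \<pi> powi k * u * f i / f j"
      using u by (metis times_divide_times_eq times_divide_eq_right)
    have "c j / c i = inverse (\<pi> powi k * u)" using u(2) by (metis inverse_divide)
    then have "c j / c i = \<pi> powi (- k) * inverse u" by (simp add: power_int_minus)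
    then have e': "(c j * f j) / (c i * f i) = \<pi> powi (- k) * inverse u * f j / f i"
      by (metis times_divide_times_eq times_divide_eq_right)
    consider "k = 0" | "k \<ge> 1" | "- k \<ge> 1" by linarith
    then show "(c i * f i) / (c j * f j) \<in> nonunits \<or> (c j * f j) / (c i * f i) \<in> nonunits"
    proof cases
      case 1
      have "f i / f j \<in> nonunits \<or> f j / f i \<in> nonunits" using dist ij by auto
      then have "u * (f i / f j) \<in> nonunits \<or> inverse u * (f j / f i) \<in> nonunits"
        using u nonunits_mult(2) unitsD by blast
      then show ?thesis using e e' 1 by simp
    next
      case 2
      then show ?thesis using e u(1) f ij by (simp add: scaled_ratio_nonunit)
    next
      case 3
      then show ?thesis using e' u(1) f ij
        by (simp only: e') (auto intro!: scaled_ratio_nonunit unit_inverse)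
    qed
  qed
  moreover have "(\<Sum>i\<in>?J. c i * f i) = (\<Sum>i\<in>I. c i * f i)"
    using I by (intro sum.mono_neutral_left) auto
  ultimately show False using c by simp
qed

text \<open>
  Without a nonunit of least value there would be an infinite sequence of smaller and smaller
  values, starting from that of \<open>\<pi>\<close>.
\<close>

lemma uniformizer_exists: "\<exists>p\<in>nonunits. p \<noteq> 0 \<and> (\<forall>z\<in>nonunits. z / p \<in> V)"
proof (rule ccontr)
  assume no: "\<not> ?thesis"
  have "\<exists>f. \<forall>n. (f n \<in> nonunits \<and> f n \<noteq> 0 \<and> \<pi> / f n \<in> V) \<and> f n / f (Suc n) \<in> nonunits"
  proof (rule dependent_nat_choice[where P = "\<lambda>_ x. x \<in> nonunits \<and> x \<noteq> 0 \<and> \<pi> / x \<in> V"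
        and Q = "\<lambda>_ x y. x / y \<in> nonunits"])
    show "\<exists>x. x \<in> nonunits \<and> x \<noteq> 0 \<and> \<pi> / x \<in> V"
      by (rule exI[of _ \<pi>]) (use pi subring_1[OF subring] in simp)
    fix x n assume x: "x \<in> nonunits \<and> x \<noteq> 0 \<and> \<pi> / x \<in> V"
    then obtain y where y: "y \<in> nonunits" "y / x \<notin> V" using no by blast
    then have y0: "y \<noteq> 0" using subring_0[OF subring] by auto
    have xy: "x / y \<in> nonunits" using ratio_nonunit y x by blast
    have "(\<pi> / x) * (x / y) \<in> V" using x nonunits_V[OF xy] subring_mult[OF subring] by blast
    then have "\<pi> / y \<in> V" using x by simp
    then show "\<exists>y. (y \<in> nonunits \<and> y \<noteq> 0 \<and> \<pi> / y \<in> V) \<and> x / y \<in> nonunits"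
      using y(1) y0 xy by blast
  qed
  then obtain f where f: "\<And>n. f n \<in> nonunits \<and> f n \<noteq> 0 \<and> \<pi> / f n \<in> V" "\<And>n. f n / f (Suc n) \<in> nonunits"
    by blast
  have step: "f n / f (Suc (n + d)) \<in> nonunits" for n d
  proof (induction d)
    case 0
    then show ?case using f(2) by simp
  next
    case (Suc d)
    have "(f n / f (Suc (n + d))) * (f (Suc (n + d)) / f (Suc (n + Suc d))) \<in> nonunits"
      using Suc by (rule nonunits_mult(1)) (use f(2)[of "Suc (n + d)"] nonunits_V in simp)
    then show ?case using f(1)[of "Suc (n + d)"] by simp
  qed
  have lt: "f n / f k \<in> nonunits" if "n < k" for n k
    using step[of n "k - n - 1"] that by simp
  have "card {..card B} \<le> card B"
  proof (rule card_values_le[of _ f])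
    show "f i / f j \<in> nonunits \<or> f j / f i \<in> nonunits" if "i \<noteq> j" for i j
      using that lt[of i j] lt[of j i] by linarith
  qed (use f(1) in auto)
  then show False by simp
qed

definition unif :: 'f where
  "unif = (SOME p. p \<in> nonunits \<and> p \<noteq> 0 \<and> (\<forall>z\<in>nonunits. z / p \<in> V))"

lemma unif: "unif \<in> nonunits" "unif \<noteq> 0" "\<And>z. z \<in> nonunits \<Longrightarrow> z / unif \<in> V"
proof -
  have "\<exists>p. p \<in> nonunits \<and> p \<noteq> 0 \<and> (\<forall>z\<in>nonunits. z / p \<in> V)" using uniformizer_exists by blast
  from someI_ex[OF this] show "unif \<in> nonunits" "unif \<noteq> 0" "\<And>z. z \<in> nonunits \<Longrightarrow> z / unif \<in> V"
    unfolding unif_def by blast+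
qed

lemma factor_unif:
  assumes "z \<in> V" "z / unif ^ n \<notin> V"
  shows "\<exists>k. \<exists>u\<in>units. z = unif ^ k * u"
proof -
  define k where "k = (LEAST n. z / unif ^ n \<notin> V)"
  have k: "z / unif ^ k \<notin> V" unfolding k_def using assms(2) by (rule LeastI)
  have below: "z / unif ^ j \<in> V" if "j < k" for j
    using not_less_Least[OF that[unfolded k_def]] by simp
  have "k \<noteq> 0" using k assms(1) by (cases k) auto
  then obtain j where j: "k = Suc j" by (cases k) auto
  let ?u = "z / unif ^ j"
  have "?u \<in> V" using below j by blast
  moreover have "?u \<notin> nonunits"
  proof
    assume "?u \<in> nonunits"
    then have "?u / unif \<in> V" by (rule unif(3))
    then show False using k j by (simp add: mult.commute)
  qed
  ultimately have "?u \<in> units" using unit_or_nonunit by blast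
  moreover have "z = unif ^ j * ?u" using unif(2) by simp
  ultimately show ?thesis by blast
qed

lemma unif_power_nonunit: "n > 0 \<Longrightarrow> unif ^ n \<in> nonunits"
  using nonunits_mult(1)[OF unif(1) subring_power[OF subring nonunits_V[OF unif(1)]], of "n - 1"]
  by (cases n) auto

lemma pi_factor: "\<exists>k. \<exists>u\<in>units. \<pi> = unif ^ k * u"
proof (rule ccontr)
  assume no: "\<not> ?thesis"
  then have all: "\<pi> / unif ^ n \<in> V" for n using factor_unif[of \<pi> n] pi nonunits_V by blast
  have lt: "unif ^ n / unif ^ k \<in> nonunits" if "k < n" for n k
    using unif_power_nonunit[of "n - k"] that unif(2) by (simp add: power_diff)
  have "card {1..Suc (card B)} \<le> card B"
  proof (rule card_values_le[of _ "\<lambda>n. unif ^ n"])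
    show "unif ^ i / unif ^ j \<in> nonunits \<or> unif ^ j / unif ^ i \<in> nonunits" if "i \<noteq> j" for i j
      using that lt[of i j] lt[of j i] by linarith
    show "unif ^ i \<in> nonunits \<and> unif ^ i \<noteq> 0 \<and> \<pi> / unif ^ i \<in> V" if "i \<in> {1..Suc (card B)}" for i
      using that all unif(2) unif_power_nonunit[of i] by auto
  qed simp
  then show False by simp
qed

text \<open>
  An element of \<open>V\<close> divides a power of \<open>\<pi>\<close>, by the lowest term of an algebraic equation
  for it over \<open>E\<close>.
\<close>

lemma divides_pi_power:
  assumes z: "z \<in> V" "z \<noteq> 0"
  shows "\<exists>n. \<pi> ^ n / z \<in> V"
proof -
  let ?I = "{..card B}"
  have "\<exists>c. c ` ?I \<subseteq> E \<and> (\<exists>i\<in>?I. c i \<noteq> 0) \<and> (\<Sum>i\<in>?I. c i * z ^ i) = 0"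
    by (rule dependent_in_span[OF E finite_B]) (simp, simp, rule span)
  then obtain c where c: "c ` ?I \<subseteq> E" "\<exists>i\<in>?I. c i \<noteq> 0" "(\<Sum>i\<in>?I. c i * z ^ i) = 0"
    by blast
  have "\<forall>i\<in>?I. \<exists>k. c i = 0 \<or> (\<exists>u\<in>units. c i = \<pi> powi k * u)"
  proof
    fix i assume "i \<in> ?I"
    then have "c i \<in> E" using c(1) by blast
    then show "\<exists>k. c i = 0 \<or> (\<exists>u\<in>units. c i = \<pi> powi k * u)" using E_discrete[of "c i"] by blast
  qed
  then obtain K where K: "\<And>i. i \<in> ?I \<Longrightarrow> c i = 0 \<or> (\<exists>u\<in>units. c i = \<pi> powi K i * u)" by metis
  define N where "N = (\<Sum>i\<in>?I. nat \<bar>K i\<bar>)"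
  have N: "nat \<bar>K i\<bar> \<le> N" if "i \<in> ?I" for i
    unfolding N_def using that by (intro member_le_sum) auto
  have scaled: "\<pi> ^ N * c i = 0 \<or> (\<exists>u\<in>units. \<pi> ^ N * c i = \<pi> ^ nat (int N + K i) * u)" if i: "i \<in> ?I" for i
  proof -
    have "0 \<le> int N + K i" using N[OF i] by linarith
    then have "\<pi> ^ N * \<pi> powi K i = \<pi> ^ nat (int N + K i)"
      using pi(2) by (metis power_int_add power_int_of_nat nat_0_le)
    then show ?thesis using K[OF i] by (metis mult.assoc mult_zero_right)
  qed
  have V: "\<pi> ^ N * c i \<in> V" if "i \<in> ?I" for i
    using scaled[OF that]
  proof
    assume "\<pi> ^ N * c i = 0"
    then show ?thesis using subring_0[OF subring] by (simp only:)
  next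
    assume "\<exists>u\<in>units. \<pi> ^ N * c i = \<pi> ^ nat (int N + K i) * u"
    then obtain u where u: "u \<in> units" "\<pi> ^ N * c i = \<pi> ^ nat (int N + K i) * u" by blast
    have "\<pi> ^ nat (int N + K i) * u \<in> V"
      using unitsD[OF u(1)] by (intro subring_mult[OF subring] subring_power[OF subring nonunits_V[OF pi(1)]]) auto
    then show ?thesis using u(2) by (simp only:)
  qed
  obtain i0 where i0: "i0 \<in> ?I" "c i0 \<noteq> 0" and least: "\<And>j. j \<in> ?I \<and> c j \<noteq> 0 \<Longrightarrow> i0 \<le> j"
    using c(2) ex_has_least_nat[of "\<lambda>i. i \<in> ?I \<and> c i \<noteq> 0" _ "\<lambda>i. i"] by blast
  have below: "c j = 0" if "j < i0" for j
    using least[of j] that i0(1) by auto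
  have "(\<Sum>i\<in>?I. c i * z ^ i) = (\<Sum>i=i0..card B. c i * z ^ i)"
    using below by (intro sum.mono_neutral_right) auto
  also have "\<dots> = c i0 * z ^ i0 + (\<Sum>i=Suc i0..card B. c i * z ^ i)"
    using i0 by (simp add: sum.atLeast_Suc_atMost)
  also have "(\<Sum>i=Suc i0..card B. c i * z ^ i) = z ^ i0 * (z * (\<Sum>i=Suc i0..card B. c i * z ^ (i - Suc i0)))"
    unfolding sum_distrib_left
  proof (intro sum.cong refl)
    fix i assume "i \<in> {Suc i0..card B}"
    then have "z ^ i = z ^ i0 * (z * z ^ (i - Suc i0))"
      by (simp flip: power_Suc power_add)
    then show "c i * z ^ i = z ^ i0 * (z * (c i * z ^ (i - Suc i0)))" by simp
  qed
  finally have "z ^ i0 * (c i0 + z * (\<Sum>i=Suc i0..card B. c i * z ^ (i - Suc i0))) = 0"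
    using c(3) by (simp add: algebra_simps)
  then have "c i0 = - (z * (\<Sum>i=Suc i0..card B. c i * z ^ (i - Suc i0)))"
    using z by (simp add: eq_neg_iff_add_eq_0)
  then have "(\<pi> ^ N * c i0) / z = - (\<pi> ^ N * (\<Sum>i=Suc i0..card B. c i * z ^ (i - Suc i0)))"
    using z by simp
  also have "\<dots> = - (\<Sum>i=Suc i0..card B. \<pi> ^ N * c i * z ^ (i - Suc i0))"
    by (simp add: sum_distrib_left mult.assoc)
  finally have eq: "(\<pi> ^ N * c i0) / z = - (\<Sum>i=Suc i0..card B. \<pi> ^ N * c i * z ^ (i - Suc i0))" .
  have quot: "(\<pi> ^ N * c i0) / z \<in> V"
    unfolding eq
    by (intro subring_uminus[OF subring] subring_sum[OF subring] subring_mult[OF subring V]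
        subring_power[OF subring z(1)]) simp
  from scaled[OF i0(1)] i0(2) pi(2) obtain u where u: "u \<in> units" "\<pi> ^ N * c i0 = \<pi> ^ nat (int N + K i0) * u"
    by auto
  have "\<pi> ^ nat (int N + K i0) / z = ((\<pi> ^ N * c i0) / z) * inverse u"
    using u unitsD by (simp add: field_simps)
  also have "\<dots> \<in> V" using quot u unitsD subring_mult[OF subring] by blast
  finally show ?thesis by blast
qed

lemma V_factor:
  assumes z: "z \<in> V" "z \<noteq> 0"
  shows "\<exists>k. \<exists>u\<in>units. z = unif ^ k * u"
proof (rule ccontr)
  assume no: "\<not> ?thesis"
  then have all: "z / unif ^ n \<in> V" for n using factor_unif z by blast
  obtain n where n: "\<pi> ^ n / z \<in> V" using divides_pi_power[OF z] by blast
  obtain k u where u: "u \<in> units" "\<pi> = unif ^ k * u" using pi_factor by blast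
  let ?N = "Suc (k * n)"
  have "(\<pi> ^ n / z) * (z / unif ^ ?N) * inverse (u ^ n) \<in> V"
    using subring_mult[OF subring subring_mult[OF subring n all]] unitsD[OF unit_power[OF u(1)]] by blast
  moreover have "(\<pi> ^ n / z) * (z / unif ^ ?N) * inverse (u ^ n) = inverse unif"
    using u unitsD[OF u(1)] unif(2) z by (simp add: power_mult_distrib field_simps flip: power_mult)
  ultimately show False using unif(1,2) by (simp add: nonunits_def)
qed

lemma factor:
  assumes z: "z \<noteq> 0"
  shows "\<exists>k. \<exists>u\<in>units. z = unif powi k * u"
proof (cases "z \<in> V")
  case True
  then show ?thesis using V_factor z by (metis power_int_of_nat)
next
  case False
  then have "inverse z \<in> V" using total by blast
  then obtain k u where u: "u \<in> units" "inverse z = unif ^ k * u" using V_factor[of "inverse z"] z by auto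
  then have "z = unif powi (- int k) * inverse u"
    by (metis inverse_inverse_eq inverse_mult_distrib power_int_minus power_int_of_nat)
  then show ?thesis using unit_inverse[OF u(1)] by blast
qed

lemma factor_nonunit:
  assumes "u \<in> units" "k > 0"
  shows "unif powi k * u \<in> nonunits"
  using assms unif_power_nonunit[of "nat k"] nonunits_mult unitsD by (auto simp: power_int_def)

lemma factor_unique:
  assumes u: "u \<in> units" "w \<in> units" and eq: "unif powi k * u = unif powi l * w"
  shows "k = l"
proof -
  have *: False if "u \<in> units" "w \<in> units" "unif powi k * u = unif powi l * w" "k < l" for u w k l
  proof -
    have "unif powi l = unif powi k * unif powi (l - k)"
      using unif(2) by (simp flip: power_int_add)
    then have "u = unif powi (l - k) * w" using that unif(2) by simp
    then show False using factor_nonunit[of w "l - k"] that unit_not_nonunit by auto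
  qed
  show ?thesis using *[OF u eq] *[OF u(2,1) eq[symmetric]] by (meson linorder_neqE)
qed

definition val :: "'f \<Rightarrow> int" where
  "val z = (if z = 0 then 0 else (THE k. \<exists>u\<in>units. z = unif powi k * u))"

lemma val_eq:
  assumes "u \<in> units"
  shows "val (unif powi k * u) = k"
proof -
  have "(THE k'. \<exists>w\<in>units. unif powi k * u = unif powi k' * w) = k"
    using assms factor_unique by (intro the_equality) blast+
  then show ?thesis using assms unitsD unif(2) by (simp add: val_def)
qed

lemma val_nonneg: "z \<noteq> 0 \<Longrightarrow> z \<in> V \<Longrightarrow> 0 \<le> val z"
proof -
  assume z: "z \<noteq> 0" "z \<in> V"
  then obtain k u where "u \<in> units" "z = unif ^ k * u" using V_factor by blast
  then show ?thesis using val_eq[of u "int k"] by simp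
qed

lemma val_pos: "z \<noteq> 0 \<Longrightarrow> z \<in> nonunits \<Longrightarrow> 0 < val z"
proof -
  assume z: "z \<noteq> 0" "z \<in> nonunits"
  then obtain k u where u: "u \<in> units" "z = unif ^ k * u" using V_factor nonunits_V by blast
  then have "k \<noteq> 0" using z unit_not_nonunit by (cases k) auto
  then show ?thesis using val_eq[of u "int k"] u by simp
qed

lemma val_place:
  assumes K: "is_subfield K" "K \<subseteq> V"
  shows "is_place K val"
proof -
  have mult: "val (a * b) = val a + val b" if ab: "a \<noteq> 0" "b \<noteq> 0" for a b
  proof -
    obtain k u l w where *: "u \<in> units" "a = unif powi k * u" "w \<in> units" "b = unif powi l * w"
      using factor[OF ab(1)] factor[OF ab(2)] by blast
    have "a * b = unif powi (k + l) * (u * w)" using * unif(2) by (simp add: power_int_add)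
    then have "val (a * b) = k + l" using val_eq[OF unit_mult[OF *(1,3)]] by (simp only:)
    then show ?thesis using val_eq[OF *(1)] val_eq[OF *(3)] *(2,4) by (simp only:)
  qed
  have le: "val a \<le> val (a + b)" if ab: "a \<noteq> 0" "b \<noteq> 0" "a + b \<noteq> 0" and "val a \<le> val b" for a b
  proof -
    have "b / a \<in> V"
    proof (rule ccontr)
      assume "b / a \<notin> V"
      then have "a / b \<in> nonunits" using ratio_nonunit ab by blast
      then have "0 < val (a / b)" using val_pos ab by simp
      moreover have "val a = val (a / b) + val b" using mult[of "a / b" b] ab by simp
      ultimately show False using that by simp
    qed
    then have "1 + b / a \<in> V" using subring_add[OF subring subring_1[OF subring]] by blast
    moreover have *: "a + b = a * (1 + b / a)" using ab by (simp add: field_simps)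
    ultimately show ?thesis using mult[of a "1 + b / a"] val_nonneg[of "1 + b / a"] ab by auto
  qed
  have "val c = 0" if "c \<in> K" "c \<noteq> 0" for c
  proof -
    have "c \<in> V" "inverse c \<in> V" using that K subfield_inverse[OF K(1)] by auto
    then have "c \<in> units" using that by (simp add: units_def)
    then show ?thesis using val_eq[of c 0] by simp
  qed
  moreover have "val unif = 1" using val_eq[OF one_unit, of 1] by simp
  moreover have "min (val a) (val b) \<le> val (a + b)" if "a \<noteq> 0" "b \<noteq> 0" "a + b \<noteq> 0" for a b
    using le[of a b] le[of b a] that by (auto simp: add.commute min_def)
  ultimately show ?thesis using mult unif(2) unfolding is_place_def
    by (auto simp: val_def intro!: exI[of _ unif])
qed

end

text \<open>
  If \<open>p\<close> has the least degree among the polynomials that a valuation ring maps to nonunits, then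
  all polynomials of lower degree become units, and division by \<open>p\<close> shows that \<open>p\<close> is a
  uniformizer on the rational function field.
\<close>

lemma (in valuation_ring_set) rational_functions_discrete:
  assumes K: "is_subfield K" "K \<subseteq> V" and w: "w \<in> V"
    and p: "p \<in> polys K" "p \<noteq> 0" "poly p w \<in> nonunits"
    and min: "\<And>r. r \<in> polys K \<Longrightarrow> r \<noteq> 0 \<Longrightarrow> degree r < degree p \<Longrightarrow> poly r w \<notin> nonunits"
    and p0: "poly p w \<noteq> 0"
  shows "\<And>r. r \<in> adjoin K {w} \<Longrightarrow> r \<noteq> 0 \<Longrightarrow> \<exists>k. \<exists>u\<in>units. r = poly p w powi k * u"
proof -
  note R = subfield_subring[OF K(1)]
  have polyV: "poly a w \<in> V" if "a \<in> polys K" for a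
    using poly_in_subring[OF subring _ w] that polys_mono[OF K(2)] by blast
  have poly: "\<exists>n. \<exists>u\<in>units. poly a w = poly p w ^ n * u" if "a \<in> polys K" "a \<noteq> 0" for a
    using that
  proof (induction "degree a" arbitrary: a rule: less_induct)
    case less
    obtain s r where sr: "s \<in> polys K" "r \<in> polys K" "a = p * s + r" "r = 0 \<or> degree r < degree p"
      using polys_division[OF K(1) p(1,2) less.prems(1)] by blast
    show ?case
    proof (cases "r = 0")
      case False
      then have "poly r w \<notin> nonunits" using min sr by blast
      then have "poly r w \<in> units" using polyV[OF sr(2)] unit_or_nonunit by blast
      then have "poly r w + poly p w * poly s w \<in> units"
        using p(3) polyV[OF sr(1)] by (intro unit_add_nonunit nonunits_mult) auto
      then show ?thesis using sr by (intro exI[of _ 0]) (auto simp: add.commute)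
    next
      case True
      have "degree p > 0"
      proof (rule ccontr)
        assume "\<not> degree p > 0"
        then obtain c where c: "c \<in> K" "c \<noteq> 0" "p = [:c:]"
          using polys_degree_0[OF p(1,2)] by blast
        then show False using p(3) c K subfield_inverse[OF K(1)] by (auto simp: nonunits_def)
      qed
      moreover have "s \<noteq> 0" using True sr less.prems by auto
      ultimately have "degree s < degree a" using True sr p by (simp add: degree_mult_eq)
      then obtain n u where "u \<in> units" "poly s w = poly p w ^ n * u"
        using less.hyps sr \<open>s \<noteq> 0\<close> by blast
      then show ?thesis using True sr by (intro exI[of _ "Suc n"]) auto
    qed
  qed
  fix r assume r: "r \<in> adjoin K {w}" "r \<noteq> 0"
  then obtain a b where ab: "a \<in> polys K" "b \<in> polys K" "b \<noteq> 0" "poly b w \<noteq> 0"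
    "r = poly a w / poly b w" using adjoin_single_fraction[OF K(1)] by metis
  then have "a \<noteq> 0" using r by auto
  then obtain n u l u' where *: "u \<in> units" "poly a w = poly p w ^ n * u"
    "u' \<in> units" "poly b w = poly p w ^ l * u'"
    using poly[OF ab(1)] poly[OF ab(2,3)] by blast
  have "r = poly p w powi (int n - int l) * (u * inverse u')"
    using ab * p0 unitsD[OF *(3)] by (simp add: power_int_diff field_simps)
  then show "\<exists>k. \<exists>u\<in>units. r = poly p w powi k * u"
    using unit_mult[OF *(1) unit_inverse[OF *(3)]] by blast
qed

text \<open>
  The source of all places other than the given one. In \<open>K[w]\<close> the nonconstant polynomial \<open>p(w)\<close> is not
  invertible, and a valuation ring containing \<open>K[w]\<close> in which it stays noninvertible is discrete, since
  it is so on the rational functions in \<open>w\<close>.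
\<close>

theorem place_exists:
  fixes K :: "'f::field set"
  assumes K: "is_subfield K" and w: "transcendental_over K w" and fin: "finite_over (adjoin K {w})"
    and p: "p \<in> polys K" "degree p > 0"
  shows "\<exists>v. is_place K v \<and> vge v 0 w \<and> poly p w \<noteq> 0 \<and> 0 < v (poly p w)"
proof -
  note R = subfield_subring[OF K]
  note tr = w[unfolded transcendental_polys[OF K], rule_format]
  let ?A = "poly_values K w"
  have "p \<noteq> 0" using p by auto
  then have pw: "poly p w \<noteq> 0" using tr p by blast
  have "inverse (poly p w) \<notin> ?A"
  proof
    assume "inverse (poly p w) \<in> ?A"
    then obtain r where r: "r \<in> polys K" "inverse (poly p w) = poly r w" by blast
    then have "poly (p * r - 1) w = 0" using pw by (auto simp: field_simps)
    then have "p * r - 1 = 0"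
      using tr[of "p * r - 1"] R r p by (auto intro: polys_diff polys_mult polys_1)
    then have "p * r = 1" by simp
    then have "degree p = 0" by (metis degree_1 degree_mult_eq mult_zero_left mult_zero_right add_is_0 zero_neq_one)
    then show False using p by simp
  qed
  then obtain V where V: "is_subring V" "?A \<subseteq> V" "inverse (poly p w) \<notin> V" "\<And>z. z \<in> V \<or> inverse z \<in> V"
    using valuation_ring_exists[OF subring_poly_values[OF R], of "poly p w" w] p by blast
  interpret valuation_ring_set V using V by unfold_locales auto
  have KV: "K \<subseteq> V" and wV: "w \<in> V" using V(2) poly_values_base[OF R] poly_values_gen[OF R] by blast+
  have "poly p w \<in> nonunits" using V p by (auto simp: nonunits_def)
  then obtain r where r: "r \<in> polys K" "r \<noteq> 0" "poly r w \<in> nonunits"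
    and least: "\<And>s. s \<in> polys K \<and> s \<noteq> 0 \<and> poly s w \<in> nonunits \<Longrightarrow> degree r \<le> degree s"
    using ex_has_least_nat[of "\<lambda>r. r \<in> polys K \<and> r \<noteq> 0 \<and> poly r w \<in> nonunits" p degree]
      p(1) \<open>p \<noteq> 0\<close> by blast
  have min: "poly s w \<notin> nonunits" if "s \<in> polys K" "s \<noteq> 0" "degree s < degree r" for s
    using least[of s] that by auto
  have rw: "poly r w \<noteq> 0" using tr r by blast
  obtain B where B: "finite B" "\<And>f. \<exists>c. c ` B \<subseteq> adjoin K {w} \<and> f = (\<Sum>b\<in>B. c b * b)"
    using fin unfolding finite_over_def by blast
  interpret valuation_ring_over V "adjoin K {w}" B "poly r w"
    using subfield_adjoin B r(3) rw rational_functions_discrete[OF K KV wV r(1-3) min rw]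
    by unfold_locales auto
  have "vge val 0 w" using val_nonneg wV by (auto simp: vge_def)
  moreover have "0 < val (poly p w)" using val_pos pw \<open>poly p w \<in> nonunits\<close> by blast
  ultimately show ?thesis using val_place[OF K KV] pw by blast
qed

text \<open>
  At a zero of a denominator of least degree the numerator has to vanish too. The polynomial of least
  degree that vanishes there divides both, and cancelling it gives a smaller denominator.
\<close>

theorem no_finite_poles_imp_poly:
  fixes K :: "'f::field set"
  assumes K: "is_subfield K" and y: "transcendental_over K y" and fin: "finite_over (adjoin K {y})"
    and r: "r \<in> adjoin K {y}" and reg: "\<And>v. is_place K v \<Longrightarrow> vge v 0 y \<Longrightarrow> vge v 0 r"
  shows "\<exists>p\<in>polys K. r = poly p y"
proof -
  note R = subfield_subring[OF K]
  note tr = y[unfolded transcendental_polys[OF K], rule_format]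
  let ?rep = "\<lambda>b. b \<in> polys K \<and> b \<noteq> 0 \<and> (\<exists>a\<in>polys K. r * poly b y = poly a y)"
  have "\<exists>b. ?rep b"
    using adjoin_single_fraction[OF K r] by (metis nonzero_divide_eq_eq)
  then obtain b where b: "?rep b" and minb: "\<And>b'. ?rep b' \<Longrightarrow> degree b \<le> degree b'"
    using ex_has_least_nat[of ?rep _ degree] by blast
  then obtain a where a: "a \<in> polys K" "r * poly b y = poly a y" by blast
  have "degree b = 0"
  proof (rule ccontr)
    assume "degree b \<noteq> 0"
    then obtain v where v: "is_place K v" "vge v 0 y" "poly b y \<noteq> 0" "0 < v (poly b y)"
      using place_exists[OF K y fin, of b] b by auto
    let ?van = "\<lambda>p. p \<in> polys K \<and> p \<noteq> 0 \<and> vge v 1 (poly p y)"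
    have "?van b" using b v by (simp add: vge_def)
    then obtain p where p: "?van p" and minp: "\<And>p'. ?van p' \<Longrightarrow> degree p \<le> degree p'"
      using ex_has_least_nat[of ?van _ degree] by blast
    have dvd: "\<exists>s\<in>polys K. c = p * s" if c: "c \<in> polys K" "vge v 1 (poly c y)" for c
    proof -
      obtain s t where st: "s \<in> polys K" "t \<in> polys K" "c = p * s + t" "t = 0 \<or> degree t < degree p"
        using polys_division[OF K _ _ c(1)] p by blast
      have "vge v (1 + 0) (poly p y * poly s y)"
        using p st v by (intro vge_mult[OF v(1)] vge_poly[OF v(1)]) auto
      then have "vge v 1 (poly c y - poly p y * poly s y)" using c by (intro vge_diff[OF v(1)]) auto
      then have "vge v 1 (poly t y)" using st by simp
      then have "t = 0" using minp[of t] st by force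
      then show ?thesis using st by auto
    qed
    have "vge v (0 + 1) (r * poly b y)" using reg v by (intro vge_mult[OF v(1)]) (auto simp: vge_def)
    then obtain a' where a': "a' \<in> polys K" "a = p * a'" using dvd[of a] a by auto
    obtain b' where b': "b' \<in> polys K" "b = p * b'" using dvd[of b] b v by (auto simp: vge_def)
    have py: "poly p y \<noteq> 0" using tr p by blast
    have "?rep b'" using a' b' b a py by auto
    then have "degree b \<le> degree b'" by (rule minb)
    then have "degree p = 0" using b b' by (auto simp: degree_mult_eq)
    then obtain c where c: "c \<in> K" "c \<noteq> 0" "p = [:c:]" using polys_degree_0[of p K] p by blast
    then show False using p place_const[OF v(1)] by (auto simp: vge_def)
  qed
  then obtain c where c0: "c \<in> K" "c \<noteq> 0" and c: "b = [:c:]" using polys_degree_0[of b K] b by blast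
  then have "r = poly (smult (inverse c) a) y" using a c by (simp add: field_simps)
  then show ?thesis using a c0 K R by (auto intro!: bexI[of _ "smult (inverse c) a"] polys_smult subfield_inverse)
qed

section \<open>Characteristic three and the field of \<open>q\<^sup>2\<close> elements\<close>

lemma cube_add: "(3::'f::field) = 0 \<Longrightarrow> (a + b) ^ 3 = a ^ 3 + (b::'f) ^ 3"
proof -
  assume "(3::'f) = 0"
  moreover have "(a + b) ^ 3 = a ^ 3 + b ^ 3 + 3 * (a\<^sup>2 * b + a * b\<^sup>2)"
    by (simp add: power3_eq_cube power2_eq_square algebra_simps)
  ultimately show ?thesis by simp
qed

lemma frobenius_add: "(3::'f::field) = 0 \<Longrightarrow> (a + b) ^ 3 ^ i = a ^ 3 ^ i + (b::'f) ^ 3 ^ i"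
  by (induction i) (auto simp: power_mult power_Suc2 simp del: power_Suc simp: cube_add)

lemma frobenius_diff: "(3::'f::field) = 0 \<Longrightarrow> (a - b) ^ 3 ^ i = a ^ 3 ^ i - (b::'f) ^ 3 ^ i"
  using frobenius_add[of a "- b" i] by simp

lemma trace_sum_add: "(3::'f::field) = 0 \<Longrightarrow> trace_sum t (a + b) = trace_sum t a + trace_sum t (b::'f)"
  by (simp add: trace_sum_def frobenius_add sum.distrib)

lemma trace_sum_uminus: "trace_sum t (- a) = - trace_sum t (a::'f::field)"
  by (simp add: trace_sum_def sum_negf)

lemma trace_sum_cube:
  assumes "(3::'f::field) = 0"
  shows "trace_sum t (a::'f) ^ 3 = trace_sum t a + a ^ 3 ^ t - a"
proof (induction t)
  case 0
  then show ?case by (simp add: trace_sum_def)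
next
  case (Suc t)
  have "trace_sum (Suc t) a ^ 3 = trace_sum t a ^ 3 + (a ^ 3 ^ t) ^ 3"
    by (simp add: trace_sum_def cube_add assms)
  also have "(a ^ 3 ^ t) ^ 3 = a ^ 3 ^ Suc t" by (simp add: power_mult power_Suc2 del: power_Suc)
  finally show ?case using Suc by (simp add: trace_sum_def)
qed

lemma subfield_card_eq_0:
  fixes K :: "'f::field set"
  assumes "is_subfield K" "finite K"
  shows "of_nat (card K) = (0::'f)"
proof -
  note R = subfield_subring[OF assms(1)]
  have "bij_betw (\<lambda>c. c + 1) K K"
    by (rule bij_betw_byWitness[of _ "\<lambda>c. c - 1"])
      (use R in \<open>auto intro: subring_add subring_diff subring_1\<close>)
  then have "(\<Sum>c\<in>K. c + 1) = \<Sum>K" by (rule sum.reindex_bij_betw)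
  then show ?thesis by (simp add: sum.distrib)
qed

lemma subfield_power_card:
  fixes K :: "'f::field set"
  assumes K: "is_subfield K" "finite K" and c: "c \<in> K"
  shows "c ^ card K = c"
proof (cases "c = 0")
  case True
  have "card K > 0" using c K by (auto simp: card_gt_0_iff)
  then show ?thesis using True by simp
next
  case False
  note R = subfield_subring[OF K(1)]
  let ?U = "K - {0}"
  have "bij_betw (\<lambda>x. c * x) ?U ?U"
  proof (rule bij_betw_byWitness[of _ "\<lambda>x. inverse c * x"])
    show "(\<lambda>x. c * x) ` ?U \<subseteq> ?U" "(\<lambda>x. inverse c * x) ` ?U \<subseteq> ?U"
      using False c subring_mult[OF R] subfield_inverse[OF K(1) c] by auto
  qed (use False in \<open>simp_all add: mult.assoc[symmetric]\<close>)
  then have "(\<Prod>x\<in>?U. c * x) = \<Prod>?U" by (rule prod.reindex_bij_betw)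
  then have "c ^ card ?U * \<Prod>?U = \<Prod>?U" by (simp add: prod.distrib)
  moreover have "\<Prod>?U \<noteq> 0" using K by simp
  ultimately have "c ^ card ?U = 1" by simp
  moreover have "card K = Suc (card ?U)"
    using K subring_0[OF R] by (metis card.remove)
  ultimately show ?thesis by simp
qed

locale finite_field_q2 =
  fixes K :: "'f::field set" and t q :: nat
  assumes K: "is_subfield K" and card_K: "card K = q\<^sup>2" and q: "q = 3 ^ t" and t: "t \<ge> 1"
begin

lemma q_ge: "q \<ge> 3"
proof -
  have "(3::nat) ^ 1 \<le> 3 ^ t" using t by (intro power_increasing) auto
  then show ?thesis using q by simp
qed

lemma finite_K: "finite K"
  using card_K q by (intro card_ge_0_finite) auto

lemma K_ring: "is_subring K" by (rule subfield_subring[OF K])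

lemma three: "(3::'f) = 0"
  using subfield_card_eq_0[OF K finite_K] by (simp add: card_K q)

lemma q_zero: "of_nat q = (0::'f)"
  using three t by (simp add: q)

lemma frob_add: "(a + b) ^ q = a ^ q + (b::'f) ^ q"
  unfolding q by (rule frobenius_add[OF three])

lemma frob_diff: "(a - b) ^ q = a ^ q - (b::'f) ^ q"
  unfolding q by (rule frobenius_diff[OF three])

lemma frob2: "c \<in> K \<Longrightarrow> (c ^ q) ^ q = c"
  using subfield_power_card[OF K finite_K, of c] by (simp add: card_K power2_eq_square flip: power_mult)

lemma power_q_add_dominant:
  assumes v: "is_place K v" and z: "v z < 0"
  shows "z ^ q + z \<noteq> 0" "v (z ^ q + z) = int q * v z"
proof -
  have "int q * v z \<le> 3 * v z" using q_ge z by (intro mult_right_mono_neg) auto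
  then have "v (z ^ q) + 1 \<le> v z" using z unfolding place_power[OF v] by linarith
  then have "vge v (v (z ^ q) + 1) z" by (rule vgeI)
  moreover have "z ^ q \<noteq> 0" using z place_0[OF v] by auto
  ultimately show "z ^ q + z \<noteq> 0" "v (z ^ q + z) = int q * v z"
    using place_add_dominant[OF v] place_power[OF v] by metis+
qed

lemma power_q_add_finite:
  assumes v: "is_place K v" and "vge v 0 (z ^ q + z)"
  shows "vge v 0 z"
proof (rule ccontr)
  assume "\<not> vge v 0 z"
  then have "v z < 0" by (auto simp: vge_def)
  then show False using power_q_add_dominant[OF v, of z] assms(2) q_ge
    by (auto simp: vge_def zero_le_mult_iff)
qed

lemma power_q_add_pole:
  assumes v: "is_place K v" and z: "v (z ^ q + z) < 0"
  shows "v z < 0" "int q * v z = v (z ^ q + z)"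
proof -
  show "v z < 0"
  proof (rule ccontr)
    assume "\<not> v z < 0"
    then have z0: "vge v 0 z" by (simp add: vge_def)
    have "vge v 0 (z ^ q + z)" using vge_add[OF v vge_power[OF v z0, of q]] z0 by simp
    then show False using z place_0[OF v] by (auto simp: vge_def)
  qed
  from power_q_add_dominant(2)[OF v this] show "int q * v z = v (z ^ q + z)" by simp
qed

definition fixed_q :: "'f set" where "fixed_q = {c\<in>K. c ^ q = c}"

definition anti_q :: "'f set" where "anti_q = {c\<in>K. c ^ q = - c}"

lemma card_roots_le:
  assumes "degree r < n"
  shows "card {z. z ^ n + poly r z = 0} \<le> n" "finite {z::'f. z ^ n + poly r z = 0}"
proof -
  let ?p = "monom 1 n + r"
  have "degree ?p = n" using assms by (simp add: degree_add_eq_left degree_monom_eq)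
  moreover have "?p \<noteq> 0" using calculation assms by auto
  moreover have "{z. poly ?p z = 0} = {z. z ^ n + poly r z = 0}" by (simp add: poly_monom)
  ultimately show "card {z. z ^ n + poly r z = 0} \<le> n" "finite {z::'f. z ^ n + poly r z = 0}"
    using card_poly_roots_bound[of ?p] poly_roots_finite[of ?p] by auto
qed

text \<open>
  The additive map \<open>c \<mapsto> c ^ q - c\<close> has kernel \<open>fixed_q\<close> and takes values in \<open>anti_q\<close>. Both sets
  have at most \<open>q\<close> elements, so they have exactly \<open>q\<close>.
\<close>

lemma card_fixed_anti: "card fixed_q = q" "card anti_q = q"
proof -
  have fin: "finite fixed_q" "finite anti_q"
    using finite_K by (auto simp: fixed_q_def anti_q_def)
  have deg: "degree [:0, - 1::'f:] < q" "degree [:0, 1::'f:] < q" using q_ge by simp_all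
  have sub: "fixed_q \<subseteq> {z. z ^ q + poly [:0, -1:] z = 0}" "anti_q \<subseteq> {z. z ^ q + poly [:0, 1:] z = 0}"
    by (auto simp: fixed_q_def anti_q_def)
  have le: "card fixed_q \<le> q" "card anti_q \<le> q"
    using order_trans[OF card_mono[OF card_roots_le(2)[OF deg(1)] sub(1)] card_roots_le(1)[OF deg(1)]]
      order_trans[OF card_mono[OF card_roots_le(2)[OF deg(2)] sub(2)] card_roots_le(1)[OF deg(2)]] by simp_all
  have fiber: "card {c\<in>K. c ^ q - c = a} \<le> card fixed_q" for a
  proof (cases "{c\<in>K. c ^ q - c = a} = {}")
    case False
    then obtain c0 where c0: "c0 \<in> K" "c0 ^ q - c0 = a" by blast
    have "{c\<in>K. c ^ q - c = a} \<subseteq> (\<lambda>d. d + c0) ` fixed_q"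
    proof
      fix c assume c: "c \<in> {c\<in>K. c ^ q - c = a}"
      then have "c - c0 \<in> K" using K_ring c0 by (auto intro: subring_diff)
      moreover have "c ^ q - c = a" using c by simp
      then have "c ^ q = a + c" "c0 ^ q = a + c0" using c0(2) by (simp_all only: diff_eq_eq)
      then have "(c - c0) ^ q = c - c0" by (simp add: frob_diff)
      ultimately have "c - c0 \<in> fixed_q" by (simp add: fixed_q_def)
      then show "c \<in> (\<lambda>d. d + c0) ` fixed_q" by (intro image_eqI[of _ _ "c - c0"]) auto
    qed
    then show ?thesis using fin by (meson card_image_le card_mono finite_imageI order_trans)
  next
    case True
    then show ?thesis by (simp only: card.empty)
  qed
  have "K \<subseteq> (\<Union>a\<in>anti_q. {c\<in>K. c ^ q - c = a})"
  proof
    fix c assume c: "c \<in> K"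
    have "c ^ q - c \<in> anti_q"
      using c frob2[OF c] K_ring by (auto simp: anti_q_def frob_diff intro: subring_diff subring_power)
    then show "c \<in> (\<Union>a\<in>anti_q. {c\<in>K. c ^ q - c = a})" using c by blast
  qed
  then have "card K \<le> card (\<Union>a\<in>anti_q. {c\<in>K. c ^ q - c = a})"
    using fin finite_K by (intro card_mono) auto
  also have "\<dots> \<le> (\<Sum>a\<in>anti_q. card {c\<in>K. c ^ q - c = a})" by (rule card_UN_le[OF fin(2)])
  also have "\<dots> \<le> card anti_q * card fixed_q"
    using sum_bounded_above[of anti_q "\<lambda>a. card {c\<in>K. c ^ q - c = a}" "card fixed_q"] fiber by simp
  finally have "q * q \<le> card anti_q * card fixed_q" by (simp add: card_K power2_eq_square)
  moreover have "card anti_q * card fixed_q \<le> card anti_q * q" "card anti_q * card fixed_q \<le> q * card fixed_q"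
    using le by auto
  ultimately have "q * q \<le> card anti_q * q" "q * q \<le> q * card fixed_q" by linarith+
  then have "q \<le> card anti_q" "q \<le> card fixed_q" using q_ge by auto
  then show "card fixed_q = q" "card anti_q = q" using le by auto
qed

lemma zero_anti: "0 \<in> anti_q"
  using subring_0[OF K_ring] q_ge by (simp add: anti_q_def)

lemma finite_anti: "finite anti_q"
  using finite_K by (simp add: anti_q_def)

text \<open>
  Multiplication by an element of \<open>fixed_q\<close> permutes \<open>anti_q\<close>, which makes all the power sums of
  positive exponent below \<open>q - 1\<close> vanish. The one of exponent \<open>0\<close> is \<open>q = 0\<close>.
\<close>

lemma power_sum_anti:
  assumes "i \<le> q - 1"
  shows "(\<Sum>\<alpha>\<in>anti_q. \<alpha> ^ i) = (if i = q - 1 then 1 else 0)"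
proof -
  consider "i = 0" | "0 < i" "i < q - 1" | "i = q - 1" using assms by linarith
  then show ?thesis
  proof cases
    case 1
    then show ?thesis using card_fixed_anti q_zero q_ge by simp
  next
    case 2
    have "\<not> fixed_q - {0} \<subseteq> {z. z ^ i + poly [:-1:] z = 0}"
    proof
      assume "fixed_q - {0} \<subseteq> {z. z ^ i + poly [:-1:] z = 0}"
      then have "card (fixed_q - {0}) \<le> i"
        using order_trans[OF card_mono[OF card_roots_le(2)] card_roots_le(1)] 2 by (simp only: degree_pCons_0)
      moreover have "card (fixed_q - {0}) \<ge> q - 1"
        using card_fixed_anti(1) diff_card_le_card_Diff[of "{0}" fixed_q] by simp
      ultimately show False using 2 by simp
    qed
    then obtain c where c: "c \<in> K" "c ^ q = c" "c \<noteq> 0" "c ^ i \<noteq> 1" by (auto simp: fixed_q_def)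
    have "bij_betw (\<lambda>x. c * x) anti_q anti_q"
    proof (rule bij_betw_byWitness[of _ "\<lambda>x. inverse c * x"])
      show "(\<lambda>x. c * x) ` anti_q \<subseteq> anti_q" "(\<lambda>x. inverse c * x) ` anti_q \<subseteq> anti_q"
        using c(2) subring_mult[OF K_ring c(1)] subring_mult[OF K_ring subfield_inverse[OF K c(1)]]
        by (auto simp: anti_q_def power_mult_distrib power_inverse)
    qed (use c in \<open>simp_all add: mult.assoc[symmetric]\<close>)
    then have "(\<Sum>\<alpha>\<in>anti_q. (c * \<alpha>) ^ i) = (\<Sum>\<alpha>\<in>anti_q. \<alpha> ^ i)"
      by (rule sum.reindex_bij_betw)
    then have "c ^ i * (\<Sum>\<alpha>\<in>anti_q. \<alpha> ^ i) = (\<Sum>\<alpha>\<in>anti_q. \<alpha> ^ i)"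
      by (simp add: power_mult_distrib sum_distrib_left)
    then have "(c ^ i - 1) * (\<Sum>\<alpha>\<in>anti_q. \<alpha> ^ i) = 0" by (simp add: algebra_simps)
    then show ?thesis using c 2 by simp
  next
    case 3
    have "\<alpha> ^ i = -1" if "\<alpha> \<in> anti_q - {0}" for \<alpha>
    proof -
      have "\<alpha> * \<alpha> ^ (q - 1) = \<alpha> ^ q" using q_ge by (cases q) auto
      also have "\<dots> = \<alpha> * (- 1)" using that by (simp add: anti_q_def)
      finally show ?thesis using that 3 by (metis DiffE insertI1 mult_left_cancel)
    qed
    then have "(\<Sum>\<alpha>\<in>anti_q - {0}. \<alpha> ^ i) = - of_nat (card (anti_q - {0}))" by simp
    also have "card (anti_q - {0}) = q - 1" using card_fixed_anti zero_anti finite_anti by simp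
    also have "- of_nat (q - 1) = (1::'f)"
      using q_ge q_zero by (simp add: of_nat_diff)
    finally show ?thesis
      using zero_anti finite_anti 3 q_ge by (simp add: sum.remove[of anti_q 0] power_0_left)
  qed
qed

lemma sum_anti_poly:
  assumes "degree p < q"
  shows "(\<Sum>\<alpha>\<in>anti_q. poly p (z + \<alpha>)) = coeff p (q - 1)"
proof -
  have pw: "(\<Sum>\<alpha>\<in>anti_q. (z + \<alpha>) ^ i) = (if i = q - 1 then 1 else 0)" if i: "i \<le> q - 1" for i
  proof -
    have "(\<Sum>\<alpha>\<in>anti_q. (z + \<alpha>) ^ i) = (\<Sum>k\<le>i. of_nat (i choose k) * z ^ (i - k) * (\<Sum>\<alpha>\<in>anti_q. \<alpha> ^ k))"
      by (subst add.commute, subst binomial_ring, subst sum.swap)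
        (simp add: sum_distrib_left mult_ac)
    also have "\<dots> = (\<Sum>k\<le>i. if k = q - 1 then of_nat (i choose k) * z ^ (i - k) else 0)"
      using i by (intro sum.cong) (auto simp: power_sum_anti)
    also have "\<dots> = (if i = q - 1 then 1 else 0)" using i by (auto simp: sum.delta)
    finally show ?thesis .
  qed
  have "(\<Sum>\<alpha>\<in>anti_q. poly p (z + \<alpha>)) = (\<Sum>i\<le>degree p. coeff p i * (\<Sum>\<alpha>\<in>anti_q. (z + \<alpha>) ^ i))"
    by (simp add: poly_altdef sum_distrib_left) (rule sum.swap)
  also have "\<dots> = (\<Sum>i\<le>degree p. if i = q - 1 then coeff p i else 0)"
    using assms by (intro sum.cong) (auto simp: pw)
  also have "\<dots> = coeff p (q - 1)"
    by (auto simp: sum.delta coeff_eq_0)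
  finally show ?thesis .
qed

end

section \<open>The curve with the point moved to the origin\<close>

lemma trace_sum_vge:
  assumes v: "is_place K v" and z: "vge v k z" and k: "k \<ge> 0"
  shows "vge v k (trace_sum t z)"
  unfolding trace_sum_def
proof (rule vge_sum[OF v])
  fix i
  have "1 * k \<le> int (3 ^ i) * k" using k by (intro mult_right_mono) auto
  then show "vge v k (z ^ 3 ^ i)" using vge_mono[OF vge_power[OF v z, of "3 ^ i"]] by simp
qed

lemma trace_sum_rest:
  assumes v: "is_place K v" and z: "vge v 1 z" and t: "t \<ge> 1"
  shows "vge v (3 * v z) (trace_sum t z - z)"
proof (cases "z = 0")
  case True
  then show ?thesis by (simp add: trace_sum_def power_0_left)
next
  case False
  then have z1: "v z \<ge> 1" using z by (simp add: vge_def)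
  obtain t' where t': "t = Suc t'" using t by (cases t) auto
  have "trace_sum t z - z = (\<Sum>i<t'. z ^ 3 ^ Suc i)"
    unfolding t' trace_sum_def by (subst sum.lessThan_Suc_shift) simp
  moreover have "vge v (3 * v z) (z ^ 3 ^ Suc i)" for i
  proof -
    have "(3::nat) ^ 1 \<le> 3 ^ Suc i" by (intro power_increasing) auto
    then have "int 3 \<le> int (3 ^ Suc i)" unfolding of_nat_le_iff by simp
    then have "3 \<le> int (3 ^ Suc i)" by simp
    then have "3 * v z \<le> int (3 ^ Suc i) * v z" using z1 by (intro mult_right_mono) auto
    then show ?thesis by (simp add: vge_def place_power[OF v])
  qed
  ultimately show ?thesis using vge_sum[OF v] by metis
qed

lemma trace_sum_power3: "trace_sum t (z ^ 3) = trace_sum t (z::'f::field) ^ 3" if "(3::'f) = 0"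
proof -
  have "trace_sum t (z ^ 3) = (\<Sum>i<t. (z ^ 3 ^ i) ^ 3)"
    by (simp add: trace_sum_def mult.commute flip: power_mult)
  also have "\<dots> = trace_sum t z ^ 3"
    unfolding trace_sum_def by (induction t) (auto simp: cube_add[OF that])
  finally show ?thesis .
qed

lemma vge_root:
  assumes v: "is_place K v" and "vge v 1 (z ^ n)"
  shows "vge v 1 z"
proof (cases "z = 0")
  case False
  then have "1 \<le> int n * v z" using assms by (simp add: vge_def place_power[OF v])
  then have "0 < v z" by (metis int_one_le_iff_zero_less less_le_trans linorder_not_less mult_nonneg_nonpos of_nat_0_le_iff zero_less_one)
  then show ?thesis by (simp add: vge_def)
qed simp

locale curve = finite_field_q2 K t q for K :: "'f::field set" and t q :: nat +
  fixes m :: nat and X Y :: 'f and P :: "'f \<Rightarrow> int"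
  assumes m: "m = q div 3" and gen: "adjoin K {X, Y} = UNIV"
    and curve: "X ^ q + X + (trace_sum t Y)\<^sup>2 + trace_sum t Y = 0"
    and P: "is_place K P" and PX: "vge P 1 X" and PY: "vge P 1 Y"
begin

abbreviation T :: 'f where "T \<equiv> trace_sum t Y"

definition \<tau> :: 'f where "\<tau> = X ^ 3 - X\<^sup>2 + Y\<^sup>2"

lemma q_m: "q = 3 * m" "m = 3 ^ (t - 1)" "m \<ge> 1"
proof -
  obtain t' where "t = Suc t'" using t by (cases t) auto
  then show "q = 3 * m" "m = 3 ^ (t - 1)" "m \<ge> 1" by (auto simp: m q)
qed

lemma X_q: "X ^ q = - X - T\<^sup>2 - T"
  using curve by (simp add: algebra_simps eq_neg_iff_add_eq_0)

lemma Y_q: "Y ^ q = Y + T ^ 3 - T"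
  using trace_sum_cube[OF three, of t Y] by (simp add: q)

definition zero_place :: "('f \<Rightarrow> int) \<Rightarrow> bool" where
  "zero_place v \<longleftrightarrow> is_place K v \<and> vge v 1 X \<and> vge v 1 Y"

lemma zero_place_P: "zero_place P"
  using P PX PY by (simp add: zero_place_def)

lemma Y_nonzero: "Y \<noteq> 0"
proof
  assume Y: "Y = 0"
  then have "X * (1 + X ^ (q - 1)) = 0"
    using curve q_ge by (cases q) (auto simp: trace_sum_def power_0_left algebra_simps)
  moreover have "vge P 1 (X ^ (q - 1))"
    using vge_mono[OF vge_power[OF P PX, of "q - 1"], of 1] q_ge by simp
  then have "1 + X ^ (q - 1) \<noteq> 0"
    using vge_add_const[OF P _ subring_1[OF K_ring]] by auto
  ultimately have "X = 0" by simp
  then have "adjoin K {X, Y} \<subseteq> K" using Y K subring_0[OF K_ring] by (intro adjoin_least) auto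
  then have "K = UNIV" using gen by blast
  then show False using place_onto[OF P] place_const[OF P] by (metis UNIV_I zero_neq_one)
qed

text \<open>
  In \<open>X + X ^ q = - (T + T\<^sup>2)\<close> and in \<open>T\<close> the linear terms dominate.
\<close>

lemma zero_place_vals:
  assumes "zero_place v"
  shows "v Y \<ge> 1" "v T = v Y" "T \<noteq> 0" "X \<noteq> 0" "v X = v Y"
proof -
  from assms have v: "is_place K v" and vX: "vge v 1 X" and vY: "vge v 1 Y" by (auto simp: zero_place_def)
  show Y1: "v Y \<ge> 1" using vY Y_nonzero by (simp add: vge_def)
  have "vge v (v Y + 1) (T - Y)"
    using vge_mono[OF trace_sum_rest[OF v vY t]] Y1 by simp
  from place_add_dominant[OF v Y_nonzero this] show T: "v T = v Y" "T \<noteq> 0" by simp_all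
  have "v T + 1 \<le> int 2 * v T" using T Y1 by simp
  then have "vge v (v T + 1) (T\<^sup>2)" unfolding vge_def place_power[OF v] by blast
  from place_add_dominant[OF v T(2) this] have T2: "T + T\<^sup>2 \<noteq> 0" "v (T + T\<^sup>2) = v Y" using T by auto
  have eq: "X + X ^ q = - (T + T\<^sup>2)" using X_q by simp
  show X0: "X \<noteq> 0"
  proof
    assume "X = 0"
    then have "X + X ^ q = 0" using q_ge by (simp add: power_0_left)
    then have "T + T\<^sup>2 = 0" unfolding eq by (simp only: neg_equal_0_iff_equal)
    then show False using T2(1) by contradiction
  qed
  have "v X \<ge> 1" using vX X0 by (simp add: vge_def)
  moreover have "3 * v X \<le> int q * v X" using calculation q_ge by (intro mult_right_mono) auto
  ultimately have "v X + 1 \<le> int q * v X" by linarith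
  then have "vge v (v X + 1) (X ^ q)" unfolding vge_def place_power[OF v] by blast
  from place_add_dominant(2)[OF v X0 this] show "v X = v Y"
    unfolding eq place_uminus[OF v] T2(2) by simp
qed

section \<open>The place at the origin is unique, and \<open>Y\<close> is a uniformizer\<close>

text \<open>
  The exponent is the order of vanishing of \<open>B\<close> at \<open>0\<close>. It matters that it does not depend on \<open>v\<close>.
\<close>

lemma zero_place_poly:
  assumes "B \<in> polys K" "B \<noteq> 0"
  shows "poly B Y \<noteq> 0 \<and> (\<exists>k. \<forall>v. zero_place v \<longrightarrow> v (poly B Y) = int k * v Y)"
  using assms
proof (induction B)
  case (pCons a B)
  have a: "a \<in> K" using polys_coeff[OF pCons.prems(1), of 0] by simp
  have B: "B \<in> polys K"
    using polys_coeff[OF pCons.prems(1), of "Suc i" for i] by (auto intro: polysI)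
  show ?case
  proof (cases "a = 0")
    case True
    then have "B \<noteq> 0" using pCons.prems by simp
    from pCons.IH[OF B this] obtain k where
      k: "poly B Y \<noteq> 0" "\<And>v. zero_place v \<Longrightarrow> v (poly B Y) = int k * v Y" by blast
    have "v (poly (pCons a B) Y) = int (Suc k) * v Y" if "zero_place v" for v
      using k(2)[OF that] True k(1) Y_nonzero that place_mult[of K v Y "poly B Y"]
      by (simp add: zero_place_def algebra_simps)
    then show ?thesis using True k Y_nonzero by (intro conjI exI[of _ "Suc k"]) auto
  next
    case False
    have *: "poly (pCons a B) Y \<noteq> 0 \<and> v (poly (pCons a B) Y) = 0" if "zero_place v" for v
    proof -
      from that have v: "is_place K v" and vY: "vge v 1 Y" by (auto simp: zero_place_def)
      have "vge v (1 + 0) (Y * poly B Y)"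
        using vge_mult[OF v vY vge_poly[OF v B vge_mono[OF vY]]] by simp
      then show ?thesis using vge_add_const[OF v _ a False] by simp
    qed
    then show ?thesis using zero_place_P by (intro conjI exI[of _ 0]) auto
  qed
qed simp

lemma Y_transcendental: "transcendental_over K Y"
  using zero_place_poly by (auto simp: transcendental_polys[OF K])

text \<open>
  The functions that are approximated by polynomials in \<open>Y\<close> at all places over the origin at once.
  Their values are determined by the approximating polynomials, which makes these places agree.
\<close>

definition approximable :: "'f set" where
  "approximable = {f. \<forall>N. \<exists>B\<in>polys K. \<forall>v. zero_place v \<longrightarrow> vge v (int N * v Y) (f - poly B Y)}"

lemma approximable_nonneg:
  assumes "f \<in> approximable" "zero_place v"
  shows "vge v 0 f"
proof -
  from assms have v: "is_place K v" and vY: "vge v 1 Y" by (auto simp: zero_place_def)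
  from assms(1) have "\<exists>B\<in>polys K. \<forall>v. zero_place v \<longrightarrow> vge v (int 0 * v Y) (f - poly B Y)"
    unfolding approximable_def by blast
  then obtain B where B: "B \<in> polys K" "vge v 0 (f - poly B Y)" using assms(2) by auto
  have "vge v 0 (poly B Y)" by (rule vge_poly[OF v B(1) vge_mono[OF vY]]) simp
  from vge_add[OF v B(2) this] show ?thesis by simp
qed

lemma approximable_subring: "is_subring approximable"
proof (rule is_subringI)
  show "1 \<in> approximable"
    unfolding approximable_def using polys_1[OF K_ring] by (auto intro!: bexI[of _ 1])
next
  fix f g assume fg: "f \<in> approximable" "g \<in> approximable"
  have "\<exists>D\<in>polys K. \<forall>v. zero_place v \<longrightarrow> vge v (int N * v Y) (f - g - poly D Y)"
    "\<exists>D\<in>polys K. \<forall>v. zero_place v \<longrightarrow> vge v (int N * v Y) (f * g - poly D Y)" for N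
  proof -
    obtain B C where BC: "B \<in> polys K" "\<And>v. zero_place v \<Longrightarrow> vge v (int N * v Y) (f - poly B Y)"
      "C \<in> polys K" "\<And>v. zero_place v \<Longrightarrow> vge v (int N * v Y) (g - poly C Y)"
      using fg unfolding approximable_def by blast
    have "vge v (int N * v Y) (f - g - poly (B - C) Y)" "vge v (int N * v Y) (f * g - poly (B * C) Y)"
      if z: "zero_place v" for v
    proof -
      from z have v: "is_place K v" and vY: "vge v 1 Y" by (auto simp: zero_place_def)
      show "vge v (int N * v Y) (f - g - poly (B - C) Y)"
        using vge_diff[OF v BC(2)[OF z] BC(4)[OF z]] by (simp add: algebra_simps)
      have C0: "vge v 0 (poly C Y)" by (rule vge_poly[OF v BC(3) vge_mono[OF vY]]) simp
      have "vge v (0 + int N * v Y) (f * (g - poly C Y))"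
        by (rule vge_mult[OF v approximable_nonneg[OF fg(1) z] BC(4)[OF z]])
      moreover have "vge v (0 + int N * v Y) (poly C Y * (f - poly B Y))"
        by (rule vge_mult[OF v C0 BC(2)[OF z]])
      ultimately have "vge v (int N * v Y) (f * (g - poly C Y) + poly C Y * (f - poly B Y))"
        using vge_add[OF v] by simp
      then show "vge v (int N * v Y) (f * g - poly (B * C) Y)" by (simp add: algebra_simps)
    qed
    then show "\<exists>D\<in>polys K. \<forall>v. zero_place v \<longrightarrow> vge v (int N * v Y) (f - g - poly D Y)"
      "\<exists>D\<in>polys K. \<forall>v. zero_place v \<longrightarrow> vge v (int N * v Y) (f * g - poly D Y)"
      using polys_diff[OF K_ring BC(1,3)] polys_mult[OF K_ring BC(1,3)] by blast+
  qed
  then show "f - g \<in> approximable" "f * g \<in> approximable" unfolding approximable_def by blast+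
qed

definition trace_poly :: "'f poly" where "trace_poly = (\<Sum>i<t. monom 1 (3 ^ i))"

lemma trace_poly: "trace_poly \<in> polys K" "poly trace_poly Y = T"
proof -
  show "poly trace_poly Y = T" by (simp add: trace_poly_def poly_sum poly_monom trace_sum_def)
  show "trace_poly \<in> polys K"
    unfolding trace_poly_def
    by (rule polysI) (use subring_0[OF K_ring] subring_1[OF K_ring] in
        \<open>auto simp: coeff_sum intro!: subring_sum[OF K_ring]\<close>)
qed

text \<open>
  The iteration \<open>X\<^sub>0 = 0\<close>, \<open>X\<^sub>n\<^sub>+\<^sub>1 = - T - T\<^sup>2 - X\<^sub>n ^ q\<close> of the equation of the curve converges to
  \<open>X\<close>, since the errors satisfy \<open>X - X\<^sub>n\<^sub>+\<^sub>1 = - (X - X\<^sub>n) ^ q\<close>.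
\<close>

lemma X_approximable: "X \<in> approximable"
proof -
  have *: "\<exists>B\<in>polys K. \<forall>v. zero_place v \<longrightarrow> vge v (int (Suc N) * v Y) (X - poly B Y)" for N
  proof (induction N)
    case 0
    have "vge v (int (Suc 0) * v Y) (X - poly 0 Y)" if "zero_place v" for v
      using zero_place_vals(5)[OF that] by (simp add: vge_def)
    then show ?case using polys_0[OF K_ring] by blast
  next
    case (Suc N)
    then obtain B where B: "B \<in> polys K"
      "\<And>v. zero_place v \<Longrightarrow> vge v (int (Suc N) * v Y) (X - poly B Y)" by blast
    let ?C = "0 - trace_poly - trace_poly\<^sup>2 - B ^ q"
    have C: "?C \<in> polys K"
      using trace_poly(1) B(1) by (intro polys_diff polys_power polys_0 K_ring)
    have "vge v (int (Suc (Suc N)) * v Y) (X - poly ?C Y)" if z: "zero_place v" for v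
    proof -
      from z have v: "is_place K v" by (simp add: zero_place_def)
      have e: "X - poly ?C Y = - ((X - poly B Y) ^ q)"
        using X_q by (simp add: frob_diff trace_poly(2))
      have "Suc (Suc N) \<le> 3 * Suc N" by simp
      also have "\<dots> \<le> q * Suc N" using q_ge by (rule mult_le_mono1)
      finally have "int (Suc (Suc N)) \<le> int q * int (Suc N)" by (metis of_nat_le_iff of_nat_mult)
      then have "int (Suc (Suc N)) * v Y \<le> int q * (int (Suc N) * v Y)"
        using mult_right_mono[of _ _ "v Y"] zero_place_vals(1)[OF z] by (simp add: mult.assoc)
      then show ?thesis
        using vge_mono[OF vge_power[OF v B(2)[OF z], of q]] unfolding e vge_uminus[OF v] by blast
    qed
    then show ?case using C by blast
  qed
  have "\<exists>B\<in>polys K. \<forall>v. zero_place v \<longrightarrow> vge v (int N * v Y) (X - poly B Y)" for N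
  proof -
    obtain B where B: "B \<in> polys K"
      "\<And>v. zero_place v \<Longrightarrow> vge v (int (Suc N) * v Y) (X - poly B Y)" using * by blast
    have "vge v (int N * v Y) (X - poly B Y)" if "zero_place v" for v
      using zero_place_vals(1)[OF that] by (intro vge_mono[OF B(2)[OF that]] mult_right_mono) auto
    then show ?thesis using B(1) by blast
  qed
  then show ?thesis by (simp add: approximable_def)
qed

lemma poly_approximable: "B \<in> polys K \<Longrightarrow> poly B Y \<in> approximable"
  unfolding approximable_def by (auto intro!: bexI[of _ B])

lemma approximable_val:
  assumes f: "f \<in> approximable" "f \<noteq> 0" and z: "zero_place v" "zero_place w"
  shows "\<exists>k. v f = int k * v Y \<and> w f = int k * w Y"
proof -
  define N where "N = nat (max (v f) (w f)) + 1"
  obtain B where B: "B \<in> polys K" "\<And>v. zero_place v \<Longrightarrow> vge v (int N * v Y) (f - poly B Y)"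
    using f(1) unfolding approximable_def by blast
  have *: "poly B Y \<noteq> 0 \<and> v (poly B Y) = v f" if "zero_place v" "v f + 1 \<le> int N" for v
  proof -
    from that have v: "is_place K v" by (simp add: zero_place_def)
    have "int N * 1 \<le> int N * v Y" using zero_place_vals(1)[OF that(1)] by (intro mult_left_mono) auto
    then have "vge v (v f + 1) (- (f - poly B Y))"
      using that(2) unfolding vge_uminus[OF v] by (intro vge_mono[OF B(2)[OF that(1)]]) simp
    from place_add_dominant[OF v f(2) this] show ?thesis by simp
  qed
  have "v f + 1 \<le> int N" "w f + 1 \<le> int N" by (auto simp: N_def)
  then have vals: "poly B Y \<noteq> 0" "v (poly B Y) = v f" "w (poly B Y) = w f" using * z by blast+
  then have "B \<noteq> 0" by auto
  then obtain k where "\<And>v. zero_place v \<Longrightarrow> v (poly B Y) = int k * v Y"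
    using zero_place_poly[OF B(1)] by blast
  then show ?thesis using vals z by metis
qed

lemma zero_place_val:
  assumes f: "f \<noteq> 0" and z: "zero_place v" "zero_place w"
  shows "\<exists>k. v f = k * v Y \<and> w f = k * w Y"
proof -
  have "Y \<in> approximable" using poly_approximable[of "[:0, 1:]"] polys_monom[OF K_ring subring_1[OF K_ring], of 1]
    by (simp add: monom_altdef)
  moreover have "K \<subseteq> approximable" using poly_approximable[OF polys_const[OF K_ring]] by auto
  ultimately have "adjoin K {X, Y} \<subseteq> fractions approximable"
    using X_approximable subset_fractions[OF approximable_subring]
    by (intro adjoin_least subfield_fractions[OF approximable_subring]) auto
  then have "f \<in> fractions approximable" using gen by blast
  then obtain a b where ab: "a \<in> approximable" "b \<in> approximable" "f = a / b"
    unfolding fractions_def by blast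
  then have nz: "a \<noteq> 0" "b \<noteq> 0" using f by auto
  obtain k l where kl: "v a = int k * v Y" "w a = int k * w Y" "v b = int l * v Y" "w b = int l * w Y"
    using approximable_val[OF ab(1) nz(1) z] approximable_val[OF ab(2) nz(2) z] by blast
  have "is_place K v" "is_place K w" using z by (auto simp: zero_place_def)
  then show ?thesis using kl ab(3) nz by (intro exI[of _ "int k - int l"]) (auto simp: place_divide algebra_simps)
qed

text \<open>
  All values are multiples of that of \<open>Y\<close>, and the value \<open>1\<close> occurs.
\<close>

lemma zero_place_Y:
  assumes "zero_place v" shows "v Y = 1"
proof -
  have "is_place K v" using assms by (simp add: zero_place_def)
  then obtain u where "u \<noteq> 0" "v u = 1" using place_onto by blast
  then obtain k where "k * v Y = 1" using zero_place_val[OF _ assms assms] by metis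
  then show ?thesis using zero_place_vals(1)[OF assms] by (auto simp: zmult_eq_1_iff)
qed

lemma zero_place_unique:
  assumes "zero_place v" shows "v = P"
proof
  fix f
  show "v f = P f"
  proof (cases "f = 0")
    case True
    then show ?thesis using assms place_0[OF P] place_0[of K v] by (simp add: zero_place_def)
  next
    case False
    then obtain k where "v f = k * v Y" "P f = k * P Y"
      using zero_place_val[OF False assms zero_place_P] by blast
    then show ?thesis using zero_place_Y[OF assms] zero_place_Y[OF zero_place_P] by simp
  qed
qed

lemma P_Y: "P Y = 1" and P_X: "P X = 1" and X_nonzero: "X \<noteq> 0"
  using zero_place_Y[OF zero_place_P] zero_place_vals[OF zero_place_P] by auto

section \<open>The function \<open>\<tau>\<close>\<close>

text \<open>
  By this equation \<open>(X, Y, \<tau>)\<close> maps the curve into a Hermitian surface whose tangent plane at the origin is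
  \<open>\<tau> = 0\<close>. It is the source of the zero of order \<open>q + 1\<close> of \<open>\<tau>\<close> at \<open>P\<close> and of the pole of that order at
  infinity.
\<close>

lemma tau_equation: "\<tau> ^ q + \<tau> = - (X ^ (q + 1) + Y ^ (q + 1))"
proof -
  have tq: "\<tau> ^ q = (X ^ q) ^ 3 - (X ^ q)\<^sup>2 + (Y ^ q)\<^sup>2"
    unfolding \<tau>_def frob_diff frob_add by (simp add: mult.commute flip: power_mult)
  have identity: "(a ^ 3 - a\<^sup>2 + b\<^sup>2) + (x ^ 3 - x\<^sup>2 + y\<^sup>2) + (x * a + y * b)
      = 3 * (y\<^sup>2 - x\<^sup>2 + y * z ^ 3 - y * z - x\<^sup>2 * z\<^sup>2 - x\<^sup>2 * z - x * z ^ 4 - 2 * x * z ^ 3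
        - 2 * x * z\<^sup>2 - x * z - z ^ 5 - 2 * z ^ 4 - z ^ 3)"
    if "a = - x - z\<^sup>2 - z" "b = y + z ^ 3 - z" for a b x y z :: 'f
    unfolding that by (simp add: algebra_simps eval_nat_numeral)
  have "\<tau> ^ q + \<tau> + (X * X ^ q + Y * Y ^ q) = 0"
    unfolding tq by (subst \<tau>_def, subst identity[OF X_q Y_q]) (simp add: three)
  then have "\<tau> ^ q + \<tau> = - (X * X ^ q + Y * Y ^ q)" by (simp only: eq_neg_iff_add_eq_0)
  then show ?thesis by simp
qed

lemma P_X_plus_Y: "X + Y \<noteq> 0" "P (X + Y) = 2"
proof -
  note vals = zero_place_vals[OF zero_place_P]
  have val: "P (- (T\<^sup>2)) = 2" using vals(2) P_Y by (simp add: place_uminus[OF P] place_power[OF P])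
  have nz: "- (T\<^sup>2) \<noteq> 0" using vals by simp
  have "vge P (2 + 1) (- (X ^ q) - (T - Y))"
  proof (rule vge_diff[OF P])
    show "vge P (2 + 1) (- (X ^ q))" using q_ge P_X by (simp add: vge_def place_uminus[OF P] place_power[OF P])
    show "vge P (2 + 1) (T - Y)" using trace_sum_rest[OF P PY t] P_Y by simp
  qed
  note dom = place_add_dominant[OF P nz, unfolded val, OF this]
  have "X + Y = - (T\<^sup>2) + (- (X ^ q) - (T - Y))" using X_q by simp
  then show "X + Y \<noteq> 0" "P (X + Y) = 2" using dom by (simp_all only: not_False_eq_True)
qed

text \<open>
  Near the origin \<open>X / Y\<close> is close to \<open>- 1\<close>, and \<open>q + 1\<close> is even. So \<open>X ^ (q + 1)\<close> and \<open>Y ^ (q + 1)\<close> have the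
  same leading term, and their sum has a nonzero one since \<open>2 \<noteq> 0\<close>.
\<close>

lemma P_tau: "\<tau> \<noteq> 0" "P \<tau> = int q + 1"
proof -
  define a where "a = (X + Y) / Y"
  have a: "vge P 1 a" using P_X_plus_Y P_Y Y_nonzero by (simp add: a_def vge_def place_divide[OF P])
  have X: "X = Y * (a - 1)" using Y_nonzero by (simp add: a_def field_simps)
  have "X ^ (q + 1) = Y ^ (q + 1) * ((a - 1) * (a ^ q - 1))"
    unfolding X by (simp add: power_mult_distrib frob_diff)
  then have e: "\<tau> ^ q + \<tau> = Y ^ (q + 1) * (1 + (a + a ^ q - a * a ^ q))"
  proof -
    have "- (z * ((a - 1) * (b - 1)) + z) = z * (1 + (a + b - a * b)) - 3 * z" for z b
      by (simp add: algebra_simps)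
    then show ?thesis unfolding tau_equation \<open>X ^ (q + 1) = _\<close> using three by simp
  qed
  have aq: "vge P 1 (a ^ q)" using vge_mono[OF vge_power[OF P a, of q], of 1] q_ge by simp
  have "vge P 1 (a + a ^ q - a * a ^ q)"
    by (intro vge_diff[OF P vge_add[OF P a aq]] vge_mono[OF vge_mult[OF P a aq]]) simp
  from vge_add_const[OF P this subring_1[OF K_ring]]
  have rhs: "\<tau> ^ q + \<tau> \<noteq> 0" "P (\<tau> ^ q + \<tau>) = int q + 1"
    unfolding e using Y_nonzero P_Y by (simp_all add: place_mult[OF P] place_power[OF P])
  show t0: "\<tau> \<noteq> 0"
  proof
    assume "\<tau> = 0"
    then show False using rhs q_ge by (simp add: power_0_left)
  qed
  have "vge P 1 \<tau>" unfolding \<tau>_def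
    using vge_power[OF P PX, of 3] vge_power[OF P PX, of 2] vge_power[OF P PY, of 2]
    by (intro vge_add[OF P] vge_diff[OF P]) (auto elim: vge_mono)
  then have t1: "P \<tau> \<ge> 1" using t0 by (simp add: vge_def)
  then have "3 * P \<tau> \<le> int q * P \<tau>" using q_ge by (intro mult_right_mono) auto
  then have "P \<tau> + 1 \<le> P (\<tau> ^ q)" using t1 unfolding place_power[OF P] by linarith
  then have "vge P (P \<tau> + 1) (\<tau> ^ q)" by (rule vgeI)
  from place_add_dominant[OF P t0 this] show "P \<tau> = int q + 1" using rhs by (simp add: add.commute)
qed

text \<open>Where \<open>Y\<close> is finite, so is \<open>X\<close>, which is integral over \<open>K[Y]\<close>.\<close>

lemma finite_place_X:
  assumes v: "is_place K v" and Y: "vge v 0 Y"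
  shows "vge v 0 X"
proof (rule power_q_add_finite[OF v])
  have T: "vge v 0 T" by (rule trace_sum_vge[OF v Y]) simp
  then have "vge v 0 (- (T\<^sup>2 + T))"
    unfolding vge_uminus[OF v] using vge_power[OF v T, of 2] by (intro vge_add[OF v]) auto
  then show "vge v 0 (X ^ q + X)" using X_q by simp
qed

text \<open>
  Away from the origin a zero of \<open>\<tau>\<close> lies on the nodal cubic \<open>\<tau> = 0\<close>, which the slope \<open>s = Y / X\<close>
  parametrizes by \<open>X = 1 - s\<^sup>2\<close>, \<open>Y = s - s ^ 3\<close>. On it the equation of \<open>\<tau> ^ q + \<tau>\<close> becomes \<open>s ^ (q + 1) = - 1\<close>
  and the equation of the curve becomes \<open>s ^ q = s + 1\<close>. Together they give \<open>(s - 1)\<^sup>2 = 0\<close>, and \<open>s = 1\<close> does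
  not satisfy the second one. The elements \<open>\<epsilon>\<close>, \<open>\<delta>\<close>, \<open>\<eta>\<close>, \<open>\<kappa>\<close> below are errors that vanish at \<open>v\<close>.
\<close>

lemma tau_zero_unique:
  assumes v: "is_place K v" and Y0: "vge v 0 Y" and tau: "vge v 1 \<tau>"
  shows "v = P"
proof (cases "vge v 1 X")
  case True
  have "vge v 1 (\<tau> - X ^ 3 + X\<^sup>2)"
    using vge_power[OF v True, of 3] vge_power[OF v True, of 2] tau
    by (intro vge_add[OF v] vge_diff[OF v]) (auto elim: vge_mono)
  then have "vge v 1 (Y\<^sup>2)" by (simp add: \<tau>_def)
  then have "vge v 1 Y" by (rule vge_root[OF v])
  then show ?thesis using zero_place_unique v True by (simp add: zero_place_def)
next
  case False
  have X: "X \<noteq> 0" "v X = 0" using False finite_place_X[OF v Y0] by (auto simp: vge_def)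
  have pow: "vge v 1 (z ^ n)" if "vge v 1 z" "n > 0" for z n
    using vge_mono[OF vge_power[OF v that(1), of n], of 1] that(2) by simp
  have mul: "vge v 1 (z * w)" "vge v 1 (w * z)" if "vge v 1 z" "vge v 0 w" for z w
    using vge_mult[OF v that] by (simp_all add: mult.commute)
  have inv: "vge v 0 (inverse X)" using X by (simp add: vge_def place_inverse[OF v])
  have pow0: "vge v 0 (z ^ n)" if "vge v 0 z" for z n using vge_power[OF v that, of n] by simp
  have one: "vge v 0 1" by (rule vge_1[OF v])
  have num: "vge v 0 2" using vge_add[OF v one one] by simp
  define s where "s = Y / X"
  have s0: "vge v 0 s" using vge_mult[OF v Y0 inv] by (simp add: s_def divide_inverse)
  have Ys: "Y = s * X" using X by (simp add: s_def)
  define \<epsilon> where "\<epsilon> = 1 + s ^ (q + 1)"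
  have "\<epsilon> = - (\<tau> ^ q + \<tau>) * inverse X ^ (q + 1)"
    unfolding tau_equation \<epsilon>_def s_def using X by (simp add: field_simps)
  moreover have "vge v 1 (- (\<tau> ^ q + \<tau>))"
    unfolding vge_uminus[OF v] using tau q_ge by (intro vge_add[OF v] pow) auto
  then have "vge v 1 (- (\<tau> ^ q + \<tau>) * inverse X ^ (q + 1))" by (rule mul(1)[OF _ pow0[OF inv]])
  ultimately have \<epsilon>: "vge v 1 \<epsilon>" by (simp only:)
  define \<delta> where "\<delta> = X - 1 + s\<^sup>2"
  have "\<delta> = \<tau> * inverse X ^ 2"
    unfolding \<delta>_def \<tau>_def s_def using X by (simp add: field_simps power2_eq_square power3_eq_cube)
  then have \<delta>: "vge v 1 \<delta>" using mul(1)[OF tau pow0[OF inv]] by simp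
  have Xs: "X = 1 - s\<^sup>2 + \<delta>" by (simp add: \<delta>_def)
  define \<eta> where "\<eta> = trace_sum t (s * \<delta>)"
  have \<eta>: "vge v 1 \<eta>" unfolding \<eta>_def by (rule trace_sum_vge[OF v mul(2)[OF \<delta> s0]]) simp
  have "Y = s + (- (s ^ 3)) + s * \<delta>" unfolding Ys Xs
    by (simp add: algebra_simps power2_eq_square power3_eq_cube)
  then have "T = trace_sum t (s + (- (s ^ 3)) + s * \<delta>)" by (rule arg_cong)
  then have "T = trace_sum t s - trace_sum t s ^ 3 + \<eta>"
    unfolding trace_sum_add[OF three] trace_sum_uminus trace_sum_power3[OF three] \<eta>_def by simp
  then have Ts: "T = s - s ^ q + \<eta>" using trace_sum_cube[OF three, of t s] by (simp add: q)
  have Xq: "X ^ q = 1 - (s ^ q)\<^sup>2 + \<delta> ^ q"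
    unfolding Xs by (simp add: frob_add frob_diff mult.commute flip: power_mult)
  define \<kappa> where "\<kappa> = 1 + s - s ^ q"
  have "0 = X ^ q + X + T\<^sup>2 + T" using curve by simp
  also have "\<dots> = 2 - 2 * (s * s ^ q) + (s - s ^ q) + (\<delta> ^ q + \<delta> + 2 * (s - s ^ q) * \<eta> + \<eta>\<^sup>2 + \<eta>)"
    unfolding Xq Ts by (subst Xs) (simp add: algebra_simps power2_eq_square)
  also have "2 - 2 * (s * s ^ q) + (s - s ^ q) = \<kappa> + \<epsilon> + 3 * (1 - \<epsilon>)"
    unfolding \<epsilon>_def \<kappa>_def by (simp add: algebra_simps)
  finally have "\<kappa> = - (\<epsilon> + (\<delta> ^ q + \<delta> + 2 * (s - s ^ q) * \<eta> + \<eta>\<^sup>2 + \<eta>))"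
    using three by (simp add: eq_neg_iff_add_eq_0 algebra_simps)
  moreover have "vge v 1 (2 * (s - s ^ q) * \<eta>)"
    using vge_mult[OF v num vge_diff[OF v s0 pow0[OF s0]]] by (intro mul(2)[OF \<eta>]) simp
  then have "vge v 1 (- (\<epsilon> + (\<delta> ^ q + \<delta> + 2 * (s - s ^ q) * \<eta> + \<eta>\<^sup>2 + \<eta>)))"
    unfolding vge_uminus[OF v] using \<epsilon> \<delta> \<eta> q_ge by (intro vge_add[OF v] pow) auto
  ultimately have \<kappa>: "vge v 1 \<kappa>" by simp
  have "(s - 1) ^ 2 = s * \<kappa> + \<epsilon> - 3 * s"
    unfolding \<kappa>_def \<epsilon>_def by (simp add: algebra_simps power2_eq_square)
  then have "vge v 1 ((s - 1) ^ 2)"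
    using three vge_add[OF v mul(2)[OF \<kappa> s0] \<epsilon>] by simp
  then have s1: "vge v 1 (s - 1)" by (rule vge_root[OF v])
  then have "vge v 1 ((s - 1) ^ q)" using q_ge by (intro pow) auto
  then have "vge v 1 (\<kappa> - (s - 1) + (s - 1) ^ q)" by (intro vge_add[OF v] vge_diff[OF v] \<kappa> s1)
  moreover have "\<kappa> - (s - 1) + (s - 1) ^ q = 1" by (simp add: \<kappa>_def frob_diff)
  ultimately show ?thesis by (simp add: vge_def place_1[OF v])
qed

end

lemma weierstrass_submonoid:
  assumes P: "is_place K P"
  shows "is_submonoid (weierstrass_semigroup K P)"
proof -
  have "0 \<in> weierstrass_semigroup K P"
    unfolding weierstrass_semigroup_def
    by (auto intro!: exI[of _ 1] simp: pole_divisor_def point_divisor_def place_1)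
  moreover have "a + b \<in> weierstrass_semigroup K P"
    if ab: "a \<in> weierstrass_semigroup K P" "b \<in> weierstrass_semigroup K P" for a b
  proof (cases "a = 0 \<or> b = 0")
    case False
    obtain z w where z: "z \<noteq> 0" "pole_divisor K z = point_divisor a P"
      and w: "w \<noteq> 0" "pole_divisor K w = point_divisor b P"
      using ab unfolding weierstrass_semigroup_def by blast
    have "pole_divisor K (z * w) Q = point_divisor (a + b) P Q" for Q
    proof (cases "is_place K Q")
      case True
      then show ?thesis
        using fun_cong[OF z(2), of Q] fun_cong[OF w(2), of Q] False z(1) w(1)
        by (auto simp: pole_divisor_def point_divisor_def place_mult split: if_splits)
    next
      case False
      then show ?thesis using P by (auto simp: pole_divisor_def point_divisor_def)
    qed
    then show ?thesis using z(1) w(1) unfolding weierstrass_semigroup_def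
      by (intro CollectI exI[of _ "z * w"]) auto
  qed (use ab in auto)
  ultimately show ?thesis by (simp add: is_submonoid_def)
qed

text \<open>
  Pairs whose quotient of second by first entry is \<open>Y / X\<close> modulo \<open>\<tau>\<close>, obtained from \<open>X + Y\<close>
  by repeated multiplication by \<open>1 - Y + Y / X\<close>, which on the cubic \<open>\<tau> = 0\<close> is the cube of
  \<open>1 + Y / X\<close>.
\<close>

primrec node_pair :: "'f::field \<Rightarrow> 'f \<Rightarrow> nat \<Rightarrow> 'f \<times> 'f" where
  "node_pair X Y 0 = (X + Y, Y + X - X\<^sup>2)"
| "node_pair X Y (Suc k) =
     ((1 - Y) * fst (node_pair X Y k) + snd (node_pair X Y k),
      (1 - Y) * snd (node_pair X Y k) + (1 - X) * fst (node_pair X Y k))"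

context curve
begin

section \<open>The field as a vector space over the rational functions in \<open>Y\<close>\<close>

abbreviation KY :: "'f set" where "KY \<equiv> adjoin K {Y}"

lemma KY: "is_subfield KY" by (rule subfield_adjoin)

lemma KY_ring: "is_subring KY" by (rule subfield_subring[OF KY])

lemma Y_KY: "Y \<in> KY" using adjoin_gen by blast

lemma T_KY: "T \<in> KY"
  using poly_in_adjoin[OF K trace_poly(1), of Y] trace_poly(2) by simp

definition curve_poly :: "'f poly" where
  "curve_poly = monom 1 q + [:T\<^sup>2 + T, 1:]"

lemma curve_poly:
  "curve_poly \<in> polys KY" "poly curve_poly X = 0" "degree curve_poly = q" "curve_poly \<noteq> 0"
proof -
  have "T\<^sup>2 + T \<in> KY" using T_KY by (intro subring_add[OF KY_ring] subring_power[OF KY_ring])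
  then show "curve_poly \<in> polys KY"
    unfolding curve_poly_def
    by (intro polys_add[OF KY_ring] polys_monom[OF KY_ring] polys_pCons[OF KY_ring]
        polys_const[OF KY_ring] subring_1[OF KY_ring] polys_0[OF KY_ring]) auto
  show "poly curve_poly X = 0"
    using curve by (simp add: curve_poly_def poly_monom algebra_simps)
  show "degree curve_poly = q"
    using q_ge by (simp add: curve_poly_def degree_add_eq_left degree_monom_eq)
  then show "curve_poly \<noteq> 0" using q_ge by auto
qed

lemma poly_X_reduce:
  assumes "p \<in> polys KY"
  shows "\<exists>r\<in>polys KY. degree r < q \<and> (\<exists>s\<in>polys KY. p = curve_poly * s + r)"
proof -
  obtain s r where sr: "s \<in> polys KY" "r \<in> polys KY" "p = curve_poly * s + r"
    "r = 0 \<or> degree r < degree curve_poly"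
    using polys_division[OF KY curve_poly(1,4) assms] by blast
  moreover have "degree r < q" using sr(4) curve_poly(3) q_ge by auto
  ultimately show ?thesis by blast
qed

text \<open>
  The polynomials in \<open>X\<close> over \<open>K(Y)\<close> form a field. The inverse of \<open>p(X)\<close> is found by
  dividing a relation of least degree for \<open>X\<close> by \<open>p\<close>, recursively in the degree of \<open>p\<close>.
\<close>

lemma poly_X_inverse:
  assumes p: "p \<in> polys KY" "poly p X \<noteq> 0"
  shows "\<exists>r\<in>polys KY. poly r X * poly p X = 1"
proof -
  obtain \<mu> where mu: "\<mu> \<in> polys KY \<and> \<mu> \<noteq> 0 \<and> poly \<mu> X = 0"
    and least: "\<And>r. r \<in> polys KY \<and> r \<noteq> 0 \<and> poly r X = 0 \<Longrightarrow> degree \<mu> \<le> degree r"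
    using ex_has_least_nat[of "\<lambda>\<mu>. \<mu> \<in> polys KY \<and> \<mu> \<noteq> 0 \<and> poly \<mu> X = 0" curve_poly degree]
      curve_poly by blast
  have *: "\<exists>r\<in>polys KY. poly r X * poly p X = 1"
    if "p \<in> polys KY" "poly p X \<noteq> 0" "degree p < degree \<mu>" for p
    using that
  proof (induction "degree p" arbitrary: p rule: less_induct)
    case less
    then have "p \<noteq> 0" by auto
    then obtain s r where sr: "s \<in> polys KY" "r \<in> polys KY" "\<mu> = p * s + r"
      "r = 0 \<or> degree r < degree p"
      using polys_division[OF KY less.prems(1)] mu by blast
    show ?case
    proof (cases "r = 0")
      case True
      then have "poly s X = 0" "s \<noteq> 0" using sr(3) mu less.prems(2) by auto
      then have "degree \<mu> \<le> degree s" using least sr(1) by blast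
      then have "degree p = 0" using True sr(3) \<open>p \<noteq> 0\<close> \<open>s \<noteq> 0\<close> by (simp add: degree_mult_eq)
      then obtain c where "c \<in> KY" "c \<noteq> 0" "p = [:c:]"
        using polys_degree_0[OF less.prems(1) \<open>p \<noteq> 0\<close>] by blast
      then show ?thesis using polys_const[OF KY_ring subfield_inverse[OF KY]]
        by (intro bexI[of _ "[:inverse c:]"]) auto
    next
      case False
      then have r: "poly r X \<noteq> 0" using least[of r] sr less.prems(3) by force
      then obtain r' where r': "r' \<in> polys KY" "poly r' X * poly r X = 1"
        using less.hyps[of r] sr False less.prems(3) by auto
      have "poly (p * s + r) X = 0" using mu sr(3) by simp
      then have "poly r X = - (poly p X * poly s X)" by (simp add: eq_neg_iff_add_eq_0 add.commute)
      then have "poly (0 - r' * s) X * poly p X = 1" using r'(2) by (simp add: algebra_simps)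
      moreover have "0 - r' * s \<in> polys KY"
        using r'(1) sr(1) by (intro polys_diff[OF KY_ring] polys_mult[OF KY_ring] polys_0[OF KY_ring])
      ultimately show ?thesis by blast
    qed
  qed
  obtain s r where sr: "s \<in> polys KY" "r \<in> polys KY" "p = \<mu> * s + r" "r = 0 \<or> degree r < degree \<mu>"
    using polys_division[OF KY _ _ p(1)] mu by blast
  then have pr: "poly p X = poly r X" using mu by simp
  then have "r \<noteq> 0" using p(2) by auto
  then have "\<exists>r'\<in>polys KY. poly r' X * poly r X = 1" using * sr pr p(2) by auto
  then show ?thesis using pr by simp
qed

lemma all_poly_X:
  obtains p where "p \<in> polys KY" "degree p < q" "f = poly p X"
proof -
  let ?W = "poly_values KY X"
  have W: "is_subring ?W" by (rule subring_poly_values[OF KY_ring])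
  have "is_subfield ?W"
    unfolding is_subfield_def
  proof (intro conjI ballI)
    show "0 \<in> ?W" "1 \<in> ?W" using subring_0[OF W] subring_1[OF W] by auto
    fix a assume "a \<in> ?W"
    show "inverse a \<in> ?W"
    proof (cases "a = 0")
      case False
      obtain p where p: "p \<in> polys KY" "a = poly p X" using \<open>a \<in> ?W\<close> by blast
      then obtain r where "r \<in> polys KY" "poly r X * a = 1" using poly_X_inverse False by blast
      then show ?thesis using False by (intro image_eqI[of _ _ r]) (auto simp: field_simps)
    qed (use subring_0[OF W] in simp)
    fix b assume "b \<in> ?W"
    then show "a - b \<in> ?W" "a * b \<in> ?W" using \<open>a \<in> ?W\<close> subring_diff[OF W] subring_mult[OF W] by auto
  qed
  moreover have "K \<subseteq> ?W" "{X, Y} \<subseteq> ?W"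
    using poly_values_base[OF KY_ring, of X] poly_values_gen[OF KY_ring, of X] adjoin_base[of K "{Y}"] Y_KY
    by blast+
  ultimately have "f \<in> ?W" using adjoin_least[of ?W K "{X, Y}"] gen by blast
  then obtain p where p: "p \<in> polys KY" "f = poly p X" by blast
  then obtain r s where "r \<in> polys KY" "degree r < q" "p = curve_poly * s + r"
    using poly_X_reduce by blast
  then show ?thesis using that p(2) curve_poly(2) by auto
qed

lemma finite_over_KY: "finite_over KY"
proof -
  let ?B = "(\<lambda>i. X ^ i) ` {..<q}"
  have P_pow: "P (X ^ i) = int i" for i using P_X by (simp add: place_power[OF P])
  then have inj: "inj_on (\<lambda>i. X ^ i) {..<q}" by (intro inj_onI) (metis of_nat_eq_iff)
  have "\<exists>c. c ` ?B \<subseteq> KY \<and> f = (\<Sum>b\<in>?B. c b * b)" for f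
  proof -
    obtain p where p: "p \<in> polys KY" "degree p < q" "f = poly p X" by (rule all_poly_X)
    have "poly p X = (\<Sum>i<q. coeff p i * X ^ i)"
      unfolding poly_altdef using p(2) by (intro sum.mono_neutral_left) (auto simp: coeff_eq_0)
    also have "\<dots> = (\<Sum>b\<in>?B. coeff p (nat (P b)) * b)"
      by (subst sum.reindex[OF inj]) (simp add: P_pow)
    finally show ?thesis using p by (intro exI[of _ "\<lambda>b. coeff p (nat (P b))"]) (auto simp: polys_coeff)
  qed
  then show ?thesis unfolding finite_over_def by (intro exI[of _ ?B]) auto
qed

section \<open>The places at infinity\<close>

lemma infinite_place_exists: "\<exists>v. is_place K v \<and> v Y < 0"
proof -
  have "adjoin K {Y} \<subseteq> adjoin K {inverse Y}"
    using adjoin_base[of K "{inverse Y}"] adjoin_gen[of "{inverse Y}" K]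
      subfield_inverse[OF subfield_adjoin, of "inverse Y" K "{inverse Y}"]
    by (intro adjoin_least subfield_adjoin) auto
  moreover have "adjoin K {inverse Y} \<subseteq> adjoin K {Y}"
    using adjoin_base[of K "{Y}"] subfield_inverse[OF KY Y_KY] by (intro adjoin_least subfield_adjoin) auto
  ultimately have "adjoin K {inverse Y} = KY" by blast
  then have fin: "finite_over (adjoin K {inverse Y})" using finite_over_KY by simp
  have "P (inverse Y) < 0" using P_Y by (simp add: place_inverse[OF P])
  then have tr: "transcendental_over K (inverse Y)"
    unfolding transcendental_polys[OF K] using place_poly_at_pole(2)[OF P K] by blast
  have "[:0, 1:] \<in> polys K"
    using polys_pCons[OF K_ring subring_0[OF K_ring] polys_1[OF K_ring]] by (simp add: one_pCons)
  from place_exists[OF K tr fin this] obtain v where "is_place K v" "0 < v (inverse Y)" by auto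
  then show ?thesis using place_inverse[of K v Y] by auto
qed

lemma degree_trace_poly: "degree trace_poly = m" "trace_poly \<noteq> 0"
proof -
  obtain t' where t': "t = Suc t'" using t by (cases t) auto
  have "degree (\<Sum>i<t'. monom (1::'f) (3 ^ i)) < 3 ^ t'"
  proof (rule degree_sum_less)
    show "degree (monom (1::'f) (3 ^ i)) < 3 ^ t'" if "i \<in> {..<t'}" for i
      using that by (simp add: degree_monom_eq)
  qed simp
  moreover have "trace_poly = (\<Sum>i<t'. monom 1 (3 ^ i)) + monom 1 (3 ^ t')"
    unfolding trace_poly_def by (simp add: t')
  ultimately have "degree trace_poly = 3 ^ t'"
    by (simp add: degree_add_eq_right degree_monom_eq)
  then show "degree trace_poly = m" using q_m(2) t' by simp
  then show "trace_poly \<noteq> 0" using q_m(3) by auto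
qed

text \<open>
  Comparison of the leading terms in the equations of the curve and of \<open>\<tau>\<close> determines the three values up
  to a common positive factor \<open>e\<close>. The estimates that follow are homogeneous in \<open>e\<close>.
\<close>

lemma infinite_place_vals:
  assumes v: "is_place K v" and Y: "v Y < 0"
  shows "\<exists>e>0. v Y = - int q * e \<and> v X = - 2 * int m * e \<and> v \<tau> = - (int q + 1) * e"
proof -
  let ?p = "trace_poly\<^sup>2 + trace_poly"
  have "degree trace_poly < degree (trace_poly\<^sup>2)"
    using degree_trace_poly q_m(3) by (simp add: degree_power_eq)
  then have deg: "degree ?p = 2 * m"
    using degree_trace_poly by (simp add: degree_add_eq_left degree_power_eq)
  then have "?p \<noteq> 0" using q_m(3) by auto
  moreover have "?p \<in> polys K"
    using trace_poly(1) by (intro polys_add[OF K_ring] polys_power[OF K_ring])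
  ultimately have T: "v (poly ?p Y) = int (2 * m) * v Y" "poly ?p Y \<noteq> 0"
    using place_poly_at_pole[OF v K Y] deg by metis+
  have eq: "X ^ q + X = - poly ?p Y" using X_q by (simp add: trace_poly(2))
  then have val: "v (X ^ q + X) = 2 * int m * v Y" "X ^ q + X \<noteq> 0"
    using T by (simp_all only: place_uminus[OF v] neg_equal_0_iff_equal) auto
  have q3: "int q = 3 * int m" using q_m(1) by simp
  have "v (X ^ q + X) < 0" using val(1) Y q_m(3) by (simp add: mult_less_0_iff)
  from power_q_add_pole[OF v this] have X: "v X < 0" "int q * v X = 2 * int m * v Y" using val(1) by auto
  then have XY: "3 * v X = 2 * v Y" using q3 q_m(3) by simp
  \<comment> \<open>in the relation between \<open>\<tau>\<close>, \<open>X\<close> and \<open>Y\<close> the leading terms are \<open>\<tau> ^ q\<close> and \<open>Y ^ (q + 1)\<close>\<close>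
  have "int (q + 1) * v Y < int (q + 1) * v X"
    using XY Y X(1) by (intro mult_strict_left_mono) auto
  then have "v (Y ^ (q + 1)) + 1 \<le> v (X ^ (q + 1))" unfolding place_power[OF v] by linarith
  then have "vge v (v (Y ^ (q + 1)) + 1) (X ^ (q + 1))" by (rule vgeI)
  from place_add_dominant(2)[OF v _ this] have "v (\<tau> ^ q + \<tau>) = (int q + 1) * v Y"
    unfolding tau_equation place_uminus[OF v] using Y_nonzero
    by (simp add: add.commute place_power[OF v] del: power_Suc power_Suc2 add_Suc_right)
  moreover have "(int q + 1) * v Y < 0" using Y by (simp add: mult_less_0_iff)
  ultimately have rhs: "v (\<tau> ^ q + \<tau>) = (int q + 1) * v Y" "v (\<tau> ^ q + \<tau>) < 0" by auto
  have q\<tau>: "int q * v \<tau> = (int q + 1) * v Y" using power_q_add_pole(2)[OF v rhs(2)] rhs(1) by simp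
  define e where "e = v Y - v \<tau>"
  have "v Y = - int q * e" using q\<tau> by (simp add: e_def algebra_simps)
  moreover have "v X = - 2 * int m * e" using calculation XY q3 by simp
  moreover have "v \<tau> = - (int q + 1) * e" using calculation(1) by (simp add: e_def algebra_simps)
  moreover have "e > 0"
  proof (rule ccontr)
    assume "\<not> e > 0"
    then have "int q * e \<le> 0" by (simp add: mult_nonneg_nonpos)
    then show False using calculation(1) Y by simp
  qed
  ultimately show ?thesis by blast
qed

text \<open>
  The functions whose only pole is at infinity, of order at most \<open>n\<close> there if orders are measured so that
  \<open>Y\<close> has order \<open>q\<close>.
\<close>

definition bounded :: "nat \<Rightarrow> 'f \<Rightarrow> bool" where
  "bounded n f \<longleftrightarrow> (\<forall>v. is_place K v \<longrightarrow> (vge v 0 Y \<longrightarrow> vge v 0 f) \<and>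
     (\<forall>e>0. v Y = - int q * e \<longrightarrow> vge v (- (int n * e)) f))"

lemma boundedI:
  assumes "\<And>v. is_place K v \<Longrightarrow> vge v 0 Y \<Longrightarrow> vge v 0 f"
    and "\<And>v e. is_place K v \<Longrightarrow> e > 0 \<Longrightarrow> v Y = - int q * e \<Longrightarrow> vge v (- (int n * e)) f"
  shows "bounded n f"
  using assms by (auto simp: bounded_def)

lemma
  assumes "bounded n f" "is_place K v"
  shows bounded_finite: "vge v 0 Y \<Longrightarrow> vge v 0 f"
    and bounded_infinite: "e > 0 \<Longrightarrow> v Y = - int q * e \<Longrightarrow> vge v (- (int n * e)) f"
  using assms by (auto simp: bounded_def)

lemma bounded_mono: "bounded n f \<Longrightarrow> n \<le> k \<Longrightarrow> bounded k f"
  by (rule boundedI) (auto intro: bounded_finite vge_mono[OF bounded_infinite] mult_right_mono)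

lemma bounded_add: "bounded n f \<Longrightarrow> bounded n g \<Longrightarrow> bounded n (f + g)"
  by (rule boundedI) (blast intro: vge_add bounded_finite bounded_infinite)+

lemma bounded_diff: "bounded n f \<Longrightarrow> bounded n g \<Longrightarrow> bounded n (f - g)"
  by (rule boundedI) (blast intro: vge_diff bounded_finite bounded_infinite)+

lemma bounded_mult:
  assumes "bounded n f" "bounded k g"
  shows "bounded (n + k) (f * g)"
proof (rule boundedI)
  fix v assume v: "is_place K v"
  show "vge v 0 (f * g)" if "vge v 0 Y"
    using vge_mult[OF v bounded_finite[OF assms(1) v that] bounded_finite[OF assms(2) v that]] by simp
  show "vge v (- (int (n + k) * e)) (f * g)" if "e > 0" "v Y = - int q * e" for e
    using vge_mult[OF v bounded_infinite[OF assms(1) v that] bounded_infinite[OF assms(2) v that]]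
    by (simp add: algebra_simps)
qed

lemma bounded_1: "bounded n 1"
  by (rule boundedI) (auto simp: vge_def place_1)

lemma bounded_power: "bounded n f \<Longrightarrow> bounded (k * n) (f ^ k)"
  by (induction k) (auto intro: bounded_1 bounded_mult)

lemma bounded_Y: "bounded q Y"
  by (rule boundedI) (auto simp: vge_def)

lemma infinite_vals:
  assumes v: "is_place K v" and e: "e > 0" "v Y = - int q * e"
  shows "v X = - 2 * int m * e" "v \<tau> = - (int q + 1) * e"
proof -
  have q0: "int q > 0" using q_ge by simp
  then have "v Y < 0" using e by (simp add: mult_less_0_iff)
  then obtain e' where e': "v Y = - int q * e'" "v X = - 2 * int m * e'" "v \<tau> = - (int q + 1) * e'"
    using infinite_place_vals[OF v] by blast
  then have "e' = e" using e q0 by simp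
  then show "v X = - 2 * int m * e" "v \<tau> = - (int q + 1) * e" using e' by auto
qed

lemma bounded_X: "bounded (2 * m) X"
proof (rule boundedI)
  show "vge v 0 X" if "is_place K v" "vge v 0 Y" for v
    using that by (rule finite_place_X)
  show "vge v (- (int (2 * m) * e)) X" if "is_place K v" "e > 0" "v Y = - int q * e" for v e
    using infinite_vals(1)[OF that] by (simp add: vge_def)
qed

lemma bounded_tau: "bounded (q + 1) \<tau>"
proof (rule boundedI)
  fix v assume v: "is_place K v" and Y: "vge v 0 Y"
  note X = finite_place_X[OF v Y]
  show "vge v 0 \<tau>" unfolding \<tau>_def
    using vge_power[OF v X, of 3] vge_power[OF v X, of 2] vge_power[OF v Y, of 2]
    by (intro vge_add[OF v] vge_diff[OF v]) auto
next
  show "vge v (- (int (q + 1) * e)) \<tau>" if "is_place K v" "e > 0" "v Y = - int q * e" for v e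
    using infinite_vals(2)[OF that] by (simp add: vge_def algebra_simps)
qed

section \<open>Functions with a pole at \<open>P\<close> only\<close>

abbreviation H :: "nat set" where "H \<equiv> weierstrass_semigroup K P"

text \<open>
  The divisor of \<open>\<tau>\<close> is \<open>q + 1\<close> times \<open>P - P\<^sub>\<infinity>\<close>, so division by \<open>\<tau> ^ k\<close> moves the poles of \<open>f\<close> from
  infinity to \<open>P\<close>.
\<close>

lemma quotient_in_semigroup:
  assumes f: "f \<noteq> 0" "bounded (k * (q + 1)) f" and n: "P f + int n = int (k * (q + 1))"
  shows "n \<in> H"
proof -
  define z where "z = f / \<tau> ^ k"
  have z: "z \<noteq> 0" using f P_tau(1) by (simp add: z_def)
  have val: "v z = v f - int k * v \<tau>" if "is_place K v" for v
    using f(1) P_tau(1) that by (simp add: z_def place_divide place_power)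
  have "pole_divisor K z v = point_divisor n P v" for v
  proof -
    consider "\<not> is_place K v" | "v = P" | "is_place K v" "v \<noteq> P" "vge v 0 Y" | "is_place K v" "v Y < 0"
      unfolding vge_def by linarith
    then show ?thesis
    proof cases
      case 1
      then show ?thesis using P by (auto simp: pole_divisor_def point_divisor_def)
    next
      case 2
      have "P z = - int n" using val[OF P] n P_tau(2) by (simp add: algebra_simps)
      then show ?thesis using 2 P by (simp add: pole_divisor_def point_divisor_def)
    next
      case 3
      then have "vge v 0 \<tau>" "\<not> vge v 1 \<tau>" using bounded_finite[OF bounded_tau] tau_zero_unique by blast+
      then have "v \<tau> = 0" by (auto simp: vge_def)
      moreover have "v f \<ge> 0" using bounded_finite[OF f(2) 3(1,3)] f(1) by (simp add: vge_def)
      ultimately show ?thesis using 3 val[OF 3(1)] by (simp add: pole_divisor_def point_divisor_def)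
    next
      case 4
      then obtain e where e: "e > 0" "v Y = - int q * e" "v \<tau> = - (int q + 1) * e"
        using infinite_place_vals by blast
      have "v f \<ge> - (int (k * (q + 1)) * e)" using bounded_infinite[OF f(2) 4(1) e(1,2)] f(1) by (simp add: vge_def)
      then have "v z \<ge> 0" using val[OF 4(1)] e(3) by (simp add: algebra_simps)
      moreover have "v \<noteq> P" using 4 P_Y by auto
      ultimately show ?thesis using 4 by (simp add: pole_divisor_def point_divisor_def)
    qed
  qed
  then show ?thesis using z unfolding weierstrass_semigroup_def by blast
qed

definition node :: "nat \<Rightarrow> 'f" where "node k = fst (node_pair X Y k)"

definition node' :: "nat \<Rightarrow> 'f" where "node' k = snd (node_pair X Y k)"

lemma node_simps:
  "node 0 = X + Y" "node' 0 = Y + X - X\<^sup>2"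
  "node (Suc k) = (1 - Y) * node k + node' k" "node' (Suc k) = (1 - Y) * node' k + (1 - X) * node k"
  by (simp_all add: node_def node'_def)

text \<open>
  On the cubic \<open>\<tau> = 0\<close> the first entry is a polynomial of degree \<open>3 k + 3\<close> in the slope and the second
  has degree one more. A degree in the slope costs a pole of order \<open>m\<close>.
\<close>

lemma bounded_node: "bounded (Suc k * q) (node k)" "bounded (Suc k * q + m) (node' k)"
proof -
  have X: "bounded q X" using bounded_mono[OF bounded_X, of q] q_m(1) by simp
  have m4: "bounded (q + m) (X\<^sup>2)" using bounded_power[OF bounded_X, of 2] q_m(1) by (simp add: mult.assoc)
  have "bounded (Suc k * q) (node k) \<and> bounded (Suc k * q + m) (node' k)"
  proof (induction k)
    case 0
    have "bounded (q + m) (Y + X - X\<^sup>2)"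
      using bounded_Y X m4 by (intro bounded_diff bounded_add) (auto elim: bounded_mono)
    then show ?case using bounded_Y X by (simp add: node_simps bounded_add)
  next
    case (Suc k)
    have f: "bounded (q + Suc k * q) ((1 - Y) * node k)" "bounded (q + Suc k * q) ((1 - X) * node k)"
      "bounded (q + (Suc k * q + m)) ((1 - Y) * node' k)"
      using Suc bounded_Y X by (auto intro!: bounded_mult bounded_diff bounded_1)
    have "m \<le> q" using q_m(1) by simp
    then have "bounded (q + Suc k * q) (node' k)" "bounded (q + (Suc k * q + m)) ((1 - X) * node k)"
      using Suc f(2) by (auto elim!: bounded_mono)
    then have "bounded (q + Suc k * q) (node (Suc k))" "bounded (q + (Suc k * q + m)) (node' (Suc k))"
      unfolding node_simps using f by (auto intro: bounded_add)
    then show ?case by (simp add: algebra_simps)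
  qed
  then show "bounded (Suc k * q) (node k)" "bounded (Suc k * q + m) (node' k)" by auto
qed

text \<open>
  With \<open>s = Y / X\<close> each step multiplies \<open>node k\<close> by \<open>1 - Y + s\<close>, which is close to \<open>(1 + s) ^ 3\<close> and has
  order \<open>3\<close>. The error \<open>node' k - s * node k\<close> comes from the distance to the cubic and has order at least \<open>q\<close>.
  It stays invisible as long as \<open>k < m\<close>.
\<close>

lemma node_order:
  assumes "k < m"
  shows "node k \<noteq> 0" "P (node k) = 3 * int k + 2"
    and "k + 1 < m \<Longrightarrow> node k + node' k \<noteq> 0 \<and> P (node k + node' k) = 3 * int k + 3"
proof -
  define s where "s = Y / X"
  define d where "d = \<tau> / X\<^sup>2"
  have d: "vge P (int q - 1) d"
    using P_tau P_X X_nonzero by (simp add: d_def vge_def place_divide[OF P] place_power[OF P])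
  have Y: "Y = s * X" using X_nonzero by (simp add: s_def)
  have dX: "d = X - 1 + s\<^sup>2"
    unfolding d_def s_def \<tau>_def using X_nonzero by (simp add: field_simps power2_eq_square power3_eq_cube)
  have s: "vge P 0 s" "1 + s \<noteq> 0" "P (1 + s) = 1"
  proof -
    show "vge P 0 s" using P_X P_Y X_nonzero Y_nonzero by (simp add: s_def vge_def place_divide[OF P])
    have "1 + s = (X + Y) / X" using X_nonzero by (simp add: s_def field_simps)
    then show "1 + s \<noteq> 0" "P (1 + s) = 1"
      using P_X_plus_Y P_X X_nonzero by (simp_all add: place_divide[OF P])
  qed
  have Y0: "vge P 0 Y" using P_Y by (simp add: vge_def)
  have one: "vge P 0 1" by (rule vge_1[OF P])
  have err_step: "node' (Suc k) - s * node (Suc k) = (1 - Y - s) * (node' k - s * node k) - d * node k" for k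
    unfolding node_simps dX by (simp add: algebra_simps power2_eq_square)
  have node_step: "node (Suc k) = (1 - Y + s) * node k + (node' k - s * node k)" for k
    unfolding node_simps by (simp add: algebra_simps)
  have factor: "1 - Y + s \<noteq> 0 \<and> P (1 - Y + s) = 3" if "m \<ge> 2"
  proof -
    have cube: "(1 + s) ^ 3 = 1 + s ^ 3" using cube_add[OF three, of 1 s] by simp
    have e: "1 - Y + s = (1 + s) ^ 3 + (- (s * d))"
      unfolding cube Y dX by (simp add: algebra_simps power2_eq_square power3_eq_cube)
    have P3: "P ((1 + s) ^ 3) = 3" using s(3) by (simp add: place_power[OF P])
    have "vge P (0 + (int q - 1)) (s * d)" by (rule vge_mult[OF P s(1) d])
    then have "vge P (P ((1 + s) ^ 3) + 1) (- (s * d))"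
      unfolding vge_uminus[OF P] P3 using that q_m(1) by (elim vge_mono) simp
    note dom = place_add_dominant[OF P _ this]
    have "(1 + s) ^ 3 \<noteq> 0" using s(2) by simp
    then have "1 - Y + s \<noteq> 0" "P (1 - Y + s) = P ((1 + s) ^ 3)" unfolding e by (rule dom)+
    then show ?thesis using P3 by simp
  qed
  have main: "node k \<noteq> 0 \<and> P (node k) = 3 * int k + 2 \<and> vge P (int q) (node' k - s * node k)" if "k < m" for k
    using that
  proof (induction k)
    case 0
    have "node' 0 - s * node 0 = - (X * d)"
      unfolding node_simps dX by (subst (1 2) Y) (simp add: algebra_simps power2_eq_square)
    moreover have "vge P (1 + (int q - 1)) (X * d)" by (rule vge_mult[OF P PX d])
    ultimately have "vge P (int q) (node' 0 - s * node 0)" by (simp add: vge_uminus[OF P])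
    then show ?case using P_X_plus_Y by (simp add: node_simps)
  next
    case (Suc k)
    then have IH: "node k \<noteq> 0" "P (node k) = 3 * int k + 2" "vge P (int q) (node' k - s * node k)" by auto
    have f: "1 - Y + s \<noteq> 0" "P (1 - Y + s) = 3" using factor Suc.prems by auto
    have val: "P ((1 - Y + s) * node k) = 3 * int (Suc k) + 2"
      using IH f by (simp add: place_mult[OF P])
    have "3 * Suc k + 3 \<le> q" using Suc.prems q_m(1) by simp
    then have "3 * int (Suc k) + 2 + 1 \<le> int q" by linarith
    then have "vge P (P ((1 - Y + s) * node k) + 1) (node' k - s * node k)"
      unfolding val by (rule vge_mono[OF IH(3)])
    from place_add_dominant[OF P _ this] have n: "node (Suc k) \<noteq> 0" "P (node (Suc k)) = 3 * int (Suc k) + 2"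
      using IH(1) f(1) val unfolding node_step[symmetric] by auto
    have "vge P (0 + int q) ((1 - Y - s) * (node' k - s * node k))"
      by (rule vge_mult[OF P _ IH(3)]) (intro vge_diff[OF P] one Y0 s(1))
    moreover have "vge P 1 (node k)" using IH by (simp add: vge_def)
    then have "vge P (int q - 1 + 1) (d * node k)" by (rule vge_mult[OF P d])
    ultimately have "vge P (int q) (node' (Suc k) - s * node (Suc k))"
      unfolding err_step by (intro vge_diff[OF P]) auto
    then show ?case using n by simp
  qed
  show node: "node k \<noteq> 0" "P (node k) = 3 * int k + 2" using main[OF assms] by auto
  show "node k + node' k \<noteq> 0 \<and> P (node k + node' k) = 3 * int k + 3" if "k + 1 < m"
  proof -
    have val: "P ((1 + s) * node k) = 3 * int k + 3" using node s by (simp add: place_mult[OF P])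
    have "3 * int k + 3 + 1 \<le> int q" using that q_m(1) by simp
    then have "vge P (P ((1 + s) * node k) + 1) (node' k - s * node k)"
      unfolding val using vge_mono main[OF assms] by blast
    from place_add_dominant[OF P _ this] have
      "(1 + s) * node k + (node' k - s * node k) \<noteq> 0"
      "P ((1 + s) * node k + (node' k - s * node k)) = 3 * int k + 3"
      using node(1) s(2) val by auto
    moreover have "(1 + s) * node k + (node' k - s * node k) = node k + node' k" by (simp add: algebra_simps)
    ultimately show ?thesis by simp
  qed
qed

lemma generators_in_semigroup:
  "q \<in> H" "q + 1 \<in> H"
  "j < m \<Longrightarrow> (q - 1) + j * (q - 2) \<in> H"
proof -
  show "q + 1 \<in> H"
    using quotient_in_semigroup[of 1 1 "q + 1"] bounded_1 place_1[OF P] by simp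
  show "q \<in> H"
    using quotient_in_semigroup[of Y 1 q] Y_nonzero P_Y bounded_mono[OF bounded_Y, of "q + 1"] by simp
  assume j: "j < m"
  have "bounded (Suc j * (q + 1)) (node j)"
    by (rule bounded_mono[OF bounded_node(1)]) simp
  moreover have "P (node j) + int ((q - 1) + j * (q - 2)) = int (Suc j * (q + 1))"
  proof -
    have "2 \<le> q" using q_ge by simp
    then obtain r where "q = 2 + r" using le_Suc_ex by blast
    then show ?thesis using node_order(2)[OF j] by (simp add: algebra_simps)
  qed
  ultimately show "(q - 1) + j * (q - 2) \<in> H"
    by (rule quotient_in_semigroup[OF node_order(1)[OF j]])
qed

text \<open>
  The three residues of \<open>l\<close> modulo \<open>3\<close> are served by \<open>node k + node' k\<close>, which is close to \<open>(1 + s) * node k\<close>,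
  by \<open>node k * (X + Y)\<close> and by \<open>node k\<close>. The pole order \<open>d * q + d + m - 1\<close> allowed at infinity is what remains
  of the degree \<open>2 g - 2\<close> of a canonical divisor after \<open>m - 1 - d\<close> factors \<open>\<tau>\<close>; the case \<open>l = 3 * d\<close> needs
  more than \<open>d * q\<close>.
\<close>

lemma function_of_order:
  assumes d: "d < m" and l: "l \<le> 3 * d"
  shows "\<exists>f. f \<noteq> 0 \<and> P f = int l \<and> bounded (d * (q + 1) + (m - 1)) f"
proof -
  have "l = 0 \<or> l = 1 \<or> (\<exists>k. l = 3 * k + 3) \<or> (\<exists>k. l = 3 * k + 4) \<or> (\<exists>k. l = 3 * k + 2)"
    by presburger
  then consider (zero) "l = 0" | (one) "l = 1" | (m0) k where "l = 3 * k + 3"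
    | (m1) k where "l = 3 * k + 4" | (m2) k where "l = 3 * k + 2"
    by blast
  then show ?thesis
  proof cases
    case zero
    then show ?thesis using bounded_1 place_1[OF P] by (intro exI[of _ 1]) simp
  next
    case one
    then have "q \<le> d * (q + 1) + (m - 1)" using l by (cases d) auto
    then show ?thesis using one Y_nonzero P_Y bounded_mono[OF bounded_Y] by (intro exI[of _ Y]) simp
  next
    case m0
    then have k: "Suc k \<le> d" using l by simp
    have "Suc k * q \<le> d * q" using k by (rule mult_le_mono1)
    then have le: "Suc k * q + m \<le> d * (q + 1) + (m - 1)" using k d by simp
    have "bounded (Suc k * q + m) (node k + node' k)"
      using bounded_mono[OF bounded_node(1), of k "Suc k * q + m"] bounded_node(2) by (intro bounded_add) auto
    then show ?thesis using m0 node_order(3)[of k] k d bounded_mono[OF _ le]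
      by (intro exI[of _ "node k + node' k"]) auto
  next
    case m1
    then have k: "Suc (Suc k) \<le> d" using l by simp
    have "Suc (Suc k) * q \<le> d * q" using k by (rule mult_le_mono1)
    then have le: "Suc k * q + q \<le> d * (q + 1) + (m - 1)" by simp
    have "bounded (Suc k * q + q) (node k * (X + Y))"
      using bounded_mult[OF bounded_node(1)[of k] bounded_node(1)[of 0]] by (simp add: node_simps)
    then show ?thesis using m1 node_order(1,2)[of k] P_X_plus_Y k d bounded_mono[OF _ le]
      by (intro exI[of _ "node k * (X + Y)"]) (auto simp: place_mult[OF P])
  next
    case m2
    then have k: "Suc k \<le> d" using l by simp
    have "Suc k * q \<le> d * q" using k by (rule mult_le_mono1)
    then have le: "Suc k * q \<le> d * (q + 1) + (m - 1)" by simp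
    then show ?thesis using m2 node_order(1,2)[of k] k d bounded_mono[OF bounded_node(1) le]
      by (intro exI[of _ "node k"]) auto
  qed
qed

end

context curve
begin

section \<open>A basis adapted to the places at infinity\<close>

definition tau_poly :: "'f poly" where "tau_poly = monom 1 3 + [:Y\<^sup>2, 0, -1:]"

definition basis_poly :: "nat \<Rightarrow> 'f poly" where
  "basis_poly k = monom 1 (k mod 3) * tau_poly ^ (k div 3)"

lemma tau_poly: "tau_poly \<in> polys KY" "poly tau_poly X = \<tau>" "degree tau_poly = 3" "lead_coeff tau_poly = 1"
proof -
  show "tau_poly \<in> polys KY"
    unfolding tau_poly_def
    using subring_power[OF KY_ring Y_KY] subring_1[OF KY_ring] subring_0[OF KY_ring] subring_uminus[OF KY_ring]
    by (intro polys_add[OF KY_ring] polys_monom[OF KY_ring] polys_pCons[OF KY_ring]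
        polys_0[OF KY_ring]) auto
  show "poly tau_poly X = \<tau>"
    by (simp add: tau_poly_def poly_monom \<tau>_def algebra_simps power2_eq_square)
  show deg: "degree tau_poly = 3"
    by (simp add: tau_poly_def degree_add_eq_left degree_monom_eq)
  show "lead_coeff tau_poly = 1" unfolding deg by (simp add: tau_poly_def eval_nat_numeral)
qed

lemma basis_poly:
  "basis_poly k \<in> polys KY" "poly (basis_poly k) X = X ^ (k mod 3) * \<tau> ^ (k div 3)"
  "degree (basis_poly k) = k" "coeff (basis_poly k) k = 1"
proof -
  show "basis_poly k \<in> polys KY"
    unfolding basis_poly_def using tau_poly(1) subring_1[OF KY_ring]
    by (intro polys_mult[OF KY_ring] polys_monom[OF KY_ring] polys_power[OF KY_ring]) auto
  show "poly (basis_poly k) X = X ^ (k mod 3) * \<tau> ^ (k div 3)"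
    by (simp add: basis_poly_def poly_monom tau_poly(2))
  have "tau_poly \<noteq> 0" using tau_poly(4) by auto
  then have "degree (basis_poly k) = degree (monom (1::'f) (k mod 3)) + degree (tau_poly ^ (k div 3))"
    unfolding basis_poly_def by (intro degree_mult_eq) auto
  also have "\<dots> = k mod 3 + k div 3 * 3"
  proof -
    have "degree (monom (1::'f) (k mod 3)) = k mod 3" by (rule degree_monom_eq) simp
    moreover have "degree (tau_poly ^ (k div 3)) = k div 3 * 3"
      using degree_power_eq[OF \<open>tau_poly \<noteq> 0\<close>, of "k div 3"] tau_poly(3) by simp
    ultimately show ?thesis by (simp only:)
  qed
  finally have "degree (basis_poly k) = k mod 3 + k div 3 * 3" .
  then show deg: "degree (basis_poly k) = k" by simp
  have "lead_coeff (basis_poly k) = 1"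
    unfolding basis_poly_def lead_coeff_mult lead_coeff_power tau_poly(4) by (simp only: lead_coeff_monom power_one mult_1)
  then show "coeff (basis_poly k) k = 1" unfolding deg .
qed

lemma basis_expansion:
  assumes "p \<in> polys KY" "degree p \<le> n"
  shows "\<exists>c. (\<forall>k. c k \<in> KY) \<and> p = (\<Sum>k\<le>n. smult (c k) (basis_poly k)) \<and> c n = coeff p n"
  using assms
proof (induction n arbitrary: p)
  case 0
  then obtain a where a: "p = [:a:]" by (metis degree_eq_zeroE le_zero_eq)
  then have "a \<in> KY" using polys_coeff[OF 0(1), of 0] by simp
  moreover have "basis_poly 0 = 1" by (simp add: basis_poly_def)
  ultimately show ?case using a by (intro exI[of _ "\<lambda>_. a"]) simp
next
  case (Suc n)
  let ?a = "coeff p (Suc n)"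
  let ?r = "p - smult ?a (basis_poly (Suc n))"
  have a: "?a \<in> KY" using Suc.prems by (simp add: polys_coeff)
  have r: "?r \<in> polys KY"
    using Suc.prems(1) a basis_poly(1) by (intro polys_diff[OF KY_ring] polys_smult[OF KY_ring])
  have "degree ?r \<le> n"
  proof (rule degree_le, intro allI impI)
    fix i assume "n < i"
    show "coeff ?r i = 0"
    proof (cases "i = Suc n")
      case True
      then show ?thesis using basis_poly(4)[of "Suc n"] by simp
    next
      case False
      then have "coeff p i = 0" "coeff (basis_poly (Suc n)) i = 0"
        using \<open>n < i\<close> Suc.prems(2) basis_poly(3)[of "Suc n"] by (auto intro: coeff_eq_0)
      then show ?thesis by simp
    qed
  qed
  from Suc.IH[OF r this] obtain c where c: "\<And>k. c k \<in> KY" "?r = (\<Sum>k\<le>n. smult (c k) (basis_poly k))" by blast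
  let ?c = "c(Suc n := ?a)"
  have "(\<Sum>k\<le>n. smult (?c k) (basis_poly k)) = (\<Sum>k\<le>n. smult (c k) (basis_poly k))"
    by (rule sum.cong) auto
  then have "(\<Sum>k\<le>Suc n. smult (?c k) (basis_poly k)) = ?r + smult ?a (basis_poly (Suc n))"
    unfolding sum.atMost_Suc c(2)[symmetric] by simp
  also have "\<dots> = p" by simp
  finally show ?case using c(1) a by (intro exI[of _ ?c]) auto
qed

lemma value_KY:
  assumes v: "is_place K v" and e: "e > 0" "v Y = - int q * e" and r: "r \<in> KY" "r \<noteq> 0"
  shows "\<exists>k. v r = int q * e * k"
proof -
  obtain a b where ab: "a \<in> polys K" "b \<in> polys K" "b \<noteq> 0" "poly b Y \<noteq> 0" "r = poly a Y / poly b Y"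
    using adjoin_single_fraction[OF K r(1)] by blast
  then have a: "a \<noteq> 0" "poly a Y \<noteq> 0" using r(2) by auto
  have "v Y < 0" using e q_ge by (simp add: mult_less_0_iff)
  then have "v r = int (degree a) * v Y - int (degree b) * v Y"
    using place_poly_at_pole(1)[OF v K _ ab(1) a(1)] place_poly_at_pole(1)[OF v K _ ab(2,3)]
      ab(4,5) a(2) by (simp add: place_divide[OF v])
  then show ?thesis using e(2) by (intro exI[of _ "int (degree b) - int (degree a)"]) (simp add: algebra_simps)
qed

definition weight :: "nat \<Rightarrow> int" where
  "weight k = 2 * int m * int (k mod 3) + (int q + 1) * int (k div 3)"

lemma value_basis:
  assumes "is_place K v" "e > 0" "v Y = - int q * e"
  shows "v (X ^ (k mod 3) * \<tau> ^ (k div 3)) = - (weight k * e)"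
proof -
  have "v (X ^ (k mod 3) * \<tau> ^ (k div 3)) = int (k mod 3) * v X + int (k div 3) * v \<tau>"
    using assms(1) X_nonzero P_tau(1) by (simp add: place_mult place_power)
  then show ?thesis unfolding infinite_vals[OF assms] weight_def by (simp add: algebra_simps)
qed

text \<open>
  Modulo \<open>m\<close> a weight is \<open>k div 3 < m\<close>; after that, \<open>2 m (k mod 3)\<close> is seen modulo \<open>3 m\<close>.
\<close>

lemma weight_inj:
  assumes ij: "i < q" "j < q" and eq: "int q * a - weight i = int q * b - weight j"
  shows "i = j"
proof -
  have q3: "int q = 3 * int m" using q_m(1) by simp
  have M: "int m > 0" using q_m(3) by simp
  define d where "d = int (i div 3) - int (j div 3)"
  have d: "d = int m * (3 * (a - b) - 2 * (int (i mod 3) - int (j mod 3)) - 3 * d)"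
    using eq unfolding weight_def q3 d_def by (simp add: algebra_simps)
  have "i div 3 < m" "j div 3 < m" using ij q_m(1) by auto
  then have "\<bar>d\<bar> < int m" unfolding d_def by linarith
  moreover have "int m dvd d" using d by (metis dvd_triv_left)
  ultimately have d0: "d = 0" using dvd_imp_le_int[of d "int m"] by force
  define y where "y = int (i mod 3) - int (j mod 3)"
  have "i mod 3 < 3" "j mod 3 < 3" by simp_all
  then have "y < 3" "- 3 < y" unfolding y_def by linarith+
  moreover have "3 * (a - b) = 2 * y" using d M unfolding d0 y_def by simp
  ultimately have "y = 0" by presburger
  then have "i mod 3 = j mod 3" unfolding y_def by simp
  moreover have "i div 3 = j div 3" using d0 by (simp add: d_def)
  ultimately show ?thesis by (metis div_mult_mod_eq)
qed

text \<open>
  The weights of the basis are pairwise different modulo \<open>q\<close>, so the pole order of a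
  combination is the largest pole order of its terms.
\<close>

lemma expansion_value:
  assumes v: "is_place K v" "e > 0" "v Y = - int q * e"
    and c: "\<And>k. c k \<in> KY" and n: "n < q" and k: "k \<le> n" "c k \<noteq> 0"
  shows "poly (\<Sum>k\<le>n. smult (c k) (basis_poly k)) X \<noteq> 0"
    "v (poly (\<Sum>k\<le>n. smult (c k) (basis_poly k)) X) \<le> v (c k) - weight k * e"
proof -
  let ?f = "\<lambda>k. c k * (X ^ (k mod 3) * \<tau> ^ (k div 3))"
  have sum: "poly (\<Sum>k\<le>n. smult (c k) (basis_poly k)) X = (\<Sum>k\<in>{..n}. ?f k)"
    by (simp add: poly_sum basis_poly(2))
  have nz: "X ^ (k mod 3) * \<tau> ^ (k div 3) \<noteq> 0" for k using X_nonzero P_tau(1) by simp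
  have val: "v (?f k) = v (c k) - weight k * e" if "c k \<noteq> 0" for k
    using place_mult[OF v(1) that nz] value_basis[OF v] by simp
  have "inj_on (\<lambda>k. v (?f k)) {k\<in>{..n}. ?f k \<noteq> 0}"
  proof (rule inj_onI)
    fix i j assume i: "i \<in> {k\<in>{..n}. ?f k \<noteq> 0}" and j: "j \<in> {k\<in>{..n}. ?f k \<noteq> 0}" and eq: "v (?f i) = v (?f j)"
    then have ci: "c i \<noteq> 0" and cj: "c j \<noteq> 0" by auto
    obtain a b where ab: "v (c i) = int q * e * a" "v (c j) = int q * e * b"
      using value_KY[OF v c ci] value_KY[OF v c cj] by blast
    have "(int q * a - weight i) * e = (int q * b - weight j) * e"
      using eq val[OF ci] val[OF cj] ab by (simp add: algebra_simps)
    then have "int q * a - weight i = int q * b - weight j" using v(2) by simp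
    then show "i = j" using weight_inj[of i j a b] i j n by auto
  qed
  from place_sum_distinct[OF v(1) finite_atMost this, of k]
  show "poly (\<Sum>k\<le>n. smult (c k) (basis_poly k)) X \<noteq> 0"
    "v (poly (\<Sum>k\<le>n. smult (c k) (basis_poly k)) X) \<le> v (c k) - weight k * e"
    unfolding sum using k nz[of k] val[OF k(2)] by auto
qed

text \<open>
  Infinity is totally ramified over \<open>K(Y)\<close>, which makes the equation of the curve irreducible.
\<close>

lemma powers_independent:
  assumes p: "p \<in> polys KY" "degree p < q" "poly p X = 0"
  shows "p = 0"
proof (rule ccontr)
  assume "p \<noteq> 0"
  obtain v where v: "is_place K v" "v Y < 0" using infinite_place_exists by blast
  obtain e where e: "e > 0" "v Y = - int q * e" using infinite_place_vals[OF v] by blast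
  obtain c where c: "\<And>k. c k \<in> KY" "p = (\<Sum>k\<le>degree p. smult (c k) (basis_poly k))" "c (degree p) = lead_coeff p"
    using basis_expansion[OF p(1) order_refl] by blast
  have "poly (\<Sum>k\<le>degree p. smult (c k) (basis_poly k)) X \<noteq> 0"
    using expansion_value(1)[OF v(1) e c(1) p(2) order_refl] c(3) \<open>p \<noteq> 0\<close> by simp
  then show False using p(3) c(2) by simp
qed

text \<open>
  The basis polynomials are monic of degrees \<open>0, \<dots>, q - 1\<close>, so the coefficient of \<open>X ^ (q - 1)\<close> is the
  coefficient at the last of them, whose weight is the largest.
\<close>

lemma top_coefficient_value:
  assumes v: "is_place K v" "e > 0" "v Y = - int q * e"
    and p: "p \<in> polys KY" "degree p < q" "coeff p (q - 1) \<noteq> 0"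
  shows "v (poly p X) \<le> v (coeff p (q - 1)) - (4 * int m + (int q + 1) * (int m - 1)) * e"
proof -
  have "degree p \<le> q - 1" using p(2) by simp
  from basis_expansion[OF p(1) this] obtain c where
    "(\<forall>k. c k \<in> KY) \<and> p = (\<Sum>k\<le>q - 1. smult (c k) (basis_poly k)) \<and> c (q - 1) = coeff p (q - 1)"
    by (rule exE)
  then have c: "\<And>k. c k \<in> KY" "p = (\<Sum>k\<le>q - 1. smult (c k) (basis_poly k))" "c (q - 1) = coeff p (q - 1)"
    by (simp_all only: simp_thms)
  have "q - 1 = 2 + (m - 1) * 3" using q_m(1,3) by arith
  then have "(q - 1) mod 3 = 2" "(q - 1) div 3 = m - 1" by (simp_all only: mod_mult_self1 div_mult_self1) simp_all
  then have "weight (q - 1) = 4 * int m + (int q + 1) * (int m - 1)"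
    using q_m(3) by (simp add: weight_def of_nat_diff)
  moreover have "v (poly (\<Sum>k\<le>q - 1. smult (c k) (basis_poly k)) X) \<le> v (c (q - 1)) - weight (q - 1) * e"
  proof (rule expansion_value(2)[OF v c(1)])
    show "q - 1 < q" using q_ge by simp
    show "c (q - 1) \<noteq> 0" unfolding c(3) by (rule p(3))
  qed simp
  ultimately show ?thesis by (simp only: c(2)[symmetric] c(3))
qed

section \<open>The translations of \<open>X\<close> and the trace\<close>

definition rep :: "'f \<Rightarrow> 'f poly" where
  "rep f = (THE p. p \<in> polys KY \<and> degree p < q \<and> f = poly p X)"

lemma rep_eq:
  assumes "p \<in> polys KY" "degree p < q"
  shows "rep (poly p X) = p"
  unfolding rep_def
proof (rule the_equality)
  fix r assume r: "r \<in> polys KY \<and> degree r < q \<and> poly p X = poly r X"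
  then have "r - p \<in> polys KY" using assms(1) by (intro polys_diff[OF KY_ring]) auto
  moreover have "degree (r - p) < q" using r assms(2) by (intro degree_diff_less) auto
  moreover have "poly (r - p) X = 0" using r by simp
  ultimately have "r - p = 0" by (rule powers_independent)
  then show "r = p" by simp
qed (use assms in auto)

lemma rep: "rep f \<in> polys KY" "degree (rep f) < q" "poly (rep f) X = f"
proof -
  obtain p where p: "p \<in> polys KY" "degree p < q" "f = poly p X" by (rule all_poly_X)
  have "rep f = p" unfolding p(3) by (rule rep_eq[OF p(1,2)])
  then show "rep f \<in> polys KY" "degree (rep f) < q" "poly (rep f) X = f" using p by simp_all
qed

text \<open>
  The automorphism of the field over \<open>K(Y)\<close> that sends \<open>X\<close> to \<open>X + \<alpha>\<close>, for \<open>\<alpha> \<in> anti_q\<close>. These are the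
  Galois automorphisms, so the sum of the images of \<open>f\<close> is its trace.
\<close>

definition translate :: "'f \<Rightarrow> 'f \<Rightarrow> 'f" where
  "translate \<alpha> f = poly (rep f) (X + \<alpha>)"

lemma translate_poly:
  assumes "\<alpha> \<in> anti_q" "p \<in> polys KY"
  shows "translate \<alpha> (poly p X) = poly p (X + \<alpha>)"
proof -
  obtain r s where rs: "r \<in> polys KY" "degree r < q" "p = curve_poly * s + r"
    using poly_X_reduce[OF assms(2)] by blast
  have "\<alpha> ^ q = - \<alpha>" using assms(1) by (simp add: anti_q_def)
  then have "poly curve_poly (X + \<alpha>) = poly curve_poly X"
    by (simp add: curve_poly_def poly_monom frob_add)
  then have "poly curve_poly (X + \<alpha>) = 0" "poly curve_poly X = 0" using curve_poly(2) by simp_all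
  then have "poly p X = poly r X" "poly p (X + \<alpha>) = poly r (X + \<alpha>)" using rs(3) by simp_all
  then show ?thesis using rep_eq[OF rs(1,2)] by (simp add: translate_def)
qed

lemma translate_add: "translate \<alpha> (f + g) = translate \<alpha> f + translate \<alpha> g"
proof -
  have "rep (poly (rep f + rep g) X) = rep f + rep g"
    by (rule rep_eq[OF polys_add[OF KY_ring rep(1) rep(1)] degree_add_less[OF rep(2) rep(2)]])
  then show ?thesis by (simp add: translate_def rep(3))
qed

lemma translate_mult:
  assumes "\<alpha> \<in> anti_q"
  shows "translate \<alpha> (f * g) = translate \<alpha> f * translate \<alpha> g"
  using translate_poly[OF assms polys_mult[OF KY_ring rep(1) rep(1)], of f g]
  by (simp add: rep(3) translate_def)

lemma translate_KY:
  assumes "c \<in> KY" shows "translate \<alpha> c = c"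
proof -
  have "rep (poly [:c:] X) = [:c:]"
    using q_ge by (intro rep_eq polys_const[OF KY_ring assms]) simp
  then show ?thesis by (simp add: translate_def)
qed

lemma translate_X:
  assumes "\<alpha> \<in> anti_q" shows "translate \<alpha> X = X + \<alpha>"
  using translate_poly[OF assms polys_monom[OF KY_ring subring_1[OF KY_ring], of 1]]
  by (simp add: poly_monom)

lemma translate_nonzero:
  assumes "\<alpha> \<in> anti_q" "f \<noteq> 0" shows "translate \<alpha> f \<noteq> 0"
  using translate_mult[OF assms(1), of f "inverse f"] assms(2)
    translate_KY[OF subring_1[OF KY_ring], of \<alpha>] by auto

lemma translate_zero: "translate \<alpha> 0 = 0"
  using translate_KY[OF subring_0[OF KY_ring]] .

lemma translate_surj:
  assumes "\<alpha> \<in> anti_q" shows "\<exists>g. translate \<alpha> g = f"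
proof -
  have "\<alpha> \<in> KY" using assms adjoin_base by (auto simp: anti_q_def)
  then have "[:- \<alpha>, 1:] \<in> polys KY"
    by (intro polys_pCons[OF KY_ring] polys_0[OF KY_ring] subring_uminus[OF KY_ring] subring_1[OF KY_ring])
  then have "rep f \<circ>\<^sub>p [:- \<alpha>, 1:] \<in> polys KY" by (rule polys_pcompose[OF KY_ring rep(1)])
  from translate_poly[OF assms this] show ?thesis by (auto simp: poly_pcompose rep(3))
qed

lemma translate_place:
  assumes \<alpha>: "\<alpha> \<in> anti_q" and v: "is_place K v"
  shows "is_place K (\<lambda>f. v (translate \<alpha> f))"
proof -
  obtain a where a: "a \<noteq> 0" "v a = 1" using place_onto[OF v] by blast
  obtain g where g: "translate \<alpha> g = a" using translate_surj[OF \<alpha>] by blast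
  then have "g \<noteq> 0" using a translate_zero by auto
  note nz = translate_nonzero[OF \<alpha>]
  show ?thesis
    unfolding is_place_def
  proof (intro conjI allI impI ballI)
    show "v (translate \<alpha> 0) = 0" by (simp add: translate_zero place_0[OF v])
    show "\<exists>f. f \<noteq> 0 \<and> v (translate \<alpha> f) = 1" using g a(2) \<open>g \<noteq> 0\<close> by blast
    show "v (translate \<alpha> c) = 0" if "c \<in> K" for c
      using translate_KY[of c \<alpha>] place_const[OF v that] adjoin_base[of K "{Y}"] that by auto
    fix f h :: 'f assume fh: "f \<noteq> 0" "h \<noteq> 0"
    show "v (translate \<alpha> (f * h)) = v (translate \<alpha> f) + v (translate \<alpha> h)"
      unfolding translate_mult[OF \<alpha>] by (rule place_mult[OF v nz[OF fh(1)] nz[OF fh(2)]])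
    show "min (v (translate \<alpha> f)) (v (translate \<alpha> h)) \<le> v (translate \<alpha> (f + h))" if "f + h \<noteq> 0"
      using nz[OF that] unfolding translate_add by (rule place_min[OF v nz[OF fh(1)] nz[OF fh(2)]])
  qed
qed

lemma sum_translates: "(\<Sum>\<alpha>\<in>anti_q. translate \<alpha> f) = coeff (rep f) (q - 1)"
  unfolding translate_def by (rule sum_anti_poly[OF rep(2)])

section \<open>The gaps at \<open>P\<close>\<close>

text \<open>
  The residue theorem for the differential \<open>G dY\<close>, which has at most a simple pole at \<open>P\<close>. The
  trace \<open>r\<close> of \<open>G\<close> to \<open>K(Y)\<close> would have a simple pole at \<open>Y = 0\<close> and no other
  finite pole, so \<open>Y r\<close> would be a nonzero polynomial. But \<open>r\<close> is the coefficient of \<open>G\<close> at the basis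
  element of largest weight, and the bound on \<open>G\<close> at infinity forces \<open>Y r\<close> to vanish there.
\<close>

lemma no_simple_pole:
  assumes G: "G \<noteq> 0" "P G = - 1"
    and fin: "\<And>v. is_place K v \<Longrightarrow> v \<noteq> P \<Longrightarrow> vge v 0 Y \<Longrightarrow> vge v 0 G"
    and inf: "\<And>v e. is_place K v \<Longrightarrow> e > 0 \<Longrightarrow> v Y = - int q * e \<Longrightarrow>
      vge v (- (((int q + 1) * (int m - 1) + int m - 1) * e)) G"
  shows False
proof -
  define r where "r = coeff (rep G) (q - 1)"
  have r: "r = (\<Sum>\<alpha>\<in>anti_q. translate \<alpha> G)" by (simp add: r_def sum_translates)
  have rKY: "r \<in> KY" unfolding r_def by (rule polys_coeff[OF rep(1)])
  have vge_tr: "vge v n (translate \<alpha> f) \<longleftrightarrow> vge (\<lambda>f. v (translate \<alpha> f)) n f" if "\<alpha> \<in> anti_q" for v n \<alpha> f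
    using translate_nonzero[OF that, of f] translate_zero[of \<alpha>] by (cases "f = 0") (auto simp: vge_def)
  have trY: "translate \<alpha> Y = Y" for \<alpha> by (rule translate_KY[OF Y_KY])
  \<comment> \<open>a conjugate of \<open>G\<close> has its pole at a conjugate of \<open>P\<close>, where \<open>Y\<close> has a simple zero too\<close>
  have reg: "vge v 0 (Y * r)" if v: "is_place K v" and Y: "vge v 0 Y" for v
  proof -
    have "vge v 0 (translate \<alpha> (Y * G))" if \<alpha>: "\<alpha> \<in> anti_q" for \<alpha>
    proof -
      let ?w = "\<lambda>f. v (translate \<alpha> f)"
      have w: "is_place K ?w" by (rule translate_place[OF \<alpha> v])
      have "vge ?w 0 (Y * G)"
      proof (cases "?w = P")
        case True
        have "P (Y * G) = 0" using G P_Y Y_nonzero by (simp add: place_mult[OF P])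
        then show ?thesis unfolding True by (simp add: vge_def)
      next
        case False
        have "vge ?w 0 Y" using Y by (simp add: vge_def trY)
        then show ?thesis using vge_mult[OF w _ fin[OF w False]] by force
      qed
      then show ?thesis using vge_tr[OF \<alpha>] by simp
    qed
    then have "vge v 0 (\<Sum>\<alpha>\<in>anti_q. translate \<alpha> (Y * G))" by (rule vge_sum[OF v])
    moreover have "(\<Sum>\<alpha>\<in>anti_q. translate \<alpha> (Y * G)) = Y * r"
      unfolding r sum_distrib_left by (intro sum.cong) (auto simp: translate_mult trY)
    ultimately show ?thesis by simp
  qed
  have "Y * r \<in> KY" using rKY Y_KY by (rule subring_mult[OF KY_ring, rotated])
  then obtain B where B: "B \<in> polys K" "Y * r = poly B Y"
    using no_finite_poles_imp_poly[OF K Y_transcendental finite_over_KY _ reg] by blast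
  have r0: "r \<noteq> 0"
  proof -
    \<comment> \<open>only the summand with \<open>\<alpha> = 0\<close> has a pole at \<open>P\<close>\<close>
    have "r = G + (\<Sum>\<alpha>\<in>anti_q - {0}. translate \<alpha> G)"
      unfolding r using sum.remove[OF finite_anti zero_anti, of "\<lambda>\<alpha>. translate \<alpha> G"]
      by (simp add: translate_def rep(3))
    moreover have "vge P (P G + 1) (\<Sum>\<alpha>\<in>anti_q - {0}. translate \<alpha> G)"
    proof (rule vge_sum[OF P])
      fix \<alpha> assume "\<alpha> \<in> anti_q - {0}"
      then have \<alpha>: "\<alpha> \<in> anti_q" "\<alpha> \<in> K" "\<alpha> \<noteq> 0" by (auto simp: anti_q_def)
      let ?w = "\<lambda>f. P (translate \<alpha> f)"
      have w: "is_place K ?w" by (rule translate_place[OF \<alpha>(1) P])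
      have "?w X = 0" using vge_add_const[OF P PX \<alpha>(2,3)] by (simp add: translate_X[OF \<alpha>(1)] add.commute)
      then have "?w \<noteq> P" using P_X by (metis zero_neq_one)
      moreover have "vge ?w 0 Y" using P_Y by (simp add: vge_def trY)
      ultimately have "vge ?w 0 G" using fin[OF w] by blast
      then show "vge P (P G + 1) (translate \<alpha> G)" using vge_tr[OF \<alpha>(1)] G by simp
    qed
    ultimately show ?thesis using place_add_dominant(1)[OF P G(1)] by simp
  qed
  then have B0: "B \<noteq> 0" using B(2) Y_nonzero by auto
  obtain v where v: "is_place K v" "v Y < 0" using infinite_place_exists by blast
  obtain e where e: "e > 0" "v Y = - int q * e" using infinite_place_vals[OF v] by blast
  have "v (poly (rep G) X) \<le> v r - (4 * int m + (int q + 1) * (int m - 1)) * e"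
    using top_coefficient_value[OF v(1) e rep(1,2)] r0 unfolding r_def by blast
  moreover have "v G \<ge> - (((int q + 1) * (int m - 1) + int m - 1) * e)"
    using inf[OF v(1) e] G(1) by (simp add: vge_def)
  ultimately have "v r \<ge> (4 * int m + (int q + 1) * (int m - 1)) * e - ((int q + 1) * (int m - 1) + int m - 1) * e"
    by (simp add: rep(3))
  also have "(4 * int m + (int q + 1) * (int m - 1)) * e - ((int q + 1) * (int m - 1) + int m - 1) * e
      = (int q + 1) * e"
    using q_m(1) by (simp add: algebra_simps)
  finally have "v (Y * r) \<ge> e"
    using e(2) r0 Y_nonzero by (simp add: place_mult[OF v(1)] algebra_simps)
  moreover have "v (poly B Y) \<le> 0"
    unfolding place_poly_at_pole(1)[OF v(1) K v(2) B(1) B0] using v(2) by (simp add: mult_nonneg_nonpos)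
  ultimately show False using B(2) e(1) by simp
qed

text \<open>
  Multiplication with a function of order \<open>n - 1\<close> turns a pole of order \<open>n = k * (q + 1) + l + 1\<close> into a
  simple pole. The allowed pole order at infinity is \<open>(q + 1) * (m - 1) + m - 1 = 2 g - 2\<close>: the factor is the
  coefficient of a regular differential.
\<close>

lemma gap:
  assumes k: "k < m" and l: "l \<le> 3 * (m - 1 - k)"
  shows "k * (q + 1) + l + 1 \<notin> H"
proof
  define n where "n = k * (q + 1) + l + 1"
  then have n1: "n \<ge> 1" by simp
  assume "k * (q + 1) + l + 1 \<in> H"
  then obtain z where z: "z \<noteq> 0" "pole_divisor K z = point_divisor n P"
    unfolding weierstrass_semigroup_def n_def by blast
  have Pz: "P z = - int n"
    using fun_cong[OF z(2), of P] P n1 by (auto simp: pole_divisor_def point_divisor_def max_def split: if_splits)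
  have Qz: "v z \<ge> 0" if "is_place K v" "v \<noteq> P" for v
    using fun_cong[OF z(2), of v] that by (auto simp: pole_divisor_def point_divisor_def max_def split: if_splits)
  let ?d = "m - 1 - k"
  obtain f where f: "f \<noteq> 0" "P f = int l" "bounded (?d * (q + 1) + (m - 1)) f"
    using function_of_order[of ?d l] k l by auto
  define F where "F = \<tau> ^ k * f"
  have F0: "F \<noteq> 0" using f(1) P_tau(1) by (simp add: F_def)
  have PF: "P F = int (k * (q + 1) + l)"
    using f P_tau by (simp add: F_def place_mult[OF P] place_power[OF P] algebra_simps)
  have "bounded (k * (q + 1) + (?d * (q + 1) + (m - 1))) F"
    unfolding F_def by (intro bounded_mult bounded_power bounded_tau f(3))
  moreover have "k * (q + 1) + (?d * (q + 1) + (m - 1)) = (m - 1) * (q + 1) + (m - 1)"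
  proof -
    obtain r where "m = Suc (k + r)" using k less_imp_Suc_add by blast
    then show ?thesis by (simp add: algebra_simps)
  qed
  ultimately have F: "bounded ((m - 1) * (q + 1) + (m - 1)) F" by (simp only:)
  show False
  proof (rule no_simple_pole[of "F * z"])
    show "F * z \<noteq> 0" using F0 z by simp
    show "P (F * z) = - 1" using F0 z(1) PF Pz by (simp add: place_mult[OF P] n_def)
    show "vge v 0 (F * z)" if v: "is_place K v" "v \<noteq> P" "vge v 0 Y" for v
      using vge_mult[OF v(1) bounded_finite[OF F v(1,3)] vgeI[of 0 v z, OF Qz[OF v(1,2)]]] by simp
    fix v e assume v: "is_place K v" "e > 0" "v Y = - int q * e"
    have "v Y < 0" using v q_ge by (simp add: mult_less_0_iff)
    then have "v \<noteq> P" using P_Y by auto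
    then have "vge v (- (int ((m - 1) * (q + 1) + (m - 1)) * e) + 0) (F * z)"
      by (intro vge_mult[OF v(1) bounded_infinite[OF F v]] vgeI Qz[OF v(1)])
    moreover have "int ((m - 1) * (q + 1) + (m - 1)) = (int q + 1) * (int m - 1) + int m - 1"
      using q_m(3) by (cases m) (simp_all add: algebra_simps)
    ultimately show "vge v (- (((int q + 1) * (int m - 1) + int m - 1) * e)) (F * z)" by simp
  qed
qed

end

section \<open>The numerical semigroup\<close>

lemma submonoid_generated_least: "is_submonoid M \<Longrightarrow> S \<subseteq> M \<Longrightarrow> submonoid_generated S \<subseteq> M"
  unfolding submonoid_generated_def by (rule hull_minimal)

lemma submonoid_generated_submonoid: "is_submonoid (submonoid_generated S)"
proof -
  have "is_submonoid (\<Inter>{M. is_submonoid M \<and> S \<subseteq> M})" by (auto simp: is_submonoid_def)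
  then show ?thesis by (simp add: submonoid_generated_def hull_def)
qed

lemma submonoid_generated_gen: "S \<subseteq> submonoid_generated S"
  unfolding submonoid_generated_def by (rule hull_subset)

abbreviation (input) generated_semigroup :: "nat \<Rightarrow> nat \<Rightarrow> nat set" where
  "generated_semigroup q m \<equiv>
    submonoid_generated ({q, q + 1} \<union> {(q - 1) + j * (q - 2) | j. j < m})"

text \<open>
  With \<open>k + 1\<close> generators all numbers from \<open>(k + 1) * (q - 2) + 1\<close> to \<open>(k + 1) * (q + 1)\<close> are reached. The
  distance between two such intervals shrinks by \<open>3\<close> from one to the next and is gone after \<open>m\<close> of them.
\<close>

lemma semigroup_or_gap:
  fixes q m n :: nat
  assumes q: "q = 3 * m" "m \<ge> 1"
  shows "n \<in> generated_semigroup q m \<or>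
    (\<exists>k l. k < m \<and> l \<le> 3 * (m - 1 - k) \<and> n = k * (q + 1) + l + 1)"
proof -
  let ?S = "generated_semigroup q m"
  have add: "a + b \<in> ?S" if "a \<in> ?S" "b \<in> ?S" for a b
    using submonoid_generated_submonoid that unfolding is_submonoid_def by blast
  have zero: "0 \<in> ?S" using submonoid_generated_submonoid unfolding is_submonoid_def by blast
  have gens: "q \<in> ?S" "q + 1 \<in> ?S" "j < m \<Longrightarrow> (q - 1) + j * (q - 2) \<in> ?S" for j
    by (rule subsetD[OF submonoid_generated_gen]; auto)+
  \<comment> \<open>the lowest number of each interval is a generator itself, the others are sums\<close>
  have level: "a \<in> ?S" if "k < m" "a + r = Suc k * (q + 1)" "r \<le> 3 * k + 2" for k a r
    using that
  proof (induction k arbitrary: a r)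
    case 0
    then have "a + r = q + 1" "r \<le> 2" by simp_all
    then have "a = q + 1 \<or> a = q \<or> a = q - 1" by arith
    moreover have "q - 1 \<in> ?S" using gens(3)[of 0] 0(1) by simp
    ultimately show ?case using gens(1,2) by (elim disjE) (simp_all only:)
  next
    case (Suc k)
    show ?case
    proof (cases "r = 3 * Suc k + 2")
      case True
      have "2 \<le> q" using q by simp
      then obtain p where p: "q = 2 + p" using le_Suc_ex by blast
      have "a = (q - 1) + Suc k * (q - 2)" using Suc.prems(2) True unfolding p by simp
      then show ?thesis using gens(3)[of "Suc k"] Suc.prems(1) by simp
    next
      case False
      define r' where "r' = (if r \<le> 3 * k + 2 then 0 else r - (3 * k + 2))"
      have r': "r' \<le> 2" "r' \<le> r" "r - r' \<le> 3 * k + 2" using False Suc.prems(3) by (auto simp: r'_def)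
      have "q + 1 - r' = q + 1 \<or> q + 1 - r' = q \<or> q + 1 - r' = q - 1" using r'(1) by arith
      moreover have "q - 1 \<in> ?S" using gens(3)[of 0] q(2) by simp
      ultimately have b: "q + 1 - r' \<in> ?S" using gens(1,2) by (elim disjE) (simp_all only:)
      have "3 * k + 2 \<le> Suc k * (q + 1)" using q Suc.prems(1) by (simp add: algebra_simps)
      then have le: "r - r' \<le> Suc k * (q + 1)" using r'(3) by linarith
      have "Suc k * (q + 1) - (r - r') \<in> ?S"
        using Suc.prems(1) r'(3) le by (intro Suc.IH[of _ "r - r'"]) auto
      then have "(Suc k * (q + 1) - (r - r')) + (q + 1 - r') \<in> ?S" using b by (rule add)
      moreover have "(Suc k * (q + 1) - (r - r')) + (q + 1 - r') = a"
        using Suc.prems(2) le r' q by simp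
      ultimately show ?thesis by simp
    qed
  qed
  have large: "n \<in> ?S" if "n + q > m * (q + 1)" for n
    using that
  proof (induction n rule: less_induct)
    case (less n)
    show ?case
    proof (cases "n \<le> m * (q + 1)")
      case True
      have "n + (m * (q + 1) - n) = Suc (m - 1) * (q + 1)" using True q(2) by simp
      moreover have "m * (q + 1) - n \<le> 3 * (m - 1) + 2" using less.prems q by simp
      ultimately show ?thesis using level[of "m - 1" n] q(2) by auto
    next
      case False
      have "q \<le> m * (q + 1)" using q(2) by (cases m) auto
      then have "n - q \<in> ?S" using False q by (intro less.IH) auto
      then have "(n - q) + q \<in> ?S" using gens(1) by (rule add)
      then show ?thesis using False \<open>q \<le> m * (q + 1)\<close> by simp
    qed
  qed
  show ?thesis
  proof (cases "n = 0")
    case True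
    then show ?thesis using zero by simp
  next
    case False
    define k where "k = (n - 1) div (q + 1)"
    define l where "l = (n - 1) mod (q + 1)"
    have n: "n = k * (q + 1) + l + 1" and l: "l \<le> q"
      using False div_mult_mod_eq[of "n - 1" "q + 1"] mod_less_divisor[of "q + 1" "n - 1"]
      unfolding k_def l_def by linarith+
    show ?thesis
    proof (cases "k < m")
      case True
      show ?thesis
      proof (cases "l \<le> 3 * (m - 1 - k)")
        case False
        have "n + (q - l) = Suc k * (q + 1)" using n l by simp
        moreover have "q - l \<le> 3 * k + 2" using False True q by simp
        ultimately show ?thesis using level[OF True] by blast
      qed (use True n in blast)
    next
      case False
      then have "m * (q + 1) \<le> k * (q + 1)" by (intro mult_le_mono1) simp
      then show ?thesis using large n by simp
    qed
  qed
qed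

section \<open>The semigroup at a place with \<open>\<beta> = 1\<close>\<close>

lemma (in curve) semigroup_at_P:
  "H = generated_semigroup q m"
proof
  show "generated_semigroup q m \<subseteq> H"
    using weierstrass_submonoid[OF P] generators_in_semigroup by (intro submonoid_generated_least) auto
  show "H \<subseteq> generated_semigroup q m"
    using semigroup_or_gap[OF q_m(1,3)] gap by blast
qed

lemma value_atI:
  assumes K: "is_subfield K" and P: "is_place K P" and c: "c \<in> K" "z - c \<in> maximal_ideal P"
  shows "value_at K z P = c"
  unfolding value_at_def
proof (rule the_equality)
  fix d assume d: "d \<in> K \<and> z - d \<in> maximal_ideal P"
  have "vge P 1 (z - c)" "vge P 1 (z - d)" using c(2) d by (auto simp: maximal_ideal_def vge_def)
  from vge_diff[OF P this(2,1)] have "vge P 1 (c - d)" by simp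
  moreover have "c - d \<in> K" using c(1) d subring_diff[OF subfield_subring[OF K]] by blast
  then have "P (c - d) = 0" by (rule place_const[OF P])
  ultimately show "d = c" by (simp add: vge_def)
qed (use c in simp)

text \<open>
  It remains to move \<open>P\<close> to the origin. The hypothesis on \<open>\<beta>\<close> says that \<open>b = y(P)\<close> has \<open>trace_sum t b = \<epsilon>\<close> with
  \<open>\<epsilon>\<^sup>2 = 1\<close>. The sign in \<open>Y = - \<epsilon> (y - b)\<close> is chosen such that the equation has the same linear term in
  both cases.
\<close>

theorem theorem2p5:
  fixes t q m :: nat
    and K :: "'f::field set"
    and x y :: 'f
    and P :: "'f place"
  assumes "t \<ge> 1" and "q = 3 ^ t" and "m = q div 3"
    and "Z3_function_field t K x y"
    and "rational_place K P"
    and "beta t K y P = Some 1"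
  shows "weierstrass_semigroup K P =
    submonoid_generated ({q, q + 1} \<union> {(q - 1) + j * (q - 2) | j. j < m})"
proof -
  have K: "is_subfield K" and card: "card K = q\<^sup>2" and gen: "adjoin K {x, y} = UNIV"
    and eq: "x ^ q + x + (trace_sum t y)\<^sup>2 = 0"
    using assms(2,4) by (auto simp: Z3_function_field_def function_field_def)
  interpret finite_field_q2 K t q by unfold_locales (fact K card assms)+
  have P: "is_place K P" and residue: "\<And>z. z \<in> valuation_ring P \<Longrightarrow> \<exists>c\<in>K. z - c \<in> maximal_ideal P"
    using assms(5) by (auto simp: rational_place_def)
  have y: "y \<in> valuation_ring P" and val: "(trace_sum t (value_at K y P))\<^sup>2 = 1"
    using assms(6) by (auto simp: beta_def split: if_splits)
  obtain b where b: "b \<in> K" "y - b \<in> maximal_ideal P" using residue[OF y] by blast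
  define \<epsilon> where "\<epsilon> = trace_sum t b"
  have \<epsilon>: "\<epsilon>\<^sup>2 = 1" using val value_atI[OF K P b] by (simp add: \<epsilon>_def)
  then have \<epsilon>_cases: "\<epsilon> = 1 \<or> \<epsilon> = - 1" by (simp add: power2_eq_1_iff)
  have y0: "vge P 0 y" using y by (auto simp: valuation_ring_def vge_def)
  have Ty: "vge P 0 (trace_sum t y)" by (rule trace_sum_vge[OF P y0]) simp
  have x0: "vge P 0 x"
  proof (rule power_q_add_finite[OF P])
    have "vge P 0 (- ((trace_sum t y)\<^sup>2))"
      unfolding vge_uminus[OF P] using vge_power[OF P Ty, of 2] by simp
    moreover have "x ^ q + x = - ((trace_sum t y)\<^sup>2)" using eq by (simp add: eq_neg_iff_add_eq_0)
    ultimately show "vge P 0 (x ^ q + x)" by simp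
  qed
  then have "x \<in> valuation_ring P" by (auto simp: valuation_ring_def vge_def)
  then obtain a where a: "a \<in> K" "x - a \<in> maximal_ideal P" using residue by blast
  define X where "X = x - a"
  define Y where "Y = - \<epsilon> * (y - b)"
  have PX: "vge P 1 X" using a(2) by (auto simp: X_def maximal_ideal_def vge_def)
  have PY': "vge P 1 (y - b)" using b(2) by (auto simp: maximal_ideal_def vge_def)
  then have PY: "vge P 1 Y" using \<epsilon>_cases vge_uminus[OF P, of 1 "y - b"] unfolding Y_def by auto
  have yY: "y = b + (- \<epsilon>) * Y"
    using \<epsilon> by (simp add: Y_def power2_eq_square flip: mult.assoc)
  have "trace_sum t ((- \<epsilon>) * Y) = (- \<epsilon>) * trace_sum t Y"
    using \<epsilon>_cases by (auto simp: trace_sum_uminus)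
  moreover have "trace_sum t y = trace_sum t (b + (- \<epsilon>) * Y)" using yY by (rule arg_cong)
  ultimately have T: "trace_sum t y = \<epsilon> - \<epsilon> * trace_sum t Y"
    unfolding trace_sum_add[OF three] by (simp add: \<epsilon>_def)
  have "(trace_sum t y)\<^sup>2 = \<epsilon>\<^sup>2 * (1 - trace_sum t Y)\<^sup>2"
    unfolding T by (simp add: power2_eq_square algebra_simps)
  also have "\<dots> = 1 + trace_sum t Y + (trace_sum t Y)\<^sup>2 - 3 * trace_sum t Y"
    unfolding \<epsilon> by (simp add: power2_eq_square algebra_simps)
  finally have T2: "(trace_sum t y)\<^sup>2 = 1 + trace_sum t Y + (trace_sum t Y)\<^sup>2" using three by simp
  have shifted: "X ^ q + X + (trace_sum t Y)\<^sup>2 + trace_sum t Y = - (a ^ q + a + 1)"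
    using eq unfolding T2 X_def frob_diff by (simp add: algebra_simps eq_neg_iff_add_eq_0)
  \<comment> \<open>the constant term lies in \<open>K\<close> and has positive value at \<open>P\<close>, hence vanishes\<close>
  have TY: "vge P 1 (trace_sum t Y)" by (rule trace_sum_vge[OF P PY]) simp
  have "vge P 1 (X ^ q)" using vge_mono[OF vge_power[OF P PX, of q], of 1] q_ge by simp
  moreover have "vge P 1 ((trace_sum t Y)\<^sup>2)" using vge_mono[OF vge_power[OF P TY, of 2], of 1] by simp
  ultimately have "vge P 1 (- (a ^ q + a + 1))"
    unfolding shifted[symmetric] using PX TY by (intro vge_add[OF P])
  then have "vge P 1 (a ^ q + a + 1)" unfolding vge_uminus[OF P] .
  moreover have "a ^ q + a + 1 \<in> K"
    using a(1) by (intro subring_add[OF K_ring] subring_power[OF K_ring] subring_1[OF K_ring])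
  then have "P (a ^ q + a + 1) = 0" by (rule place_const[OF P])
  ultimately have "a ^ q + a + 1 = 0" by (simp add: vge_def)
  then have curve: "X ^ q + X + (trace_sum t Y)\<^sup>2 + trace_sum t Y = 0" using shifted by simp
  have "\<epsilon> \<in> K"
    unfolding \<epsilon>_def trace_sum_def using b(1) by (intro subring_sum[OF K_ring] subring_power[OF K_ring])
  then have "- \<epsilon> \<in> adjoin K {X, Y}" "a \<in> adjoin K {X, Y}" "b \<in> adjoin K {X, Y}"
    using subring_uminus[OF K_ring] a(1) b(1) adjoin_base by blast+
  moreover have "X \<in> adjoin K {X, Y}" "Y \<in> adjoin K {X, Y}" using adjoin_gen by blast+
  moreover note ring = subfield_subring[OF subfield_adjoin, of K "{X, Y}"]
  ultimately have "X + a \<in> adjoin K {X, Y} \<and> b + (- \<epsilon>) * Y \<in> adjoin K {X, Y}"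
    by (intro conjI subring_add[OF ring] subring_mult[OF ring])
  then have "x \<in> adjoin K {X, Y}" "y \<in> adjoin K {X, Y}"
    unfolding yY[symmetric] by (simp_all add: X_def)
  then have "adjoin K {x, y} \<subseteq> adjoin K {X, Y}"
    using adjoin_base by (intro adjoin_least subfield_adjoin) auto
  then have "adjoin K {X, Y} = UNIV" using gen by blast
  then interpret curve K t q m X Y P
    using assms(3) curve P PX PY by unfold_locales
  show ?thesis by (rule semigroup_at_P)
qed

end
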